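(* Let $\pi : E \to B$ be a metric fibration and let $F=\pi^{-1}(b)$ (for some $b\in B$) be its fiber. Then for every $\ell\in\mathbb{R}_{\ge0}$ there is a homotopy equivalence $|\mathsf{M}^{\ell}_\bullet(E)| \simeq |\mathsf{M}^{\ell}_\bullet(F\times B)|$.
   Context: Metric fibration: a Lipschitz map $\pi:E\to B$ of metric spaces such that for all $x\in E$ and $b\in B$ there is a unique point $x^b\in\pi^{-1}(b)$ satisfying (1) $d(x,x^b)=d(\pi x,b)$ and (2) $d(x,y)=d(x,x^b)+d(x^b,y)$ for all $y\in\pi^{-1}(b)$. The fiber of $\pi$ is $\pi^{-1}(b)$ with the restricted metric, for a point $b\in B$ (all fibers are isometric). The product $F\times B$ has the metric $d((f,b),(f',b'))=d(f,f')+d(b,b')$. Hepworth–Willerton simplicial set: for a metric space $X$ and $\ell\in\mathbb{R}_{\ge0}$, $\mathsf{M}^\ell_\bullet(X)$ is the pointed simplicial set with $\mathsf{M}^\ell_n(X)=\{(x_0,\dots,x_n)\in X^{n+1}\mid \sum_{i=0}^{n-1}d(x_i,x_{i+1})=\ell\}\cup\{\ast\}$ (base point $\ast$, disjoint from the tuples; consecutive entries may coincide). Face maps: $d_i(\ast)=\ast$, and $d_i(x_0,\dots,x_n)=(x_0,\dots,\hat{x}_i,\dots,x_n)$ if the tuple obtained by deleting $x_i$ still has total length $\ell$ (for $1\le i\le n-1$ this means $d(x_{i-1},x_{i+1})=d(x_{i-1},x_i)+d(x_i,x_{i+1})$; for $i=0$ it means $x_0=x_1$; for $i=n$ it means $x_{n-1}=x_n$),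 and $d_i(x_0,\dots,x_n)=\ast$ otherwise. Degeneracies: $s_i(\ast)=\ast$, $s_i(x_0,\dots,x_n)=(x_0,\dots,x_i,x_i,\dots,x_n)$. $|\cdot|$ denotes geometric realization. *)

theory Defs
  imports "HOL-Analysis.Analysis" "HOL-Homology.Simplices"
begin

section \<open>Metric fibrations\<close>

definition fiber :: "'e metric \<Rightarrow> ('e \<Rightarrow> 'b) \<Rightarrow> 'b \<Rightarrow> 'e metric" where
  "fiber E p b = submetric E {x \<in> mspace E. p x = b}"

text \<open>The Lipschitz constant is arbitrary; the lifting conditions force it to be at most 1.\<close>

definition metric_fibration :: "'e metric \<Rightarrow> 'b metric \<Rightarrow> ('e \<Rightarrow> 'b) \<Rightarrow> bool" where
  "metric_fibration E B p \<longleftrightarrow>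
     Lipschitz_continuous_map E B p \<and>
     (\<forall>x \<in> mspace E. \<forall>b \<in> mspace B. \<exists>!x'. x' \<in> mspace (fiber E p b) \<and>
        mdist E x x' = mdist B (p x) b \<and>
        (\<forall>y \<in> mspace (fiber E p b). mdist E x y = mdist E x x' + mdist E x' y))"

text \<open>The library's \<^const>\<open>prod_metric\<close> is the Euclidean product; here distances are added.\<close>

definition l1_prod_metric :: "'a metric \<Rightarrow> 'b metric \<Rightarrow> ('a \<times> 'b) metric" where
  "l1_prod_metric X Y =
     metric (mspace X \<times> mspace Y, \<lambda>(x, y) (x', y'). mdist X x x' + mdist Y y y')"

lemma Metric_space_l1_prod:
  "Metric_space (mspace X \<times> mspace Y) (\<lambda>(x, y) (x', y'). mdist X x x' + mdist Y y y')"
proof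
  show "0 \<le> (case p of (x, y) \<Rightarrow> \<lambda>(x', y'). mdist X x x' + mdist Y y y') q" for p q
    by (auto split: prod.split)
  show "(case p of (x, y) \<Rightarrow> \<lambda>(x', y'). mdist X x x' + mdist Y y y') q =
        (case q of (x, y) \<Rightarrow> \<lambda>(x', y'). mdist X x x' + mdist Y y y') p" for p q
    by (auto simp: mdist_commute split: prod.split)
  show "(case p of (x, y) \<Rightarrow> \<lambda>(x', y'). mdist X x x' + mdist Y y y') q = 0 \<longleftrightarrow> p = q"
    if "p \<in> mspace X \<times> mspace Y" "q \<in> mspace X \<times> mspace Y" for p q
    using that by (auto simp: add_nonneg_eq_0_iff)
  show "(case p of (x, y) \<Rightarrow> \<lambda>(x', y'). mdist X x x' + mdist Y y y') r \<le>
        (case p of (x, y) \<Rightarrow> \<lambda>(x', y'). mdist X x x' + mdist Y y y') q +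
        (case q of (x, y) \<Rightarrow> \<lambda>(x', y'). mdist X x x' + mdist Y y y') r"
    if "p \<in> mspace X \<times> mspace Y" "q \<in> mspace X \<times> mspace Y" "r \<in> mspace X \<times> mspace Y"
    for p q r
  proof -
    obtain p1 p2 q1 q2 r1 r2 where "p = (p1, p2)" "q = (q1, q2)" "r = (r1, r2)"
      by (metis surj_pair)
    with that mdist_triangle[of p1 X q1 r1] mdist_triangle[of p2 Y q2 r2] show ?thesis
      by auto
  qed
qed

lemma mspace_l1_prod_metric [simp]: "mspace (l1_prod_metric X Y) = mspace X \<times> mspace Y"
  by (simp add: l1_prod_metric_def Metric_space.mspace_metric[OF Metric_space_l1_prod])

lemma mdist_l1_prod_metric [simp]:
  "mdist (l1_prod_metric X Y) (x, y) (x', y') = mdist X x x' + mdist Y y y'"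
  by (simp add: l1_prod_metric_def Metric_space.mdist_metric[OF Metric_space_l1_prod])


section \<open>Simplicial sets and geometric realization\<close>

text \<open>\<open>sface S n i\<close> acts on \<open>n\<close>-simplices with \<open>1 \<le> n\<close> and \<open>i \<le> n\<close>; \<open>sdegen S n i\<close> acts on
  \<open>n\<close>-simplices with \<open>i \<le> n\<close>. Values elsewhere are irrelevant.\<close>

record 's sset =
  ssimplices :: "nat \<Rightarrow> 's set"
  sface :: "nat \<Rightarrow> nat \<Rightarrow> 's \<Rightarrow> 's"
  sdegen :: "nat \<Rightarrow> nat \<Rightarrow> 's \<Rightarrow> 's"

definition simplicial_set :: "'s sset \<Rightarrow> bool" where
  "simplicial_set S \<longleftrightarrow>
     (\<forall>n i x. x \<in> ssimplices S n \<and> 1 \<le> n \<and> i \<le> n \<longrightarrow> sface S n i x \<in> ssimplices S (n - 1)) \<and>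
     (\<forall>n i x. x \<in> ssimplices S n \<and> i \<le> n \<longrightarrow> sdegen S n i x \<in> ssimplices S (Suc n)) \<and>
     (\<forall>n i j x. x \<in> ssimplices S n \<and> 2 \<le> n \<and> i < j \<and> j \<le> n \<longrightarrow>
        sface S (n - 1) i (sface S n j x) = sface S (n - 1) (j - 1) (sface S n i x)) \<and>
     (\<forall>n i j x. x \<in> ssimplices S n \<and> i < j \<and> j \<le> n \<longrightarrow>
        sface S (Suc n) i (sdegen S n j x) = sdegen S (n - 1) (j - 1) (sface S n i x)) \<and>
     (\<forall>n j x. x \<in> ssimplices S n \<and> j \<le> n \<longrightarrow>
        sface S (Suc n) j (sdegen S n j x) = x \<and> sface S (Suc n) (Suc j) (sdegen S n j x) = x) \<and>
     (\<forall>n i j x. x \<in> ssimplices S n \<and> Suc j < i \<and> i \<le> Suc n \<longrightarrow>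
        sface S (Suc n) i (sdegen S n j x) = sdegen S (n - 1) j (sface S n (i - 1) x)) \<and>
     (\<forall>n i j x. x \<in> ssimplices S n \<and> i \<le> j \<and> j \<le> n \<longrightarrow>
        sdegen S (Suc n) i (sdegen S n j x) = sdegen S (Suc n) (Suc j) (sdegen S n i x))"

definition quotient_topology :: "'a topology \<Rightarrow> ('a \<Rightarrow> 'b) \<Rightarrow> 'b topology" where
  "quotient_topology X q =
     topology (\<lambda>U. U \<subseteq> q ` topspace X \<and> openin X {x \<in> topspace X. q x \<in> U})"

lemma openin_quotient_topology:
  "openin (quotient_topology X q) U \<longleftrightarrow>
     U \<subseteq> q ` topspace X \<and> openin X {x \<in> topspace X. q x \<in> U}"
proof -
  have 1: "{x \<in> topspace X. q x \<in> S \<inter> T} =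
           {x \<in> topspace X. q x \<in> S} \<inter> {x \<in> topspace X. q x \<in> T}" for S T
    by auto
  have 2: "{x \<in> topspace X. q x \<in> \<Union>\<K>} = (\<Union>K\<in>\<K>. {x \<in> topspace X. q x \<in> K})" for \<K>
    by auto
  have "istopology (\<lambda>U. U \<subseteq> q ` topspace X \<and> openin X {x \<in> topspace X. q x \<in> U})"
    unfolding istopology_def 1 2 by blast
  then show ?thesis
    by (simp add: quotient_topology_def)
qed

lemma topspace_quotient_topology [simp]:
  "topspace (quotient_topology X q) = q ` topspace X"
proof -
  have "{x \<in> topspace X. q x \<in> q ` topspace X} = topspace X"
    by auto
  then have "openin (quotient_topology X q) (q ` topspace X)"
    by (simp add: openin_quotient_topology)
  moreover have "topspace (quotient_topology X q) \<subseteq> q ` topspace X"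
    by (metis openin_quotient_topology openin_topspace)
  ultimately show ?thesis
    by (simp add: openin_subset subset_antisym)
qed

lemma quotient_map_quotient_topology: "quotient_map X (quotient_topology X q) q"
  by (simp add: quotient_map_def openin_quotient_topology)

text \<open>The degeneracy counterpart of the library's coface map \<^const>\<open>simplical_face\<close>: it adds the
  barycentric coordinates \<open>k\<close> and \<open>k + 1\<close>.\<close>

definition simplicial_collapse :: "nat \<Rightarrow> (nat \<Rightarrow> real) \<Rightarrow> nat \<Rightarrow> real" where
  "simplicial_collapse k t =
     (\<lambda>i. if i < k then t i else if i = k then t k + t (Suc k) else t (Suc i))"

text \<open>A point of the disjoint union of the \<open>X\<^sub>n \<times> \<Delta>\<^sup>n\<close> is a triple \<open>(n, x, t)\<close>.\<close>

definition prerealization :: "'s sset \<Rightarrow> (nat \<times> 's \<times> (nat \<Rightarrow> real)) topology" where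
  "prerealization S =
     sum_topology
       (\<lambda>n. prod_topology (discrete_topology (ssimplices S n))
              (subtopology (powertop_real UNIV) (standard_simplex n)))
       UNIV"

inductive realization_glue ::
  "'s sset \<Rightarrow> nat \<times> 's \<times> (nat \<Rightarrow> real) \<Rightarrow> nat \<times> 's \<times> (nat \<Rightarrow> real) \<Rightarrow> bool"
  for S where
  face: "\<lbrakk>x \<in> ssimplices S (Suc n); i \<le> Suc n; t \<in> standard_simplex n\<rbrakk> \<Longrightarrow>
     realization_glue S (n, sface S (Suc n) i x, t) (Suc n, x, simplical_face i t)"
| degen: "\<lbrakk>x \<in> ssimplices S n; i \<le> n; t \<in> standard_simplex (Suc n)\<rbrakk> \<Longrightarrow>
     realization_glue S (Suc n, sdegen S n i x, t) (n, x, simplicial_collapse i t)"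

definition geometric_realization ::
  "'s sset \<Rightarrow> (nat \<times> 's \<times> (nat \<Rightarrow> real)) set topology" where
  "geometric_realization S =
     quotient_topology (prerealization S) (\<lambda>u. {v. equivclp (realization_glue S) u v})"


section \<open>The Hepworth--Willerton simplicial set\<close>

definition path_len :: "'a metric \<Rightarrow> 'a list \<Rightarrow> real" where
  "path_len X xs = (\<Sum>i < length xs - 1. mdist X (xs ! i) (xs ! Suc i))"

definition delete_nth :: "nat \<Rightarrow> 'a list \<Rightarrow> 'a list" where
  "delete_nth i xs = take i xs @ drop (Suc i) xs"

definition repeat_nth :: "nat \<Rightarrow> 'a list \<Rightarrow> 'a list" where
  "repeat_nth i xs = take (Suc i) xs @ drop i xs"

text \<open>The base point is \<^term>\<open>None\<close> in every degree, and the tuple \<open>(x\<^sub>0, \<dots>, x\<^sub>n)\<close> is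
  \<open>Some [x\<^sub>0, \<dots>, x\<^sub>n]\<close>.\<close>

definition HW_sset :: "'a metric \<Rightarrow> real \<Rightarrow> 'a list option sset" where
  "HW_sset X l = \<lparr>
     ssimplices = (\<lambda>n. insert None
       (Some ` {xs. length xs = Suc n \<and> set xs \<subseteq> mspace X \<and> path_len X xs = l})),
     sface = (\<lambda>n i \<sigma>. case \<sigma> of None \<Rightarrow> None
       | Some xs \<Rightarrow> if path_len X (delete_nth i xs) = l then Some (delete_nth i xs) else None),
     sdegen = (\<lambda>n i \<sigma>. map_option (repeat_nth i) \<sigma>) \<rparr>"

lemma length_delete_nth: "i < length xs \<Longrightarrow> length (delete_nth i xs) = length xs - 1"
  by (auto simp: delete_nth_def)

lemma length_repeat_nth: "i < length xs \<Longrightarrow> length (repeat_nth i xs) = Suc (length xs)"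
  by (auto simp: repeat_nth_def)

lemma nth_delete_nth:
  "\<lbrakk>i < length xs; k < length xs - 1\<rbrakk> \<Longrightarrow>
     delete_nth i xs ! k = xs ! (if k < i then k else Suc k)"
  by (auto simp: delete_nth_def nth_append min_def)

lemma nth_repeat_nth:
  "\<lbrakk>i < length xs; k \<le> length xs\<rbrakk> \<Longrightarrow> repeat_nth i xs ! k = xs ! (if k \<le> i then k else k - 1)"
  by (auto simp: repeat_nth_def nth_append min_def not_less Suc_le_eq intro!: arg_cong[of _ _ "nth xs"])

lemma set_delete_nth: "set (delete_nth i xs) \<subseteq> set xs"
  by (auto simp: delete_nth_def dest: in_set_takeD in_set_dropD)

lemma set_repeat_nth: "set (repeat_nth i xs) \<subseteq> set xs"
  by (auto simp: repeat_nth_def dest: in_set_takeD in_set_dropD)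

lemma path_len_simps [simp]:
  "path_len X [] = 0" "path_len X [x] = 0"
  "path_len X (x # y # ys) = mdist X x y + path_len X (y # ys)"
proof -
  show "path_len X (x # y # ys) = mdist X x y + path_len X (y # ys)"
    unfolding path_len_def length_Cons diff_Suc_1 sum.lessThan_Suc_shift by simp
qed (auto simp: path_len_def)

lemma path_len_nonneg: "0 \<le> path_len X xs"
  by (simp add: path_len_def sum_nonneg)

lemma path_len_delete_nth_le:
  "set xs \<subseteq> mspace X \<Longrightarrow> path_len X (delete_nth i xs) \<le> path_len X xs"
proof (induction xs arbitrary: i)
  case Nil
  then show ?case by (simp add: delete_nth_def)
next
  case (Cons x xs)
  show ?case
  proof (cases xs)
    case Nil
    then show ?thesis by (cases i) (auto simp: delete_nth_def)
  next
    case xs: (Cons y ys)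
    consider "i = 0" | "i = 1" | j where "i = Suc (Suc j)"
      by (metis One_nat_def not0_implies_Suc)
    then show ?thesis
    proof cases
      case 1
      then show ?thesis by (simp add: xs delete_nth_def)
    next
      case 2
      show ?thesis
      proof (cases ys)
        case Nil
        then show ?thesis using 2 by (simp add: xs delete_nth_def)
      next
        case (Cons z zs)
        then show ?thesis
          using 2 Cons.prems mdist_triangle[of x X y z] by (simp add: xs delete_nth_def)
      qed
    next
      case 3
      then show ?thesis
        using Cons.IH[of "Suc j"] Cons.prems by (simp add: xs delete_nth_def)
    qed
  qed
qed

lemma path_len_repeat_nth:
  "\<lbrakk>i < length xs; set xs \<subseteq> mspace X\<rbrakk> \<Longrightarrow> path_len X (repeat_nth i xs) = path_len X xs"
proof (induction xs arbitrary: i)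
  case (Cons x xs)
  show ?case
  proof (cases i)
    case 0
    then show ?thesis using Cons.prems by (simp add: repeat_nth_def)
  next
    case (Suc j)
    then obtain y ys where xs: "xs = y # ys"
      using Cons.prems by (cases xs) auto
    then show ?thesis
      using Cons.IH[of j] Cons.prems Suc by (simp add: repeat_nth_def)
  qed
qed simp

lemma ssimplices_HW_cases:
  assumes "x \<in> ssimplices (HW_sset X l) n"
  obtains "x = None"
  | xs where "x = Some xs" "length xs = Suc n" "set xs \<subseteq> mspace X" "path_len X xs = l"
  using assms by (auto simp: HW_sset_def)

lemma HW_sset_simps:
  "None \<in> ssimplices (HW_sset X l) n"
  "Some xs \<in> ssimplices (HW_sset X l) n \<longleftrightarrow>
     length xs = Suc n \<and> set xs \<subseteq> mspace X \<and> path_len X xs = l"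
  "sface (HW_sset X l) n i None = None"
  "sface (HW_sset X l) n i (Some xs) =
     (if path_len X (delete_nth i xs) = l then Some (delete_nth i xs) else None)"
  "sdegen (HW_sset X l) n i None = None"
  "sdegen (HW_sset X l) n i (Some xs) = Some (repeat_nth i xs)"
  by (auto simp: HW_sset_def)

lemma simplicial_set_HW_sset: "simplicial_set (HW_sset X l)"
proof -
  have dd: "delete_nth i (delete_nth j xs) = delete_nth (j - 1) (delete_nth i xs)"
    if "i < j" "j < length xs" for i j and xs :: "'a list"
    using that by (intro nth_equalityI) (auto simp: length_delete_nth nth_delete_nth)
  have ds: "delete_nth i (repeat_nth j xs) = repeat_nth (j - 1) (delete_nth i xs)"
    if "i < j" "j < length xs" for i j and xs :: "'a list"
    using that
    by (intro nth_equalityI)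
      (auto simp: length_delete_nth nth_delete_nth length_repeat_nth nth_repeat_nth)
  have ds_id: "delete_nth j (repeat_nth j xs) = xs" "delete_nth (Suc j) (repeat_nth j xs) = xs"
    if "j < length xs" for j and xs :: "'a list"
    using that
    by (intro nth_equalityI;
        simp add: length_delete_nth nth_delete_nth length_repeat_nth nth_repeat_nth)+
  have ds': "delete_nth i (repeat_nth j xs) = repeat_nth j (delete_nth (i - 1) xs)"
    if "Suc j < i" "i \<le> length xs" for i j and xs :: "'a list"
    using that
    by (intro nth_equalityI)
      (auto simp: length_delete_nth nth_delete_nth length_repeat_nth nth_repeat_nth)
  have ss: "repeat_nth i (repeat_nth j xs) = repeat_nth (Suc j) (repeat_nth i xs)"
    if "i \<le> j" "j < length xs" for i j and xs :: "'a list"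
    using that
    by (intro nth_equalityI)
      (auto simp: length_repeat_nth nth_repeat_nth)
  have sub: "set (delete_nth i xs) \<subseteq> mspace X" "set (repeat_nth i xs) \<subseteq> mspace X"
    if "set xs \<subseteq> mspace X" for i xs
    using that set_delete_nth set_repeat_nth by (meson order_trans)+
  have len_dd: "path_len X (delete_nth i xs) = path_len X xs"
    if "path_len X (delete_nth j (delete_nth i xs)) = path_len X xs" "set xs \<subseteq> mspace X"
    for i j xs
    using that path_len_delete_nth_le[of xs X i] path_len_delete_nth_le[of "delete_nth i xs" X j]
      sub(1)[of xs i] by linarith
  have len_sd: "path_len X (repeat_nth j (delete_nth i xs)) = path_len X (delete_nth i xs)"
    if "j < length xs - 1" "i < length xs" "set xs \<subseteq> mspace X" for i j xs
    using that by (simp add: path_len_repeat_nth length_delete_nth sub)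
  have closed_face: "sface (HW_sset X l) n i x \<in> ssimplices (HW_sset X l) (n - 1)"
    if "x \<in> ssimplices (HW_sset X l) n" "1 \<le> n" "i \<le> n" for n i x
    using that(1)
  proof (cases rule: ssimplices_HW_cases)
    case (2 xs)
    with that show ?thesis by (simp add: HW_sset_simps length_delete_nth sub)
  qed (simp add: HW_sset_simps)
  have closed_degen: "sdegen (HW_sset X l) n i x \<in> ssimplices (HW_sset X l) (Suc n)"
    if "x \<in> ssimplices (HW_sset X l) n" "i \<le> n" for n i x
    using that(1)
  proof (cases rule: ssimplices_HW_cases)
    case (2 xs)
    with that show ?thesis
      by (simp add: HW_sset_simps length_repeat_nth path_len_repeat_nth sub)
  qed (simp add: HW_sset_simps)
  have id1: "sface (HW_sset X l) (n - 1) i (sface (HW_sset X l) n j x) =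
      sface (HW_sset X l) (n - 1) (j - 1) (sface (HW_sset X l) n i x)"
    if x: "x \<in> ssimplices (HW_sset X l) n" and "2 \<le> n" "i < j" "j \<le> n" for n i j x
    using x
  proof (cases rule: ssimplices_HW_cases)
    case (2 xs)
    have "sface (HW_sset X l) m i' (sface (HW_sset X l) m' j' (Some xs)) =
      (if path_len X (delete_nth i' (delete_nth j' xs)) = l
       then Some (delete_nth i' (delete_nth j' xs)) else None)" for m m' i' j'
      using 2 len_dd[of i' j' xs] by (simp add: HW_sset_simps)
    then show ?thesis
      using 2 that dd[of i j xs] by simp
  qed (simp add: HW_sset_simps)
  have id2: "sface (HW_sset X l) (Suc n) i (sdegen (HW_sset X l) n j x) =
      sdegen (HW_sset X l) (n - 1) (j - 1) (sface (HW_sset X l) n i x)"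
    if x: "x \<in> ssimplices (HW_sset X l) n" and "i < j" "j \<le> n" for n i j x
    using x
  proof (cases rule: ssimplices_HW_cases)
    case (2 xs)
    with that ds[of i j xs] len_sd[of "j - 1" xs i] show ?thesis
      by (simp add: HW_sset_simps)
  qed (simp add: HW_sset_simps)
  have id3: "sface (HW_sset X l) (Suc n) j (sdegen (HW_sset X l) n j x) = x \<and>
      sface (HW_sset X l) (Suc n) (Suc j) (sdegen (HW_sset X l) n j x) = x"
    if x: "x \<in> ssimplices (HW_sset X l) n" and "j \<le> n" for n j x
    using x
  proof (cases rule: ssimplices_HW_cases)
    case (2 xs)
    with that ds_id[of j xs] show ?thesis
      by (simp add: HW_sset_simps)
  qed (simp add: HW_sset_simps)
  have id4: "sface (HW_sset X l) (Suc n) i (sdegen (HW_sset X l) n j x) =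
      sdegen (HW_sset X l) (n - 1) j (sface (HW_sset X l) n (i - 1) x)"
    if x: "x \<in> ssimplices (HW_sset X l) n" and "Suc j < i" "i \<le> Suc n" for n i j x
    using x
  proof (cases rule: ssimplices_HW_cases)
    case (2 xs)
    with that ds'[of j i xs] len_sd[of j xs "i - 1"] show ?thesis
      by (simp add: HW_sset_simps)
  qed (simp add: HW_sset_simps)
  have id5: "sdegen (HW_sset X l) (Suc n) i (sdegen (HW_sset X l) n j x) =
      sdegen (HW_sset X l) (Suc n) (Suc j) (sdegen (HW_sset X l) n i x)"
    if x: "x \<in> ssimplices (HW_sset X l) n" and "i \<le> j" "j \<le> n" for n i j x
    using x
  proof (cases rule: ssimplices_HW_cases)
    case (2 xs)
    with that ss[of i j xs] show ?thesis
      by (simp add: HW_sset_simps)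
  qed (simp add: HW_sset_simps)
  show ?thesis
    unfolding simplicial_set_def
    by (intro conjI allI impI; (elim conjE)?)
       (fact closed_face closed_degen id1 id2 id3[THEN conjunct1] id3[THEN conjunct2] id4 id5
         | (rule closed_face closed_degen id1 id2 id3[THEN conjunct1] id3[THEN conjunct2] id4 id5; assumption))+
qed

end

theory Submission
  imports Defs
begin

text \<open>
  A step \<open>x, z\<close> of a tuple in \<open>E\<close> factors through the transport \<open>x\<^bsup>\<pi> z\<^esup>\<close> into a base move
  followed by a fiber move, and this factorization is geodesic. Let \<open>D\<close> consist of the tuples in
  which some base move occurs before (or in the same step as) some fiber move. Faces preserve this,
  and inserting or deleting the transport at the first such place is an acyclic matching on the
  nondegenerate tuples of \<open>D\<close>. Going through the cells in an order adapted to the matching, one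
  extends the identity of the realization to a homotopy that preserves \<open>D\<close> and contracts it to the
  base point: over an unmatched cell by homotopy extension, over a matched pair by contracting along
  the horn that omits the free face. Hence collapsing \<open>D\<close> is a homotopy equivalence.

  The remaining tuples first move in the fiber and then in the base. Transporting the fiber
  coordinate along the base path identifies them with the corresponding tuples of \<open>F \<times> B\<close>, and
  holonomy, which distinguishes \<open>E\<close> from \<open>F \<times> B\<close>, only affects faces that lie in \<open>D\<close>. So both
  realizations are equivalent to the same collapse.
\<close>

section \<open>Standard simplices\<close>

text \<open>Contracting D in itself would not make the collapse an equivalence: the contraction has
  to extend over all cells and map D into D at every time. Being constant on D at time 1 makes the
  end map factor through the quotient; preserving D makes the homotopy descend to it. Both demands
  are met at once, cell by cell. Distances may be arbitrarily small, so the dimensions of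
  nondegenerate tuples need not be bounded, and acyclicity is not a matter of counting cells. It
  comes from three numbers attached to each tuple: base moves, fiber moves, and pairs of a fiber
  move in an earlier step than a base move. A length-preserving deletion lowers them
  lexicographically unless it removes a repetition or merges a base move with the fiber move after
  it; the latter is the shape of the matching. Base moves are counted first because merging two
  horizontal steps can create a fiber move by holonomy. Since the product is itself a metric
  fibration, one collapse theorem serves both sides.\<close>

abbreviation simplex_space :: "nat \<Rightarrow> (nat \<Rightarrow> real) topology" where
  "simplex_space n \<equiv> subtopology (powertop_real UNIV) (standard_simplex n)"

abbreviation unit_interval :: "real topology" where
  "unit_interval \<equiv> top_of_set {0..1}"

lemma standard_simplex_iff:
  "t \<in> standard_simplex n \<longleftrightarrow> (\<forall>i. 0 \<le> t i) \<and> (\<forall>i>n. t i = 0) \<and> (\<Sum>i\<le>n. t i) = 1"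
proof
  assume R: "(\<forall>i. 0 \<le> t i) \<and> (\<forall>i>n. t i = 0) \<and> (\<Sum>i\<le>n. t i) = 1"
  have "t i \<le> 1" for i
  proof (cases "i \<le> n")
    case True
    then show ?thesis
      using R member_le_sum[of i "{..n}" t] by auto
  qed (use R in auto)
  with R show "t \<in> standard_simplex n" by (simp add: standard_simplex_def)
qed (auto simp: standard_simplex_def)

lemma simplical_face_simplical_face:
  "i < j \<Longrightarrow> simplical_face j (simplical_face i t) = simplical_face i (simplical_face (j - 1) t)"
  by (auto simp: simplical_face_def fun_eq_iff)

lemma simplicial_collapse_simplical_face:
  "j < i \<Longrightarrow> simplicial_collapse i (simplical_face j t) = simplical_face j (simplicial_collapse (i - 1) t)"
  "simplicial_collapse i (simplical_face i t) = t"
  "simplicial_collapse i (simplical_face (Suc i) t) = t"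
  "Suc i < j \<Longrightarrow> simplicial_collapse i (simplical_face j t) = simplical_face (j - 1) (simplicial_collapse i t)"
  by (auto simp: simplical_face_def simplicial_collapse_def fun_eq_iff)

lemma simplicial_collapse_simplicial_collapse:
  "i < j \<Longrightarrow> simplicial_collapse i (simplicial_collapse j t) = simplicial_collapse (j - 1) (simplicial_collapse i t)"
  by (auto simp: simplicial_collapse_def fun_eq_iff)

text \<open>Parametrises the wall \<open>t j = 0\<close> by a simplex of one dimension less: there
  the collapse inverts the coface.\<close>

lemma simplical_face_collapse: "t j = 0 \<Longrightarrow> simplical_face j (simplicial_collapse j t) = t"
  by (auto simp: simplical_face_def simplicial_collapse_def fun_eq_iff)

lemma simplical_face_nth [simp]: "simplical_face j t j = 0"
  by (simp add: simplical_face_def)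

lemma sum_simplicial_collapse:
  fixes t :: "nat \<Rightarrow> real"
  assumes "k \<le> n"
  shows "(\<Sum>i\<le>n. simplicial_collapse k t i) = (\<Sum>i\<le>Suc n. t i)"
  using assms
proof (induction n rule: dec_induct)
  case base
  have "(\<Sum>i\<in>{..<k}. simplicial_collapse k t i) = sum t {..<k}"
    by (rule sum.cong) (auto simp: simplicial_collapse_def)
  then show ?case
    by (simp add: simplicial_collapse_def flip: lessThan_Suc_atMost)
next
  case (step n)
  then show ?case by (simp add: simplicial_collapse_def)
qed

lemma simplicial_collapse_in_standard_simplex:
  assumes "t \<in> standard_simplex (Suc n)" "k \<le> n"
  shows "simplicial_collapse k t \<in> standard_simplex n"
proof -
  have "simplicial_collapse k t i = 0" if "n < i" for i
    using assms that by (auto simp: standard_simplex_iff simplicial_collapse_def)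
  moreover have "0 \<le> simplicial_collapse k t i" for i
    using assms by (auto simp: standard_simplex_iff simplicial_collapse_def)
  ultimately show ?thesis
    using assms sum_simplicial_collapse[of k n t] by (auto simp: standard_simplex_iff)
qed

text \<open>The vanishing coordinate admits the extra index \<open>k = Suc n\<close>: collapsing
  there leaves \<open>t\<close> unchanged, and \<open>t\<close> already lies in the smaller
  simplex.\<close>

lemma simplicial_collapse_in_standard_simplex_zero:
  assumes "t \<in> standard_simplex (Suc n)" "t k = 0" "k \<le> Suc n"
  shows "simplicial_collapse k t \<in> standard_simplex n"
proof (cases "k = Suc n")
  case True
  have "simplicial_collapse k t = t"
    using assms True by (auto simp: standard_simplex_iff simplicial_collapse_def fun_eq_iff)
  then show ?thesis
    using assms True by (auto simp: standard_simplex_iff) (metis Suc_lessI)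
qed (use assms simplicial_collapse_in_standard_simplex in force)

lemma simplical_face_in_standard_simplex_Suc:
  "\<lbrakk>t \<in> standard_simplex n; k \<le> Suc n\<rbrakk> \<Longrightarrow> simplical_face k t \<in> standard_simplex (Suc n)"
  using simplical_face_in_standard_simplex[of "Suc n" k t] by simp

lemma continuous_map_into_simplex_space:
  assumes "\<And>i. continuous_map X euclideanreal (\<lambda>x. f x i)"
    and "\<And>x. x \<in> topspace X \<Longrightarrow> f x \<in> standard_simplex n"
  shows "continuous_map X (simplex_space n) f"
  using assms by (auto simp: continuous_map_in_subtopology continuous_map_componentwise_UNIV)

lemma continuous_map_simplex_coordinate: "continuous_map (simplex_space n) euclideanreal (\<lambda>t. t i)"
  by (intro continuous_map_from_subtopology continuous_map_product_projection) auto

lemma continuous_map_simplical_face: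
  "k \<le> Suc n \<Longrightarrow> continuous_map (simplex_space n) (simplex_space (Suc n)) (simplical_face k)"
  by (rule continuous_map_into_simplex_space)
    (auto simp: simplical_face_def[abs_def] continuous_map_simplex_coordinate
      intro: simplical_face_in_standard_simplex_Suc[unfolded simplical_face_def])

lemma continuous_map_simplicial_collapse_coordinate:
  "continuous_map (simplex_space m) euclideanreal (\<lambda>t. simplicial_collapse k t i)"
  unfolding simplicial_collapse_def
  by (cases "i < k"; cases "i = k")
    (auto intro!: continuous_map_add continuous_map_simplex_coordinate)

lemma continuous_map_simplicial_collapse:
  "k \<le> n \<Longrightarrow> continuous_map (simplex_space (Suc n)) (simplex_space n) (simplicial_collapse k)"
  by (intro continuous_map_into_simplex_space continuous_map_simplicial_collapse_coordinate)
    (auto intro: simplicial_collapse_in_standard_simplex)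

section \<open>Extending maps over prisms by radial projection\<close>

lemma continuous_map_Min:
  fixes f :: "'i \<Rightarrow> 'a \<Rightarrow> real"
  assumes "finite J" "J \<noteq> {}" "\<And>j. j \<in> J \<Longrightarrow> continuous_map X euclideanreal (f j)"
  shows "continuous_map X euclideanreal (\<lambda>x. Min ((\<lambda>j. f j x) ` J))"
  using assms
proof (induction J rule: finite_ne_induct)
  case (insert j J)
  then have "continuous_map X euclideanreal (\<lambda>x. min (f j x) (Min ((\<lambda>j. f j x) ` J)))"
    by (intro continuous_map_real_min) auto
  then show ?case using insert by simp
qed auto

text \<open>Radial projection of the prism away from the point \<open>(c, z)\<close>, which sees the part of the
  boundary consisting of the walls indexed by \<open>J\<close> and the ends where \<open>w = 1\<close>; \<open>\<nu>\<close> is the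
  reciprocal of the dilation factor.\<close>

lemma prism_extension:
  fixes n :: nat and J :: "nat set" and z :: "nat \<Rightarrow> real" and w :: "real \<Rightarrow> real"
  assumes J: "J \<subseteq> {..n}" "J \<noteq> {}" and e: "0 < e"
    and z: "\<And>j. j \<in> J \<Longrightarrow> z j = e" "\<And>j. j \<notin> J \<Longrightarrow> z j \<le> 0" "\<And>j. n < j \<Longrightarrow> z j = 0"
      "(\<Sum>j\<le>n. z j) = 1"
    and w: "continuous_on {0..1} w" "\<And>s. s \<in> {0..1} \<Longrightarrow> w s \<le> 1"
    and w_end: "\<And>s. s \<in> {0..1} \<Longrightarrow> 0 < w s \<Longrightarrow> w (c + (s - c) / w s) = 1"
    and c: "\<And>s \<nu>. s \<in> {0..1} \<Longrightarrow> w s \<le> \<nu> \<Longrightarrow> 0 < \<nu> \<Longrightarrow> \<nu> \<le> 1 \<Longrightarrow> c + (s - c) / \<nu> \<in> {0..1}"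
    and pos: "\<And>s t. s \<in> {0..1} \<Longrightarrow> t \<in> standard_simplex n \<Longrightarrow> 0 < w s \<or> (\<exists>j\<in>J. t j < e)"
    and h: "continuous_map (subtopology (prod_topology unit_interval (simplex_space n))
              {(s, t). w s = 1 \<or> (\<exists>j\<in>J. t j = 0)}) Y h"
  obtains G where "continuous_map (prod_topology unit_interval (simplex_space n)) Y G"
    and "\<And>s t. \<lbrakk>s \<in> {0..1}; t \<in> standard_simplex n; w s = 1 \<or> (\<exists>j\<in>J. t j = 0)\<rbrakk> \<Longrightarrow> G (s, t) = h (s, t)"
proof -
  let ?X = "prod_topology unit_interval (simplex_space n)"
  let ?K = "{(s, t). w s = 1 \<or> (\<exists>j\<in>J. t j = 0)}"
  have fin: "finite J" using J finite_subset by blast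
  \<comment> \<open>A wall coordinate \<open>e + (t j - e) / \<nu>\<close> is nonnegative exactly
    when \<open>1 - t j / e \<le> \<nu>\<close>. The minimum over \<open>J\<close> gives the binding
    wall, \<open>w\<close> the binding end, and the maximum of the two bounds selects what the ray
    meets first.\<close>
  define m where "m t = Min ((\<lambda>j. t j) ` J)" for t :: "nat \<Rightarrow> real"
  define \<nu> where "\<nu> u = max (1 - m (snd u) / e) (w (fst u))" for u :: "real \<times> (nat \<Rightarrow> real)"
  define \<rho> where "\<rho> u = (c + (fst u - c) / \<nu> u, \<lambda>i. z i + (snd u i - z i) / \<nu> u)" for u
  have m_le: "m t \<le> t j" if "j \<in> J" for t j
    unfolding m_def using that fin by simp
  have m_attained: "\<exists>j\<in>J. m t = t j" for t
  proof -
    have "m t \<in> t ` J" unfolding m_def by (rule Min_in) (use fin J in auto)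
    then show ?thesis by (rule imageE) blast
  qed
  have m_nonneg: "0 \<le> m t" if "t \<in> standard_simplex n" for t
    using m_attained[of t] that by (auto simp: standard_simplex_iff)
  \<comment> \<open>Condition \<open>pos\<close> says that no point of the prism needs an infinite
    dilation.\<close>
  have \<nu>_pos: "0 < \<nu> u" if u: "u \<in> topspace ?X" for u
  proof -
    from u have su: "fst u \<in> {0..1}" "snd u \<in> standard_simplex n" by auto
    from pos[OF su] show ?thesis
    proof
      assume "\<exists>j\<in>J. snd u j < e"
      then have "m (snd u) < e" using m_le order_le_less_trans by blast
      then show ?thesis using e by (simp add: \<nu>_def less_max_iff_disj field_simps)
    qed (simp add: \<nu>_def less_max_iff_disj)
  qed
  have \<nu>_le: "\<nu> u \<le> 1" if "u \<in> topspace ?X" for u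
    using that m_nonneg[of "snd u"] w(2)[of "fst u"] e by (auto simp: \<nu>_def)
  have \<rho>_simplex: "snd (\<rho> u) \<in> standard_simplex n" if u: "u \<in> topspace ?X" for u
  proof -
    have su: "snd u \<in> standard_simplex n" using u by auto
    note v = \<nu>_pos[OF u] \<nu>_le[OF u]
    have "0 \<le> z i + (snd u i - z i) / \<nu> u" for i
    proof (cases "i \<in> J")
      case True
      have "(e - snd u i) / e \<le> \<nu> u"
        using m_le[OF True, of "snd u"] e by (simp add: \<nu>_def field_simps le_max_iff_disj)
      then show ?thesis using True e v z(1) by (simp add: field_simps)
    next
      case False
      \<comment> \<open>Here \<open>z i \<le> 0\<close>, so moving away from \<open>z\<close> cannot
        make this coordinate negative.\<close>
      have "z i * \<nu> u \<ge> z i" using v z(2)[OF False] mult_left_mono_neg[of "\<nu> u" 1 "z i"] by simp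
      moreover have "0 \<le> snd u i" using su by (simp add: standard_simplex_iff)
      ultimately show ?thesis using v by (simp add: field_simps)
    qed
    moreover have "(\<Sum>i\<le>n. z i + (snd u i - z i) / \<nu> u) = 1"
      using su z(4) by (simp add: standard_simplex_iff sum.distrib sum_subtractf flip: sum_divide_distrib)
    ultimately show ?thesis
      using su z(3) by (simp add: standard_simplex_iff \<rho>_def)
  qed
  have \<rho>_interval: "fst (\<rho> u) \<in> {0..1}" if u: "u \<in> topspace ?X" for u
    using c[of "fst u" "\<nu> u"] u \<nu>_pos[OF u] \<nu>_le[OF u] by (auto simp: \<rho>_def \<nu>_def)
  have \<rho>_K: "\<rho> u \<in> ?K" if u: "u \<in> topspace ?X" for u
  proof (cases "\<nu> u = w (fst u)")
    case True
    then show ?thesis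
      using w_end[of "fst u"] u \<nu>_pos[OF u] by (auto simp: \<rho>_def)
  next
    case False
    then have "\<nu> u = 1 - m (snd u) / e" by (simp add: \<nu>_def max_def split: if_splits)
    moreover obtain j where "j \<in> J" "m (snd u) = snd u j" using m_attained by blast
    ultimately have "e - snd u j = e * \<nu> u" using e by (simp add: field_simps)
    then have "snd (\<rho> u) j = 0"
      using \<open>j \<in> J\<close> z(1) \<nu>_pos[OF u] by (simp add: \<rho>_def field_simps)
    then show ?thesis using \<open>j \<in> J\<close> by (auto simp: case_prod_unfold)
  qed
  \<comment> \<open>On the visible boundary one of the two bounds already equals 1, so the
    projection fixes it.\<close>
  have \<rho>_id: "\<rho> u = u" if u: "u \<in> topspace ?X" "u \<in> ?K" for u
  proof -
    have "\<nu> u = 1"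
      using u \<nu>_le[OF u(1)] m_nonneg[of "snd u"] m_le[of _ "snd u"] e
      by (force simp: \<nu>_def case_prod_unfold)
    then show ?thesis by (simp add: \<rho>_def)
  qed
  have coord: "continuous_map ?X euclideanreal (\<lambda>u. snd u i)" for i
    using continuous_map_compose[OF continuous_map_snd continuous_map_simplex_coordinate[of n i], of unit_interval]
    by (simp add: o_def)
  have time: "continuous_map ?X euclideanreal fst"
    using continuous_map_fst[of unit_interval "simplex_space n"] continuous_map_into_fulltopology by blast
  have "continuous_map unit_interval euclideanreal w" using w by simp
  with continuous_map_fst have "continuous_map ?X euclideanreal (w \<circ> fst)"
    by (rule continuous_map_compose)
  then have "continuous_map ?X euclideanreal (\<lambda>u. w (fst u))"
    by (simp add: o_def)
  moreover have "continuous_map ?X euclideanreal (\<lambda>u. m (snd u))"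
    unfolding m_def using fin J(2) coord by (intro continuous_map_Min) auto
  ultimately have cont_\<nu>: "continuous_map ?X euclideanreal \<nu>"
    unfolding \<nu>_def using e
    by (intro continuous_map_real_max continuous_map_diff continuous_map_real_divide) auto
  have nz: "\<nu> u \<noteq> 0" if "u \<in> topspace ?X" for u using \<nu>_pos[OF that] by simp
  have "continuous_map ?X (prod_topology unit_interval (simplex_space n)) \<rho>"
    unfolding continuous_map_pairwise
  proof
    have "continuous_map ?X euclideanreal (fst \<circ> \<rho>)"
      unfolding \<rho>_def o_def fst_conv using nz
      by (intro continuous_map_add continuous_map_real_divide continuous_map_diff time cont_\<nu>) auto
    then show "continuous_map ?X unit_interval (fst \<circ> \<rho>)"
      using \<rho>_interval by (auto simp: continuous_map_in_subtopology)
    have "continuous_map ?X euclideanreal (\<lambda>u. snd (\<rho> u) i)" for i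
      unfolding \<rho>_def snd_conv using nz
      by (intro continuous_map_add continuous_map_real_divide continuous_map_diff coord cont_\<nu>) auto
    then show "continuous_map ?X (simplex_space n) (snd \<circ> \<rho>)"
      using \<rho>_simplex by (intro continuous_map_into_simplex_space) auto
  qed
  then have "continuous_map ?X (subtopology ?X ?K) \<rho>"
    using \<rho>_K by (simp add: continuous_map_in_subtopology Pi_iff)
  then have "continuous_map ?X Y (h \<circ> \<rho>)"
    using h by (rule continuous_map_compose)
  then show ?thesis
    by (rule that) (use \<rho>_id in auto)
qed

text \<open>The centre of projection lies at height 2 above the barycentre. The ray through
  \<open>(s, t)\<close> meets the bottom at \<open>\<nu> = 1 - s / 2\<close>; all walls are visible
  from there, the top end is not a target.\<close>

lemma prism_boundary_extension:
  assumes "continuous_map (subtopology (prod_topology unit_interval (simplex_space n))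
              {(s, t). s = 0 \<or> (\<exists>j\<in>{..n}. t j = 0)}) Y h"
  obtains (ext) G where "continuous_map (prod_topology unit_interval (simplex_space n)) Y G"
    and "\<And>s t. \<lbrakk>s \<in> {0..1}; t \<in> standard_simplex n; s = 0 \<or> (\<exists>j\<in>{..n}. t j = 0)\<rbrakk> \<Longrightarrow> G (s, t) = h (s, t)"
proof (rule prism_extension[where n = n and J = "{..n}" and e = "1 / real (Suc n)" and c = 2
        and z = "\<lambda>j. if j \<le> n then 1 / real (Suc n) else 0" and w = "\<lambda>s. 1 - s / 2" and Y = Y and h = h])
  show "continuous_on {0..1} (\<lambda>s::real. 1 - s / 2)"
    by (intro continuous_intros) auto
  show "1 - (2 + (s - 2) / (1 - s / 2)) / 2 = (1::real)" if "0 < 1 - s / 2" for s :: real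
    using that by (simp add: field_simps)
  show "2 + (s - 2) / \<nu> \<in> {0..1}"
    if "s \<in> {0..1}" "1 - s / 2 \<le> \<nu>" "0 < \<nu>" "\<nu> \<le> 1" for s \<nu> :: real
    using that by (auto simp: field_simps)
  show "continuous_map (subtopology (prod_topology unit_interval (simplex_space n))
          {(s, t). 1 - s / 2 = 1 \<or> (\<exists>j\<in>{..n}. t j = 0)}) Y h"
    using assms by simp
  show thesis
    if "continuous_map (prod_topology unit_interval (simplex_space n)) Y G"
      "\<And>s t. \<lbrakk>s \<in> {0..1}; t \<in> standard_simplex n; 1 - s / 2 = 1 \<or> (\<exists>j\<in>{..n}. t j = 0)\<rbrakk> \<Longrightarrow> G (s, t) = h (s, t)" for G
    using that(1) by (rule ext) (use that(2) in auto)
qed auto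

text \<open>The centre of projection lies at time 1/2 beyond face \<open>i\<close>, outside the
  simplex: coordinate -1 at \<open>i\<close> and \<open>2 / real n\<close> at the other
  \<open>n\<close> indices, with sum 1. From there both ends and every wall except \<open>i\<close>
  are visible, and \<open>\<bar>2 * s - 1\<bar>\<close> is the value of \<open>\<nu>\<close> at
  which a ray reaches an end.\<close>

lemma prism_horn_extension:
  assumes n: "1 \<le> n" and i: "i \<le> n"
    and "continuous_map (subtopology (prod_topology unit_interval (simplex_space n))
              {(s, t). s = 0 \<or> s = 1 \<or> (\<exists>j\<in>{..n} - {i}. t j = 0)}) Y h"
  obtains (ext) G where "continuous_map (prod_topology unit_interval (simplex_space n)) Y G"
    and "\<And>s t. \<lbrakk>s \<in> {0..1}; t \<in> standard_simplex n; s = 0 \<or> s = 1 \<or> (\<exists>j\<in>{..n} - {i}. t j = 0)\<rbrakk>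
           \<Longrightarrow> G (s, t) = h (s, t)"
proof (rule prism_extension[where n = n and J = "{..n} - {i}" and e = "2 / real n" and c = "1 / 2"
        and z = "\<lambda>j. if n < j then 0 else if j = i then -1 else 2 / real n" and w = "\<lambda>s. \<bar>2 * s - 1\<bar>"
        and Y = Y and h = h])
  have eq: "\<bar>2 * s - 1\<bar> = 1 \<longleftrightarrow> s = 0 \<or> s = 1" for s :: real by auto
  show "{..n} - {i} \<noteq> {}" using n by (cases "i = 0") auto
  have "(\<Sum>j\<le>n. if n < j then 0 else if j = i then -1 else 2 / real n) = (-1) + (\<Sum>j\<in>{..n} - {i}. 2 / real n)"
    using i by (subst sum.remove[of _ i]) (auto intro!: sum.cong)
  then show "(\<Sum>j\<le>n. if n < j then 0 else if j = i then -1 else 2 / real n) = 1"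
    using n i by simp
  show "continuous_on {0..1} (\<lambda>s::real. \<bar>2 * s - 1\<bar>)"
    by (intro continuous_intros)
  show "\<bar>2 * (1/2 + (s - 1/2) / \<bar>2 * s - 1\<bar>) - 1\<bar> = 1" if "0 < \<bar>2 * s - 1\<bar>" for s :: real
    using that by (cases "2 * s - 1 < 0") (simp_all add: field_simps)
  show "1/2 + (s - 1/2) / \<nu> \<in> {0..1}"
    if "s \<in> {0..1}" "\<bar>2 * s - 1\<bar> \<le> \<nu>" "0 < \<nu>" "\<nu> \<le> 1" for s \<nu> :: real
    using that by (auto simp: field_simps)
  show "0 < \<bar>2 * s - 1\<bar> \<or> (\<exists>j\<in>{..n} - {i}. t j < 2 / real n)"
    if "t \<in> standard_simplex n" for s :: real and t
  proof (rule ccontr)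
    \<comment> \<open>The \<open>n\<close> coordinates other than \<open>i\<close> would have total
      mass at least 2.\<close>
    assume "\<not> ?thesis"
    then have "(\<Sum>j\<in>{..n} - {i}. 2 / real n) \<le> (\<Sum>j\<in>{..n} - {i}. t j)"
      by (intro sum_mono) (auto simp: not_less)
    also have "\<dots> \<le> (\<Sum>j\<le>n. t j)"
      using that by (intro sum_mono2) (auto simp: standard_simplex_iff)
    finally show False using that n i by (simp add: standard_simplex_iff)
  qed
  show "continuous_map (subtopology (prod_topology unit_interval (simplex_space n))
          {(s, t). \<bar>2 * s - 1\<bar> = 1 \<or> (\<exists>j\<in>{..n} - {i}. t j = 0)}) Y h"
    using assms(3) unfolding eq by (simp add: disj_assoc)
  show thesis
    if "continuous_map (prod_topology unit_interval (simplex_space n)) Y G"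
      "\<And>s t. \<lbrakk>s \<in> {0..1}; t \<in> standard_simplex n; \<bar>2 * s - 1\<bar> = 1 \<or> (\<exists>j\<in>{..n} - {i}. t j = 0)\<rbrakk> \<Longrightarrow> G (s, t) = h (s, t)" for G
    using that(1) by (rule ext) (use that(2) eq in blast)
  show "\<bar>2 * s - 1\<bar> \<le> 1" if "s \<in> {0..1}" for s :: real
    using that by auto
qed (use n in \<open>simp_all split: if_splits\<close>)

section \<open>Maps out of a geometric realization\<close>

definition rpoint :: "'s sset \<Rightarrow> nat \<Rightarrow> 's \<Rightarrow> (nat \<Rightarrow> real) \<Rightarrow> (nat \<times> 's \<times> (nat \<Rightarrow> real)) set" where
  "rpoint S n x t = {v. equivclp (realization_glue S) (n, x, t) v}"

lemma rpoint_eqI: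
  assumes "realization_glue S (n, x, t) (m, y, u)"
  shows "rpoint S n x t = rpoint S m y u"
proof -
  have "equivclp (realization_glue S) (n, x, t) (m, y, u)"
    using assms by (rule r_into_equivclp)
  then show ?thesis
    unfolding rpoint_def by (blast intro: equivclp_sym equivclp_trans)
qed

lemma rpoint_face:
  "\<lbrakk>x \<in> ssimplices S (Suc n); i \<le> Suc n; t \<in> standard_simplex n\<rbrakk> \<Longrightarrow>
     rpoint S n (sface S (Suc n) i x) t = rpoint S (Suc n) x (simplical_face i t)"
  by (intro rpoint_eqI realization_glue.face)

lemma rpoint_degen:
  "\<lbrakk>x \<in> ssimplices S n; i \<le> n; t \<in> standard_simplex (Suc n)\<rbrakk> \<Longrightarrow>
     rpoint S (Suc n) (sdegen S n i x) t = rpoint S n x (simplicial_collapse i t)"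
  by (intro rpoint_eqI realization_glue.degen)

lemma topspace_prerealization:
  "topspace (prerealization S) = {(n, x, t). x \<in> ssimplices S n \<and> t \<in> standard_simplex n}"
  by (auto simp: prerealization_def)

lemma quotient_map_geometric_realization:
  "quotient_map (prerealization S) (geometric_realization S) (\<lambda>(n, x, t). rpoint S n x t)"
proof -
  have "(\<lambda>(n, x, t). rpoint S n x t) = (\<lambda>u. {v. equivclp (realization_glue S) u v})"
    by (auto simp: rpoint_def)
  then show ?thesis
    by (simp add: geometric_realization_def quotient_map_quotient_topology)
qed

lemma topspace_geometric_realization:
  "topspace (geometric_realization S) =
     {rpoint S n x t | n x t. x \<in> ssimplices S n \<and> t \<in> standard_simplex n}"
proof -
  have "topspace (geometric_realization S) =
      (\<lambda>(n, x, t). rpoint S n x t) ` {(n, x, t). x \<in> ssimplices S n \<and> t \<in> standard_simplex n}"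
    using quotient_imp_surjective_map[OF quotient_map_geometric_realization, of S]
    by (simp add: topspace_prerealization)
  then show ?thesis by (simp add: image_def) blast
qed

lemma continuous_map_rpoint:
  assumes "x \<in> ssimplices S n"
  shows "continuous_map (simplex_space n) (geometric_realization S) (rpoint S n x)"
proof -
  have "continuous_map (simplex_space n)
          (prod_topology (discrete_topology (ssimplices S n)) (simplex_space n)) (\<lambda>t. (x, t))"
    using assms by (intro continuous_map_pairedI) auto
  moreover have "continuous_map (prod_topology (discrete_topology (ssimplices S n)) (simplex_space n))
          (prerealization S) (\<lambda>y. (n, y))"
    unfolding prerealization_def by (rule continuous_map_component_injection) auto
  ultimately have "continuous_map (simplex_space n) (prerealization S) (\<lambda>t. (n, x, t))"
    using continuous_map_compose by (fastforce simp: o_def)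
  from continuous_map_compose[OF this quotient_imp_continuous_map[OF quotient_map_geometric_realization]]
  show ?thesis by (simp add: o_def)
qed

lemma openin_prerealization_cell:
  assumes "x \<in> ssimplices S n" "openin (simplex_space n) U"
  shows "openin (prerealization S) ({n} \<times> {x} \<times> U)"
proof -
  have "openin (prod_topology (discrete_topology (ssimplices S k)) (simplex_space k))
          {y. (k, y) \<in> {n} \<times> {x} \<times> U}" for k
  proof (cases "k = n")
    case True
    then have "{y. (k, y) \<in> {n} \<times> {x} \<times> U} = {x} \<times> U" by auto
    then show ?thesis
      using True assms by (simp add: openin_prod_Times_iff)
  qed auto
  moreover have "U \<subseteq> standard_simplex n"
    using openin_subset[OF assms(2)] by simp
  ultimately show ?thesis
    using assms(1) by (auto simp: prerealization_def openin_sum_topology)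
qed

text \<open>The parameter space \<open>Z\<close> is needed for homotopies; local compactness makes the
  product of the gluing map with \<open>Z\<close> a quotient map.\<close>

lemma realization_lift:
  assumes Z: "locally_compact_space Z" "Hausdorff_space Z"
    and cont: "\<And>n x. x \<in> ssimplices S n \<Longrightarrow> continuous_map (prod_topology Z (simplex_space n)) Y (F n x)"
    and face: "\<And>n i x s t. \<lbrakk>x \<in> ssimplices S (Suc n); i \<le> Suc n; s \<in> topspace Z; t \<in> standard_simplex n\<rbrakk>
      \<Longrightarrow> F n (sface S (Suc n) i x) (s, t) = F (Suc n) x (s, simplical_face i t)"
    and degen: "\<And>n i x s t. \<lbrakk>x \<in> ssimplices S n; i \<le> n; s \<in> topspace Z; t \<in> standard_simplex (Suc n)\<rbrakk>
      \<Longrightarrow> F (Suc n) (sdegen S n i x) (s, t) = F n x (s, simplicial_collapse i t)"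
  obtains G where "continuous_map (prod_topology Z (geometric_realization S)) Y G"
    and "\<And>n x s t. \<lbrakk>x \<in> ssimplices S n; s \<in> topspace Z; t \<in> standard_simplex n\<rbrakk>
      \<Longrightarrow> G (s, rpoint S n x t) = F n x (s, t)"
proof -
  let ?X = "prod_topology Z (prerealization S)"
  let ?h = "\<lambda>(s, n, x, t). F n x (s, t)"
  let ?q = "\<lambda>(s, u). (s, (\<lambda>(n, x, t). rpoint S n x t) u)"
  let ?T = "\<lambda>(n, x). topspace Z \<times> {n} \<times> {x} \<times> standard_simplex n"
  let ?f = "\<lambda>(n, x) (s, _, _, t). F n x (s, t)"
  have q: "quotient_map ?X (prod_topology Z (geometric_realization S)) ?q"
    using Z quotient_map_geometric_realization by (intro quotient_map_prod_right) auto
  \<comment> \<open>Simplices carry the discrete topology, so the cells are disjoint open sets and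
    the cellwise maps paste.\<close>
  have "continuous_map ?X Y ?h"
  proof (rule pasting_lemma[where I = "SIGMA n:UNIV. ssimplices S n" and T = ?T and f = ?f])
    fix i assume "i \<in> (SIGMA n:UNIV. ssimplices S n)"
    then obtain n x where i: "i = (n, x)" and x: "x \<in> ssimplices S n" by auto
    show "openin ?X (?T i)"
      using openin_prerealization_cell[OF x openin_topspace] by (simp add: i openin_prod_Times_iff)
    let ?C = "{n} \<times> {x} \<times> standard_simplex n"
    have "continuous_map (subtopology (prerealization S) ?C) (simplex_space n) (snd \<circ> snd)"
      unfolding continuous_map_def
    proof (intro conjI allI impI)
      fix U assume U: "openin (simplex_space n) U"
      then have "U \<subseteq> standard_simplex n" using openin_subset by force
      then have "{u \<in> topspace (subtopology (prerealization S) ?C). (snd \<circ> snd) u \<in> U} =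
          ({n} \<times> {x} \<times> U) \<inter> ?C"
        using x by (auto simp: topspace_prerealization)
      with openin_prerealization_cell[OF x U]
      show "openin (subtopology (prerealization S) ?C)
          {u \<in> topspace (subtopology (prerealization S) ?C). (snd \<circ> snd) u \<in> U}"
        by (auto simp: openin_subtopology)
    qed auto
    then have "continuous_map (prod_topology Z (subtopology (prerealization S) ?C))
        (prod_topology Z (simplex_space n)) (\<lambda>(s, u). (s, (snd \<circ> snd) u))"
      by (simp add: continuous_map_prod_top o_def)
    moreover have "subtopology ?X (?T i) = prod_topology Z (subtopology (prerealization S) ?C)"
      by (simp add: i subtopology_Times)
    ultimately have "continuous_map (subtopology ?X (?T i)) (prod_topology Z (simplex_space n))
        (\<lambda>(s, u). (s, (snd \<circ> snd) u))"
      by simp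
    from continuous_map_compose[OF this cont[OF x]]
    have "continuous_map (subtopology ?X (?T i)) Y (F n x \<circ> (\<lambda>(s, u). (s, (snd \<circ> snd) u)))" .
    then show "continuous_map (subtopology ?X (?T i)) Y (?f i)"
      by (simp add: i o_def case_prod_unfold)
  qed (auto simp: topspace_prerealization)
  moreover have "?h u = ?h v" if u: "u \<in> topspace ?X" and uv: "?q u = ?q v" for u v
  proof -
    obtain s u' v' where uv': "u = (s, u')" "v = (s, v')" using uv by (cases u; cases v) auto
    have s: "s \<in> topspace Z" using u uv' by auto
    have "(\<lambda>(n, x, t). rpoint S n x t) w = {v. equivclp (realization_glue S) w v}" for w
      by (auto simp: rpoint_def)
    then have "{w. equivclp (realization_glue S) u' w} = {w. equivclp (realization_glue S) v' w}"
      using uv uv' by simp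
    moreover have "v' \<in> {w. equivclp (realization_glue S) v' w}" by simp
    ultimately have equiv: "equivclp (realization_glue S) u' v'" by (metis mem_Collect_eq)
    have glue: "?h (s, a) = ?h (s, b)" if "realization_glue S a b" for a b
      using that by cases (simp_all add: s face degen)
    \<comment> \<open>Points of the same class are joined by a zigzag of gluings, and the value is
      preserved across each of them.\<close>
    from equiv have "?h (s, u') = ?h (s, v')"
    proof (induction rule: equivclp_induct)
      case (step a b)
      from step.hyps(2) have "?h (s, a) = ?h (s, b)"
        by (rule disjE) (simp_all only: glue)
      with step.IH show ?case by (rule trans)
    qed simp
    then show ?thesis by (simp add: uv')
  qed
  ultimately obtain G where G: "continuous_map (prod_topology Z (geometric_realization S)) Y G"
      "\<And>u. u \<in> topspace ?X \<Longrightarrow> G (?q u) = ?h u"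
    by (rule quotient_map_lift_exists[OF q, of Y ?h]) blast+
  show ?thesis
  proof (rule that[OF G(1)])
    show "G (s, rpoint S n x t) = F n x (s, t)"
      if "x \<in> ssimplices S n" "s \<in> topspace Z" "t \<in> standard_simplex n" for n x s t
      using G(2)[of "(s, n, x, t)"] that by (simp add: topspace_prerealization)
  qed
qed

lemma realization_lift_homotopy:
  assumes "\<And>n x. x \<in> ssimplices S n \<Longrightarrow> continuous_map (prod_topology unit_interval (simplex_space n)) Y (F n x)"
    and "\<And>n i x s t. \<lbrakk>x \<in> ssimplices S (Suc n); i \<le> Suc n; s \<in> {0..1}; t \<in> standard_simplex n\<rbrakk>
      \<Longrightarrow> F n (sface S (Suc n) i x) (s, t) = F (Suc n) x (s, simplical_face i t)"
    and "\<And>n i x s t. \<lbrakk>x \<in> ssimplices S n; i \<le> n; s \<in> {0..1}; t \<in> standard_simplex (Suc n)\<rbrakk>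
      \<Longrightarrow> F (Suc n) (sdegen S n i x) (s, t) = F n x (s, simplicial_collapse i t)"
  obtains G where "continuous_map (prod_topology unit_interval (geometric_realization S)) Y G"
    and "\<And>n x s t. \<lbrakk>x \<in> ssimplices S n; s \<in> {0..1}; t \<in> standard_simplex n\<rbrakk>
      \<Longrightarrow> G (s, rpoint S n x t) = F n x (s, t)"
proof (rule realization_lift[of unit_interval S Y F])
  show "locally_compact_space unit_interval"
    by (intro compact_imp_locally_compact_space) (simp add: compact_space_subtopology)
  show "Hausdorff_space unit_interval"
    by (simp add: Hausdorff_space_subtopology)
qed (use assms that in auto)

text \<open>Obtained from the homotopy version, applied to constant homotopies and read off at time
  0.\<close>

lemma realization_lift_map:
  assumes "\<And>n x. x \<in> ssimplices S n \<Longrightarrow> continuous_map (simplex_space n) Y (F n x)"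
    and "\<And>n i x t. \<lbrakk>x \<in> ssimplices S (Suc n); i \<le> Suc n; t \<in> standard_simplex n\<rbrakk>
      \<Longrightarrow> F n (sface S (Suc n) i x) t = F (Suc n) x (simplical_face i t)"
    and "\<And>n i x t. \<lbrakk>x \<in> ssimplices S n; i \<le> n; t \<in> standard_simplex (Suc n)\<rbrakk>
      \<Longrightarrow> F (Suc n) (sdegen S n i x) t = F n x (simplicial_collapse i t)"
  obtains G where "continuous_map (geometric_realization S) Y G"
    and "\<And>n x t. \<lbrakk>x \<in> ssimplices S n; t \<in> standard_simplex n\<rbrakk> \<Longrightarrow> G (rpoint S n x t) = F n x t"
proof (rule realization_lift_homotopy[of S Y "\<lambda>n x. F n x \<circ> snd"])
  show "continuous_map (prod_topology unit_interval (simplex_space n)) Y (F n x \<circ> snd)"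
    if "x \<in> ssimplices S n" for n x
    using continuous_map_compose[OF continuous_map_snd assms(1)[OF that]] .
  fix G assume G: "continuous_map (prod_topology unit_interval (geometric_realization S)) Y G"
    "\<And>n x s t. \<lbrakk>x \<in> ssimplices S n; s \<in> {0..1}; t \<in> standard_simplex n\<rbrakk>
      \<Longrightarrow> G (s, rpoint S n x t) = (F n x \<circ> snd) (s, t)"
  show thesis
  proof (rule that[of "G \<circ> Pair 0"])
    show "continuous_map (geometric_realization S) Y (G \<circ> Pair 0)"
      using G(1) by (rule continuous_map_o_Pair) simp
  qed (use G(2) in auto)
qed (use assms in auto)

section \<open>Collapsing a subcomplex along a matching\<close>

text \<open>Pastes finitely many closed pieces: \<open>g j\<close> on the wall
  \<open>t j = 0\<close>, read through \<open>simplicial_collapse j\<close>, and \<open>u e\<close>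
  on the slice at time \<open>e\<close>. Conditions \<open>gg\<close> and \<open>gu\<close> are the
  agreement on overlaps. The set \<open>E\<close> is one end for homotopy extension and both ends
  for contraction along a horn.\<close>

lemma prism_walls_continuous:
  fixes J :: "nat set" and E :: "real set"
  assumes J: "J \<subseteq> {..n}" and E: "finite E" "E \<subseteq> {0..1}"
    and g: "\<And>j m. \<lbrakk>j \<in> J; n = Suc m\<rbrakk> \<Longrightarrow> continuous_map (prod_topology unit_interval (simplex_space m)) Y (g j)"
    and u: "\<And>e. e \<in> E \<Longrightarrow> continuous_map (simplex_space n) Y (u e)"
    and gg: "\<And>j k m s t. \<lbrakk>j \<in> J; k \<in> J; j < k; n = Suc (Suc m); s \<in> {0..1}; t \<in> standard_simplex m\<rbrakk>
      \<Longrightarrow> g k (s, simplical_face j t) = g j (s, simplical_face (k - 1) t)"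
    and gu: "\<And>j e m t. \<lbrakk>j \<in> J; e \<in> E; n = Suc m; t \<in> standard_simplex m\<rbrakk>
      \<Longrightarrow> u e (simplical_face j t) = g j (e, t)"
  obtains h where
    "continuous_map (subtopology (prod_topology unit_interval (simplex_space n))
       {(s, t). s \<in> E \<or> (\<exists>j\<in>J. t j = 0)}) Y h"
    "\<And>e t. \<lbrakk>e \<in> E; t \<in> standard_simplex n\<rbrakk> \<Longrightarrow> h (e, t) = u e t"
    "\<And>j m s t. \<lbrakk>j \<in> J; n = Suc m; s \<in> {0..1}; t \<in> standard_simplex m\<rbrakk> \<Longrightarrow> h (s, simplical_face j t) = g j (s, t)"
proof -
  let ?P = "prod_topology unit_interval (simplex_space n)"
  let ?X = "subtopology ?P {(s, t). s \<in> E \<or> (\<exists>j\<in>J. t j = 0)}"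
  let ?I = "Inl ` J \<union> Inr ` E :: (nat + real) set"
  define T where "T i = (case i of Inl j \<Rightarrow> {p \<in> topspace ?X. snd p j \<in> {0}} | Inr e \<Rightarrow> {p \<in> topspace ?X. fst p \<in> {e}})"
    for i :: "nat + real"
  define f where "f i = (case i of Inl j \<Rightarrow> (\<lambda>p. g j (fst p, simplicial_collapse j (snd p))) | Inr e \<Rightarrow> (\<lambda>p. u e (snd p)))"
    for i :: "nat + real"
  \<comment> \<open>A zero-dimensional simplex has its only coordinate equal to 1, hence no
    walls.\<close>
  have n_pos: "\<exists>m. n = Suc m" if "t \<in> standard_simplex n" "j \<in> J" "t j = 0" for t j
    using that J by (cases n) (auto simp: standard_simplex_iff)
  have fstX: "continuous_map ?X unit_interval fst" and sndX: "continuous_map ?X (simplex_space n) snd"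
    by (intro continuous_map_from_subtopology continuous_map_fst continuous_map_snd)+
  have coordX: "continuous_map ?X euclideanreal (\<lambda>p. snd p j)" for j
    using continuous_map_compose[OF sndX continuous_map_simplex_coordinate] by (simp add: o_def)
  have TX: "T i \<subseteq> topspace ?X" for i
    by (auto simp: T_def split: sum.split)
  \<comment> \<open>Where two walls meet, collapsing both coordinates gives one point
    \<open>?v\<close> of a codimension-two face, and \<open>gg\<close> compares its two
    descriptions.\<close>
  have f_cong: "f (Inl j) p = f (Inl k) p"
    if jk: "j \<in> J" "k \<in> J" "j < k" and p: "p \<in> topspace ?X" "snd p j = 0" "snd p k = 0" for j k p
  proof -
    let ?t = "snd p"
    have t: "?t \<in> standard_simplex n" and s: "fst p \<in> {0..1}" using p by auto
    from n_pos[OF t jk(1) p(2)] obtain m where m: "n = Suc m" by blast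
    have "simplicial_collapse k ?t j = 0" using jk p by (simp add: simplicial_collapse_def)
    moreover have ck: "simplicial_collapse k ?t \<in> standard_simplex m"
      using simplicial_collapse_in_standard_simplex_zero[of ?t m k] t m p(3) jk(2) J by auto
    moreover have "j \<le> m" using jk J m by auto
    \<comment> \<open>For \<open>m = 0\<close> the collapsed point would have its only coordinate
      equal to 0.\<close>
    ultimately obtain l where l: "m = Suc l"
      by (cases m) (auto simp: standard_simplex_iff)
    let ?v = "simplicial_collapse j (simplicial_collapse k ?t)"
    have v: "?v \<in> standard_simplex l"
      using simplicial_collapse_in_standard_simplex_zero[of _ l j] ck l m jk J
        \<open>simplicial_collapse k ?t j = 0\<close> by auto
    have k_eq: "simplicial_collapse k ?t = simplical_face j ?v"
      using \<open>simplicial_collapse k ?t j = 0\<close> by (simp add: simplical_face_collapse)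
    have "simplicial_collapse j ?t = simplical_face (k - 1) (simplicial_collapse (k - 1) (simplicial_collapse j ?t))"
      using jk p by (intro simplical_face_collapse[symmetric]) (auto simp: simplicial_collapse_def)
    then have j_eq: "simplicial_collapse j ?t = simplical_face (k - 1) ?v"
      using jk by (simp add: simplicial_collapse_simplicial_collapse)
    have "f (Inl j) p = g j (fst p, simplical_face (k - 1) ?v)"
      using arg_cong[OF j_eq, of "\<lambda>v. g j (fst p, v)"] by (simp only: f_def sum.case)
    also have "\<dots> = g k (fst p, simplical_face j ?v)"
      using gg[of j k l "fst p" ?v] jk s v l m by simp
    also have "\<dots> = f (Inl k) p"
      using arg_cong[OF k_eq, of "\<lambda>v. g k (fst p, v)"] by (simp only: f_def sum.case)
    finally show ?thesis .
  qed
  have f_end: "f (Inl j) p = f (Inr e) p"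
    if je: "j \<in> J" "e \<in> E" and p: "p \<in> topspace ?X" "snd p j = 0" "fst p = e" for j e p
  proof -
    let ?t = "snd p"
    have t: "?t \<in> standard_simplex n" using p by auto
    from n_pos[OF t je(1) p(2)] obtain m where m: "n = Suc m" by blast
    have "simplicial_collapse j ?t \<in> standard_simplex m"
      using simplicial_collapse_in_standard_simplex_zero[of ?t m j] t m p je J by auto
    from gu[OF je m this] show ?thesis
      using p by (simp add: f_def simplical_face_collapse)
  qed
  obtain h where h: "continuous_map ?X Y h" "\<And>x i. \<lbrakk>i \<in> ?I; x \<in> topspace ?X \<inter> T i\<rbrakk> \<Longrightarrow> h x = f i x"
  proof (rule pasting_lemma_exists_closed[of ?I ?X T Y f])
    show "finite ?I" using E J by (auto intro: finite_subset)
    show "topspace ?X \<subseteq> \<Union> (T ` ?I)"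
      by (auto simp: T_def)
    show "closedin ?X (T i)" if "i \<in> ?I" for i
    proof -
      have "closedin ?X {p \<in> topspace ?X. snd p j \<in> {0}}" for j
        by (rule closedin_continuous_map_preimage[OF coordX]) simp
      moreover have "closedin ?X {p \<in> topspace ?X. fst p \<in> {e}}" for e
        by (rule closedin_continuous_map_preimage[OF continuous_map_into_fulltopology[OF fstX]]) simp
      ultimately show ?thesis
        by (cases i) (simp_all only: T_def sum.case)
    qed
    show "continuous_map (subtopology ?X (T i)) Y (f i)" if "i \<in> ?I" for i
      using that
    proof (elim UnE imageE)
      fix e assume e: "i = Inr e" "e \<in> E"
      show ?thesis
        using continuous_map_compose[OF sndX u[OF e(2)]]
        by (simp add: e(1) f_def o_def continuous_map_from_subtopology)
    next
      fix j assume j: "i = Inl j" "j \<in> J"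
      show ?thesis
      proof (cases n)
        case 0
        then have "topspace (subtopology ?X (T i)) = {}"
          using n_pos j by (force simp: T_def)
        then show ?thesis
          by (simp add: continuous_map_def del: topspace_subtopology)
      next
        case (Suc m)
        have "continuous_map (subtopology ?X (T i)) (simplex_space m) (\<lambda>p. simplicial_collapse j (snd p))"
        proof (rule continuous_map_into_simplex_space)
          show "continuous_map (subtopology ?X (T i)) euclideanreal (\<lambda>p. simplicial_collapse j (snd p) k)" for k
            using continuous_map_compose[OF sndX continuous_map_simplicial_collapse_coordinate]
            by (simp add: o_def continuous_map_from_subtopology)
          show "simplicial_collapse j (snd p) \<in> standard_simplex m"
            if "p \<in> topspace (subtopology ?X (T i))" for p
            using that Suc j J by (intro simplicial_collapse_in_standard_simplex_zero) (auto simp: T_def)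
        qed
        then have "continuous_map (subtopology ?X (T i)) (prod_topology unit_interval (simplex_space m))
            (\<lambda>p. (fst p, simplicial_collapse j (snd p)))"
          by (intro continuous_map_pairedI continuous_map_from_subtopology[OF fstX])
        from continuous_map_compose[OF this g[OF j(2) Suc]] show ?thesis
          by (simp add: j(1) f_def o_def)
      qed
    qed
    show "f i x = f j x" if ij: "i \<in> ?I" "j \<in> ?I" and x: "x \<in> topspace ?X \<inter> T i \<inter> T j" for i j x
    proof -
      consider (ll) a b where "i = Inl a" "j = Inl b" "a \<in> J" "b \<in> J"
        | (lr) a e where "i = Inl a" "j = Inr e" "a \<in> J" "e \<in> E"
        | (rl) a e where "i = Inr e" "j = Inl a" "a \<in> J" "e \<in> E"
        | (rr) e e' where "i = Inr e" "j = Inr e'"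
        using ij by blast
      then show ?thesis
      proof cases
        case ll
        then have "x \<in> topspace ?X" "snd x a = 0" "snd x b = 0"
          using x by (simp_all add: T_def)
        then show ?thesis
          using f_cong[of a b x] f_cong[of b a x] ll by (metis linorder_neqE_nat)
      next
        case lr
        then have "x \<in> topspace ?X" "snd x a = 0" "fst x = e" using x by (simp_all add: T_def)
        then show ?thesis using f_end lr by blast
      next
        case rl
        then have "x \<in> topspace ?X" "snd x a = 0" "fst x = e" using x by (simp_all add: T_def)
        then have "f (Inl a) x = f (Inr e) x" using f_end rl by blast
        then show ?thesis using rl by simp
      next
        case rr
        moreover from this have "fst x = e" "fst x = e'" using x by (simp_all add: T_def)
        ultimately show ?thesis by simp
      qed
    qed
  qed blast
  show thesis
  proof (rule that[OF h(1)])
    show "h (e, t) = u e t" if "e \<in> E" "t \<in> standard_simplex n" for e t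
      using h(2)[of "Inr e" "(e, t)"] that E by (auto simp: T_def f_def)
    show "h (s, simplical_face j t) = g j (s, t)"
      if j: "j \<in> J" and n: "n = Suc m" and st: "s \<in> {0..1}" "t \<in> standard_simplex m" for j m s t
    proof -
      have "simplicial_collapse j (simplical_face j t) = t"
        by (rule simplicial_collapse_simplical_face)
      moreover have "simplical_face j t \<in> standard_simplex n"
        using j n st J by (auto intro: simplical_face_in_standard_simplex_Suc)
      ultimately show ?thesis
        using h(2)[of "Inl j" "(s, simplical_face j t)"] j st by (force simp: T_def f_def)
    qed
  qed
qed

text \<open>Homotopy extension for a simplex relative to its boundary, in a form that takes the
  boundary homotopy face by face.\<close>

lemma simplex_homotopy_extension:
  assumes g: "\<And>j m. \<lbrakk>j \<le> n; n = Suc m\<rbrakk> \<Longrightarrow> continuous_map (prod_topology unit_interval (simplex_space m)) Y (g j)"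
    and u: "continuous_map (simplex_space n) Y u"
    and gg: "\<And>j k m s t. \<lbrakk>k \<le> n; j < k; n = Suc (Suc m); s \<in> {0..1}; t \<in> standard_simplex m\<rbrakk>
      \<Longrightarrow> g k (s, simplical_face j t) = g j (s, simplical_face (k - 1) t)"
    and gu: "\<And>j m t. \<lbrakk>j \<le> n; n = Suc m; t \<in> standard_simplex m\<rbrakk>
      \<Longrightarrow> u (simplical_face j t) = g j (0, t)"
  obtains G where "continuous_map (prod_topology unit_interval (simplex_space n)) Y G"
    "\<And>t. t \<in> standard_simplex n \<Longrightarrow> G (0, t) = u t"
    "\<And>j m s t. \<lbrakk>j \<le> n; n = Suc m; s \<in> {0..1}; t \<in> standard_simplex m\<rbrakk> \<Longrightarrow> G (s, simplical_face j t) = g j (s, t)"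
proof -
  obtain h where h: "continuous_map (subtopology (prod_topology unit_interval (simplex_space n))
       {(s, t). s \<in> {0} \<or> (\<exists>j\<in>{..n}. t j = 0)}) Y h"
    "\<And>e t. \<lbrakk>e \<in> {0}; t \<in> standard_simplex n\<rbrakk> \<Longrightarrow> h (e, t) = u t"
    "\<And>j m s t. \<lbrakk>j \<in> {..n}; n = Suc m; s \<in> {0..1}; t \<in> standard_simplex m\<rbrakk> \<Longrightarrow> h (s, simplical_face j t) = g j (s, t)"
    by (rule prism_walls_continuous[of "{..n}" n "{0}" Y g "\<lambda>_. u"]) (use assms in auto)
  from h(1) have "continuous_map (subtopology (prod_topology unit_interval (simplex_space n))
       {(s, t). s = 0 \<or> (\<exists>j\<in>{..n}. t j = 0)}) Y h"
    by simp
  from prism_boundary_extension[OF this] obtain G where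
    G: "continuous_map (prod_topology unit_interval (simplex_space n)) Y G"
      "\<And>s t. \<lbrakk>s \<in> {0..1}; t \<in> standard_simplex n; s = 0 \<or> (\<exists>j\<in>{..n}. t j = 0)\<rbrakk> \<Longrightarrow> G (s, t) = h (s, t)"
    by blast
  show ?thesis
  proof (rule that[OF G(1)])
    show "G (0, t) = u t" if "t \<in> standard_simplex n" for t
      using G(2) h(2) that by simp
    show "G (s, simplical_face j t) = g j (s, t)"
      if "j \<le> n" "n = Suc m" "s \<in> {0..1}" "t \<in> standard_simplex m" for j m s t
    proof -
      have "\<exists>k\<in>{..n}. simplical_face j t k = 0" using that by (intro bexI[of _ j]) auto
      then show ?thesis
        using that G(2)[of s "simplical_face j t"] h(3)[of j m s t]
        by (auto simp: simplical_face_in_standard_simplex_Suc)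
    qed
  qed
qed

text \<open>Nothing is prescribed on face \<open>i\<close>; its homotopy is read off from the
  result. This freedom is what allows the end to be constant.\<close>

lemma simplex_horn_contraction:
  assumes n: "1 \<le> n" and i: "i \<le> n"
    and g: "\<And>j m. \<lbrakk>j \<le> n; j \<noteq> i; n = Suc m\<rbrakk> \<Longrightarrow> continuous_map (prod_topology unit_interval (simplex_space m)) Y (g j)"
    and u: "continuous_map (simplex_space n) Y u" and c: "c \<in> topspace Y"
    and gg: "\<And>j k m s t. \<lbrakk>k \<le> n; j < k; j \<noteq> i; k \<noteq> i; n = Suc (Suc m); s \<in> {0..1}; t \<in> standard_simplex m\<rbrakk>
      \<Longrightarrow> g k (s, simplical_face j t) = g j (s, simplical_face (k - 1) t)"
    and gu: "\<And>j m t. \<lbrakk>j \<le> n; j \<noteq> i; n = Suc m; t \<in> standard_simplex m\<rbrakk> \<Longrightarrow> u (simplical_face j t) = g j (0, t)"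
    and gc: "\<And>j m t. \<lbrakk>j \<le> n; j \<noteq> i; n = Suc m; t \<in> standard_simplex m\<rbrakk> \<Longrightarrow> g j (1, t) = c"
  obtains G where "continuous_map (prod_topology unit_interval (simplex_space n)) Y G"
    "\<And>t. t \<in> standard_simplex n \<Longrightarrow> G (0, t) = u t"
    "\<And>t. t \<in> standard_simplex n \<Longrightarrow> G (1, t) = c"
    "\<And>j m s t. \<lbrakk>j \<le> n; j \<noteq> i; n = Suc m; s \<in> {0..1}; t \<in> standard_simplex m\<rbrakk>
      \<Longrightarrow> G (s, simplical_face j t) = g j (s, t)"
proof -
  let ?J = "{..n} - {i}"
  obtain h where h: "continuous_map (subtopology (prod_topology unit_interval (simplex_space n))
       {(s, t). s \<in> {0, 1} \<or> (\<exists>j\<in>?J. t j = 0)}) Y h"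
    "\<And>e t. \<lbrakk>e \<in> {0, 1}; t \<in> standard_simplex n\<rbrakk> \<Longrightarrow> h (e, t) = (if e = 0 then u t else c)"
    "\<And>j m s t. \<lbrakk>j \<in> ?J; n = Suc m; s \<in> {0..1}; t \<in> standard_simplex m\<rbrakk> \<Longrightarrow> h (s, simplical_face j t) = g j (s, t)"
  proof (rule prism_walls_continuous[of ?J n "{0, 1}" Y g "\<lambda>e t. if e = 0 then u t else c"])
    show "continuous_map (simplex_space n) Y (\<lambda>t. if e = 0 then u t else c)" for e :: real
      using u c by (cases "e = 0") auto
  qed (use assms in auto)
  from h(1) have "continuous_map (subtopology (prod_topology unit_interval (simplex_space n))
       {(s, t). s = 0 \<or> s = 1 \<or> (\<exists>j\<in>?J. t j = 0)}) Y h"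
    by (simp add: disj_assoc)
  from prism_horn_extension[OF n i this] obtain G where
    G: "continuous_map (prod_topology unit_interval (simplex_space n)) Y G"
      "\<And>s t. \<lbrakk>s \<in> {0..1}; t \<in> standard_simplex n; s = 0 \<or> s = 1 \<or> (\<exists>j\<in>?J. t j = 0)\<rbrakk> \<Longrightarrow> G (s, t) = h (s, t)"
    by blast
  show ?thesis
  proof (rule that[OF G(1)])
    show "G (0, t) = u t" "G (1, t) = c" if "t \<in> standard_simplex n" for t
      using G(2)[of 0 t] G(2)[of 1 t] h(2)[of 0 t] h(2)[of 1 t] that by simp_all
    show "G (s, simplical_face j t) = g j (s, t)"
      if "j \<le> n" "j \<noteq> i" "n = Suc m" "s \<in> {0..1}" "t \<in> standard_simplex m" for j m s t
    proof -
      have "\<exists>k\<in>?J. simplical_face j t k = 0" using that by (intro bexI[of _ j]) auto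
      then show ?thesis
        using that G(2)[of s "simplical_face j t"] h(3)[of j m s t]
        by (auto simp: simplical_face_in_standard_simplex_Suc)
    qed
  qed
qed

text \<open>\<open>M n x i\<close> matches \<open>x\<close> with its face \<open>i\<close>, and
  \<open>R\<close> is the order in which cells are handled. A face normally precedes its simplex;
  \<open>matched_above\<close> reverses this for a matched face, whose homotopy comes from its
  partner. The face of a preceding cell might then come too late, and \<open>matched_next\<close>
  guarantees that it still precedes the cells two dimensions above it.\<close>

locale sset_collapse =
  fixes S :: "'s sset" and pt :: 's and D :: "nat \<Rightarrow> 's set"
    and M :: "nat \<Rightarrow> 's \<Rightarrow> nat \<Rightarrow> bool" and R :: "(nat \<times> 's) rel"
  assumes simplicial: "simplicial_set S"
    and pt_in: "pt \<in> D n"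
    and D_sub: "D n \<subseteq> ssimplices S n"
    and pt_face: "i \<le> Suc n \<Longrightarrow> sface S (Suc n) i pt = pt"
    and pt_degen: "i \<le> n \<Longrightarrow> sdegen S n i pt = pt"
    and D_face: "\<lbrakk>x \<in> D (Suc n); i \<le> Suc n\<rbrakk> \<Longrightarrow> sface S (Suc n) i x \<in> D n"
    and wf: "wf R" and trans: "trans R"
    and degen_below: "\<lbrakk>x \<in> ssimplices S n; i \<le> n\<rbrakk> \<Longrightarrow> ((n, x), (Suc n, sdegen S n i x)) \<in> R"
    and face_below: "\<lbrakk>x \<in> ssimplices S (Suc n); i \<le> Suc n; \<not> M (Suc n) x i\<rbrakk>
      \<Longrightarrow> ((n, sface S (Suc n) i x), (Suc n, x)) \<in> R"
    and matched: "M n x i \<Longrightarrow> x \<in> D n \<and> 1 \<le> n \<and> i \<le> n"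
    and matched_nondegen: "M (Suc n) x i \<Longrightarrow> y \<in> ssimplices S n \<Longrightarrow> j \<le> n \<Longrightarrow> x \<noteq> sdegen S n j y"
      "M (Suc (Suc n)) x i \<Longrightarrow> y \<in> ssimplices S n \<Longrightarrow> j \<le> n \<Longrightarrow> sface S (Suc (Suc n)) i x \<noteq> sdegen S n j y"
    and matched_pt: "M (Suc n) x i \<Longrightarrow> x \<noteq> pt \<and> sface S (Suc n) i x \<noteq> pt"
    and matched_above: "M (Suc n) x i \<Longrightarrow> ((Suc n, x), (n, sface S (Suc n) i x)) \<in> R"
    and matched_next: "\<lbrakk>M (Suc n) x i; ((Suc n, x), (Suc (Suc n), z)) \<in> R\<rbrakk>
      \<Longrightarrow> ((n, sface S (Suc n) i x), (Suc (Suc n), z)) \<in> R"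
    and matched_unique: "\<lbrakk>M n x i; M n x j\<rbrakk> \<Longrightarrow> i = j"
      "\<lbrakk>M (Suc n) x i; M (Suc n) y j; sface S (Suc n) i x = sface S (Suc n) j y\<rbrakk> \<Longrightarrow> x = y"
    and matching: "\<lbrakk>x \<in> D n; x \<noteq> pt; \<And>m y i. n = Suc m \<Longrightarrow> y \<in> ssimplices S m \<Longrightarrow> i \<le> m \<Longrightarrow> x \<noteq> sdegen S m i y\<rbrakk>
      \<Longrightarrow> (\<exists>i. M n x i) \<or> (\<exists>y i. M (Suc n) y i \<and> x = sface S (Suc n) i y)"
begin

lemma face_in: "\<lbrakk>x \<in> ssimplices S (Suc n); i \<le> Suc n\<rbrakk> \<Longrightarrow> sface S (Suc n) i x \<in> ssimplices S n"
  using simplicial[unfolded simplicial_set_def, THEN conjunct1, rule_format, of x "Suc n" i]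
  by simp

lemma degen_in: "\<lbrakk>x \<in> ssimplices S n; i \<le> n\<rbrakk> \<Longrightarrow> sdegen S n i x \<in> ssimplices S (Suc n)"
  using simplicial[unfolded simplicial_set_def, THEN conjunct2, THEN conjunct1, rule_format, of x n i]
  by simp

lemma face_face:
  "\<lbrakk>x \<in> ssimplices S (Suc (Suc n)); i < j; j \<le> Suc (Suc n)\<rbrakk> \<Longrightarrow>
    sface S (Suc n) i (sface S (Suc (Suc n)) j x) = sface S (Suc n) (j - 1) (sface S (Suc (Suc n)) i x)"
  using simplicial[unfolded simplicial_set_def, THEN conjunct2, THEN conjunct2, THEN conjunct1, rule_format, of x "Suc (Suc n)" i j]
  by simp

lemma face_degen_less:
  "\<lbrakk>x \<in> ssimplices S (Suc n); j < i; i \<le> Suc n\<rbrakk> \<Longrightarrow>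
    sface S (Suc (Suc n)) j (sdegen S (Suc n) i x) = sdegen S n (i - 1) (sface S (Suc n) j x)"
  using simplicial[unfolded simplicial_set_def, THEN conjunct2, THEN conjunct2, THEN conjunct2, THEN conjunct1, rule_format, of x "Suc n" j i]
  by simp

lemma face_degen_eq:
  assumes "x \<in> ssimplices S n" "i \<le> n"
  shows "sface S (Suc n) i (sdegen S n i x) = x" "sface S (Suc n) (Suc i) (sdegen S n i x) = x"
  using assms simplicial[unfolded simplicial_set_def, THEN conjunct2, THEN conjunct2, THEN conjunct2, THEN conjunct2, THEN conjunct1, rule_format, of x n i]
  by simp_all

lemma face_degen_greater:
  "\<lbrakk>x \<in> ssimplices S (Suc n); Suc i < j; j \<le> Suc (Suc n)\<rbrakk> \<Longrightarrow>
    sface S (Suc (Suc n)) j (sdegen S (Suc n) i x) = sdegen S n i (sface S (Suc n) (j - 1) x)"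
  using simplicial[unfolded simplicial_set_def, THEN conjunct2, THEN conjunct2, THEN conjunct2, THEN conjunct2, THEN conjunct2, THEN conjunct1, rule_format, of x "Suc n" i j]
  by simp

definition base :: "(nat \<times> 's \<times> (nat \<Rightarrow> real)) set" where
  "base = rpoint S 0 pt (\<lambda>j. if j = 0 then 1 else 0)"

definition subspace :: "(nat \<times> 's \<times> (nat \<Rightarrow> real)) set set" where
  "subspace = {rpoint S n x t | n x t. x \<in> D n \<and> t \<in> standard_simplex n}"

lemma rpoint_pt: "t \<in> standard_simplex n \<Longrightarrow> rpoint S n pt t = base"
proof (induction n arbitrary: t)
  case 0
  then show ?case by (simp add: base_def standard_simplex_0)
next
  case (Suc n)
  have "rpoint S (Suc n) (sdegen S n 0 pt) t = rpoint S n pt (simplicial_collapse 0 t)"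
    using pt_in D_sub Suc.prems by (intro rpoint_degen) auto
  then show ?case
    using Suc.IH[OF simplicial_collapse_in_standard_simplex[OF Suc.prems]] by (simp add: pt_degen)
qed

lemma base_in_subspace: "base \<in> subspace"
  using pt_in[of 0] basis_in_standard_simplex[of 0 0] unfolding subspace_def base_def by blast

lemma subspace_subset: "subspace \<subseteq> topspace (geometric_realization S)"
proof
  fix p assume "p \<in> subspace"
  then obtain n x t where "p = rpoint S n x t" "x \<in> D n" "t \<in> standard_simplex n"
    unfolding subspace_def by blast
  moreover from this have "x \<in> ssimplices S n" using D_sub by blast
  ultimately show "p \<in> topspace (geometric_realization S)"
    unfolding topspace_geometric_realization by blast
qed

text \<open>The conditions on the homotopy \<open>r\<close> on the cell of a simplex \<open>x\<close>, relative to the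
  homotopies \<open>f\<close> on the cells that precede \<open>x\<close>. A matched pair \<open>(x, d\<^sub>i x)\<close> is constrained at \<open>d\<^sub>i x\<close>,
  which succeeds \<open>x\<close>.\<close>

definition cell_homotopy ::
  "(nat \<times> 's \<Rightarrow> real \<times> (nat \<Rightarrow> real) \<Rightarrow> (nat \<times> 's \<times> (nat \<Rightarrow> real)) set)
    \<Rightarrow> nat \<Rightarrow> 's \<Rightarrow> (real \<times> (nat \<Rightarrow> real) \<Rightarrow> (nat \<times> 's \<times> (nat \<Rightarrow> real)) set) \<Rightarrow> bool" where
  "cell_homotopy f n x r \<longleftrightarrow>
     continuous_map (prod_topology unit_interval (simplex_space n)) (geometric_realization S) r \<and>
     (\<forall>t \<in> standard_simplex n. r (0, t) = rpoint S n x t) \<and>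
     (x = pt \<longrightarrow> (\<forall>s \<in> {0..1}. \<forall>t \<in> standard_simplex n. r (s, t) = base)) \<and>
     (x \<in> D n \<longrightarrow> (\<forall>t \<in> standard_simplex n. r (1, t) = base \<and> (\<forall>s \<in> {0..1}. r (s, t) \<in> subspace))) \<and>
     (\<forall>m i. n = Suc m \<and> i \<le> n \<and> \<not> M n x i \<longrightarrow>
        (\<forall>s \<in> {0..1}. \<forall>t \<in> standard_simplex m. r (s, simplical_face i t) = f (m, sface S n i x) (s, t))) \<and>
     (\<forall>y i. M (Suc n) y i \<and> x = sface S (Suc n) i y \<longrightarrow>
        (\<forall>s \<in> {0..1}. \<forall>t \<in> standard_simplex n. r (s, t) = f (Suc n, y) (s, simplical_face i t))) \<and>
     (\<forall>m y i. n = Suc m \<and> y \<in> ssimplices S m \<and> i \<le> m \<and> x = sdegen S m i y \<longrightarrow>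
        (\<forall>s \<in> {0..1}. \<forall>t \<in> standard_simplex n. r (s, t) = f (m, y) (s, simplicial_collapse i t)))"

lemma cell_homotopyD:
  assumes "cell_homotopy f n x r"
  shows cell_homotopy_continuous:
      "continuous_map (prod_topology unit_interval (simplex_space n)) (geometric_realization S) r"
    and cell_homotopy_start: "t \<in> standard_simplex n \<Longrightarrow> r (0, t) = rpoint S n x t"
    and cell_homotopy_pt: "\<lbrakk>x = pt; s \<in> {0..1}; t \<in> standard_simplex n\<rbrakk> \<Longrightarrow> r (s, t) = base"
    and cell_homotopy_end: "\<lbrakk>x \<in> D n; t \<in> standard_simplex n\<rbrakk> \<Longrightarrow> r (1, t) = base"
    and cell_homotopy_subspace: "\<lbrakk>x \<in> D n; s \<in> {0..1}; t \<in> standard_simplex n\<rbrakk> \<Longrightarrow> r (s, t) \<in> subspace"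
    and cell_homotopy_face: "\<lbrakk>n = Suc m; i \<le> n; \<not> M n x i; s \<in> {0..1}; t \<in> standard_simplex m\<rbrakk>
      \<Longrightarrow> r (s, simplical_face i t) = f (m, sface S n i x) (s, t)"
    and cell_homotopy_matched: "\<lbrakk>M (Suc n) y i; x = sface S (Suc n) i y; s \<in> {0..1}; t \<in> standard_simplex n\<rbrakk>
      \<Longrightarrow> r (s, t) = f (Suc n, y) (s, simplical_face i t)"
    and cell_homotopy_degen: "\<lbrakk>n = Suc m; z \<in> ssimplices S m; i \<le> m; x = sdegen S m i z; s \<in> {0..1}; t \<in> standard_simplex n\<rbrakk>
      \<Longrightarrow> r (s, t) = f (m, z) (s, simplicial_collapse i t)"
proof -
  note h = assms[unfolded cell_homotopy_def]
  note h1 = h[THEN conjunct1] and h2 = h[THEN conjunct2, THEN conjunct1]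
    and h3 = h[THEN conjunct2, THEN conjunct2, THEN conjunct1]
    and h4 = h[THEN conjunct2, THEN conjunct2, THEN conjunct2, THEN conjunct1]
    and h5 = h[THEN conjunct2, THEN conjunct2, THEN conjunct2, THEN conjunct2, THEN conjunct1]
    and h6 = h[THEN conjunct2, THEN conjunct2, THEN conjunct2, THEN conjunct2, THEN conjunct2, THEN conjunct1]
    and h7 = h[THEN conjunct2, THEN conjunct2, THEN conjunct2, THEN conjunct2, THEN conjunct2, THEN conjunct2]
  show "continuous_map (prod_topology unit_interval (simplex_space n)) (geometric_realization S) r"
    by (fact h1)
  show "t \<in> standard_simplex n \<Longrightarrow> r (0, t) = rpoint S n x t"
    using h2 by blast
  show "\<lbrakk>x = pt; s \<in> {0..1}; t \<in> standard_simplex n\<rbrakk> \<Longrightarrow> r (s, t) = base"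
    using h3 by blast
  show "\<lbrakk>x \<in> D n; t \<in> standard_simplex n\<rbrakk> \<Longrightarrow> r (1, t) = base"
    "\<lbrakk>x \<in> D n; s \<in> {0..1}; t \<in> standard_simplex n\<rbrakk> \<Longrightarrow> r (s, t) \<in> subspace"
    using h4 by blast+
  show "\<lbrakk>n = Suc m; i \<le> n; \<not> M n x i; s \<in> {0..1}; t \<in> standard_simplex m\<rbrakk>
      \<Longrightarrow> r (s, simplical_face i t) = f (m, sface S n i x) (s, t)"
    using h5 by blast
  show "\<lbrakk>M (Suc n) y i; x = sface S (Suc n) i y; s \<in> {0..1}; t \<in> standard_simplex n\<rbrakk>
      \<Longrightarrow> r (s, t) = f (Suc n, y) (s, simplical_face i t)"
    using h6 by blast
  show "\<lbrakk>n = Suc m; z \<in> ssimplices S m; i \<le> m; x = sdegen S m i z; s \<in> {0..1}; t \<in> standard_simplex n\<rbrakk>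
      \<Longrightarrow> r (s, t) = f (m, z) (s, simplicial_collapse i t)"
    using h7 by blast
qed

abbreviation good :: "(nat \<times> 's \<Rightarrow> real \<times> (nat \<Rightarrow> real) \<Rightarrow> (nat \<times> 's \<times> (nat \<Rightarrow> real)) set)
    \<Rightarrow> nat \<Rightarrow> 's \<Rightarrow> bool" where
  "good f n x \<equiv> cell_homotopy f n x (f (n, x))"

text \<open>Compatibility along a face is recorded at the later of the two cells: at the simplex in
  general, at the face when the pair is matched.\<close>

lemma good_face:
  assumes x: "good f (Suc m) x" "i \<le> Suc m" and y: "good f m (sface S (Suc m) i x)"
    and st: "s \<in> {0..1}" "t \<in> standard_simplex m"
  shows "f (Suc m, x) (s, simplical_face i t) = f (m, sface S (Suc m) i x) (s, t)"
proof (cases "M (Suc m) x i")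
  case True
  then show ?thesis using cell_homotopy_matched[OF y True refl st] by simp
next
  case False
  then show ?thesis using cell_homotopy_face[OF x(1) refl x(2) _ st] by simp
qed

context
  fixes f n x
  assumes x: "x \<in> ssimplices S n"
    and below: "\<And>m y. \<lbrakk>((m, y), (n, x)) \<in> R; y \<in> ssimplices S m\<rbrakk> \<Longrightarrow> good f m y"
begin

text \<open>A matched face comes after \<open>y\<close>, so transitivity does not reach it;
  \<open>matched_next\<close> does.\<close>

lemma good_below_face:
  assumes "((Suc m, y), (n, x)) \<in> R" "y \<in> ssimplices S (Suc m)" "i \<le> Suc m" "n = Suc (Suc m)"
  shows "good f m (sface S (Suc m) i y)"
proof -
  have "((m, sface S (Suc m) i y), (n, x)) \<in> R"
  proof (cases "M (Suc m) y i")
    case True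
    then show ?thesis using matched_next[OF True] assms by simp
  next
    case False
    then show ?thesis using face_below[OF assms(2,3)] assms(1) trans by (meson transD)
  qed
  then show ?thesis using assms by (intro below face_in)
qed

lemma ex_cell_homotopy_pt:
  assumes "x = pt"
  shows "\<exists>r. cell_homotopy f n x r"
proof -
  have "cell_homotopy f n x (\<lambda>_. base)"
    unfolding cell_homotopy_def
  proof (intro conjI allI impI ballI)
    show "continuous_map (prod_topology unit_interval (simplex_space n)) (geometric_realization S) (\<lambda>_. base)"
      using base_in_subspace subspace_subset by auto
    show "base = f (m, sface S n i x) (s, t)"
      if "n = Suc m \<and> i \<le> n \<and> \<not> M n x i" "s \<in> {0..1}" "t \<in> standard_simplex m" for m i s t
    proof -
      have "((m, pt), (n, x)) \<in> R" "pt \<in> ssimplices S m"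
        using that face_below[of x m i] x assms pt_face[of i m] D_sub pt_in by auto
      then show ?thesis
        using cell_homotopy_pt[OF below refl] that assms by (simp add: pt_face)
    qed
    show "base = f (Suc n, y) (s, simplical_face i t)"
      if "M (Suc n) y i \<and> x = sface S (Suc n) i y" for y i s t
      using matched_pt that assms by blast
    show "base = f (m, y) (s, simplicial_collapse i t)"
      if "n = Suc m \<and> y \<in> ssimplices S m \<and> i \<le> m \<and> x = sdegen S m i y" "s \<in> {0..1}" "t \<in> standard_simplex n"
      for m y i s t
    proof -
      have "y = pt"
        using that assms face_degen_eq(1)[of y m i] pt_face[of i m] by simp
      moreover have "((m, y), (n, x)) \<in> R" using that degen_below by blast
      moreover have "simplicial_collapse i t \<in> standard_simplex m"
        using that simplicial_collapse_in_standard_simplex by blast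
      ultimately show ?thesis
        using cell_homotopy_pt[OF below] that by simp
    qed
  qed (use assms base_in_subspace in \<open>simp_all add: rpoint_pt\<close>)
  then show ?thesis by blast
qed

text \<open>Two degenerate presentations \<open>s\<^sub>i y = s\<^sub>j z\<close> with \<open>i < j\<close> have the common refinement
  \<open>y = s\<^sub>j\<^sub>-\<^sub>1 w\<close>, \<open>z = s\<^sub>i w\<close> with \<open>w = d\<^sub>i z\<close>.\<close>

lemma degen_presentations_agree_less:
  assumes m: "n = Suc m" and y: "y \<in> ssimplices S m" "x = sdegen S m i y"
    and z: "z \<in> ssimplices S m" "x = sdegen S m j z" and ij: "i < j" "j \<le> m"
    and st: "s \<in> {0..1}" "t \<in> standard_simplex n"
  shows "f (m, y) (s, simplicial_collapse i t) = f (m, z) (s, simplicial_collapse j t)"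
proof -
  obtain l where l: "m = Suc l" using ij by (cases m) auto
  define w where "w = sface S m i z"
  have w: "w \<in> ssimplices S l"
    using face_in[of z l i] z ij l by (simp add: w_def)
  have yw: "y = sdegen S l (j - 1) w"
    using face_degen_eq(1)[of y m i] y z ij face_degen_less[of z l i j] l by (simp add: w_def)
  have "z = sface S (Suc m) (Suc j) (sdegen S m i y)"
    using face_degen_eq(2)[of z m j] y z ij by simp
  also have "\<dots> = sdegen S l i (sface S m j y)"
    using face_degen_greater[of y l i "Suc j"] y ij l by simp
  also have "sface S m j y = w"
    using face_degen_eq(2)[of w l "j - 1"] w ij yw l by simp
  finally have zw: "z = sdegen S l i w" .
  have gy: "good f m y" and gz: "good f m z"
    using below degen_below[of y m i] degen_below[of z m j] y z ij m by auto
  have ct: "simplicial_collapse i t \<in> standard_simplex m" "simplicial_collapse j t \<in> standard_simplex m"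
    using simplicial_collapse_in_standard_simplex st m ij by auto
  have "f (m, y) (s, simplicial_collapse i t) = f (l, w) (s, simplicial_collapse (j - 1) (simplicial_collapse i t))"
    by (rule cell_homotopy_degen[OF gy l w _ yw st(1) ct(1)]) (use ij l in auto)
  also have "\<dots> = f (l, w) (s, simplicial_collapse i (simplicial_collapse j t))"
    by (simp only: simplicial_collapse_simplicial_collapse[OF ij(1)])
  also have "\<dots> = f (m, z) (s, simplicial_collapse j t)"
    by (rule cell_homotopy_degen[OF gz l w _ zw st(1) ct(2), symmetric]) (use ij l in auto)
  finally show ?thesis .
qed

lemma degen_presentations_agree:
  assumes "n = Suc m" "y \<in> ssimplices S m" "i \<le> m" "x = sdegen S m i y"
    "z \<in> ssimplices S m" "j \<le> m" "x = sdegen S m j z" "s \<in> {0..1}" "t \<in> standard_simplex n"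
  shows "f (m, y) (s, simplicial_collapse i t) = f (m, z) (s, simplicial_collapse j t)"
proof (cases i j rule: linorder_cases)
  case less
  then show ?thesis using assms degen_presentations_agree_less by blast
next
  case equal
  then show ?thesis using assms face_degen_eq(1) by metis
next
  case greater
  then show ?thesis using assms degen_presentations_agree_less[of m z j y i s t] by metis
qed

text \<open>A face of \<open>x\<close> is either \<open>y\<close> itself or a degeneracy of a face
  of \<open>y\<close>. In the second case both sides reduce to the homotopy on that face of
  \<open>y\<close>.\<close>

lemma degen_face_agree:
  assumes m: "n = Suc m" and y: "y \<in> ssimplices S m" "i \<le> m" "x = sdegen S m i y"
    and j: "j \<le> n" "\<not> M n x j" and st: "s \<in> {0..1}" "t \<in> standard_simplex m"
  shows "f (m, y) (s, simplicial_collapse i (simplical_face j t)) = f (m, sface S n j x) (s, t)"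
proof -
  have yx: "((m, y), (n, x)) \<in> R" using degen_below y m by blast
  then have gy: "good f m y" using below y by blast
  have dx: "((m, sface S n j x), (n, x)) \<in> R" "sface S n j x \<in> ssimplices S m"
    using face_below[of x m j] face_in[of x m j] x j m by auto
  then have gdx: "good f m (sface S n j x)" using below by blast
  have face_step: ?thesis
    if l: "m = Suc l" and a: "a \<le> m" and b: "b \<le> l"
      and eq: "sface S n j x = sdegen S l b (sface S m a y)"
      and ct: "simplicial_collapse i (simplical_face j t) = simplical_face a (simplicial_collapse b t)" for l a b
  proof -
    have w: "sface S m a y \<in> ssimplices S l" using face_in y l a by blast
    have "((l, sface S m a y), (m, sface S n j x)) \<in> R"
      using degen_below[OF w b] eq l by simp
    then have gw: "good f l (sface S m a y)"
      using dx(1) trans below[OF _ w] by (meson transD)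
    have cbt: "simplicial_collapse b t \<in> standard_simplex l"
      using simplicial_collapse_in_standard_simplex st l b by blast
    have "f (m, y) (s, simplical_face a (simplicial_collapse b t)) = f (l, sface S m a y) (s, simplicial_collapse b t)"
      using good_face[of f l y a s "simplicial_collapse b t"] gy gw a l st cbt by simp
    also have "\<dots> = f (m, sface S n j x) (s, t)"
      by (rule cell_homotopy_degen[OF gdx l w b eq st, symmetric])
    finally show ?thesis by (simp only: ct)
  qed
  consider "j < i" | "j = i" | "j = Suc i" | "Suc i < j" by linarith
  then show ?thesis
  proof cases
    case 1
    then obtain l where l: "m = Suc l" using y by (cases m) auto
    show ?thesis
      using 1 y m l by (intro face_step[of l j "i - 1"])
        (simp_all add: face_degen_less simplicial_collapse_simplical_face(1))
  next
    case 2
    then show ?thesis using y m by (simp add: face_degen_eq simplicial_collapse_simplical_face)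
  next
    case 3
    then show ?thesis using y m by (simp add: face_degen_eq simplicial_collapse_simplical_face)
  next
    case 4
    then obtain l where l: "m = Suc l" using j m by (cases m) auto
    show ?thesis
      using 4 y m l j by (intro face_step[of l "j - 1" i])
        (simp_all add: face_degen_greater simplicial_collapse_simplical_face(4))
  qed
qed

text \<open>The pullback along the collapse is forced; what remains is its agreement with the other
  prescriptions. Matched faces are never degenerate, so no partner interferes.\<close>

lemma ex_cell_homotopy_degen:
  assumes m: "n = Suc m" and y: "y \<in> ssimplices S m" "i \<le> m" "x = sdegen S m i y" and pt: "x \<noteq> pt"
  shows "\<exists>r. cell_homotopy f n x r"
proof -
  have gy: "good f m y" using below degen_below y m by blast
  have ct: "simplicial_collapse i t \<in> standard_simplex m" if "t \<in> standard_simplex n" for t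
    using simplicial_collapse_in_standard_simplex that y m by blast
  let ?r = "\<lambda>p. f (m, y) (fst p, simplicial_collapse i (snd p))"
  have "cell_homotopy f n x ?r"
    unfolding cell_homotopy_def fst_conv snd_conv
  proof (intro conjI allI impI ballI)
    have "continuous_map (prod_topology unit_interval (simplex_space n)) (prod_topology unit_interval (simplex_space m))
        (\<lambda>p. (fst p, simplicial_collapse i (snd p)))"
      using continuous_map_compose[OF continuous_map_snd continuous_map_simplicial_collapse[OF y(2)]] m
      by (intro continuous_map_pairedI continuous_map_fst) (simp add: o_def)
    from continuous_map_compose[OF this cell_homotopy_continuous[OF gy]]
    show "continuous_map (prod_topology unit_interval (simplex_space n)) (geometric_realization S) ?r"
      by (simp add: o_def)
    show "f (m, y) (0, simplicial_collapse i t) = rpoint S n x t" if "t \<in> standard_simplex n" for t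
      using cell_homotopy_start[OF gy ct[OF that]] rpoint_degen[OF y(1,2)] that y(3) m by simp
    \<comment> \<open>\<open>y\<close> is a face of its degeneracy \<open>x\<close>, and
      \<open>D\<close> is closed under faces.\<close>
    have yD: "y \<in> D m" if "x \<in> D n"
      using D_face[of x m i] that face_degen_eq(1)[OF y(1,2)] y m by simp
    show "f (m, y) (1, simplicial_collapse i t) = base" if "x \<in> D n" "t \<in> standard_simplex n" for t
      using cell_homotopy_end[OF gy] yD ct that by blast
    show "f (m, y) (s, simplicial_collapse i t) \<in> subspace" if "x \<in> D n" "t \<in> standard_simplex n" "s \<in> {0..1}" for s t
      using cell_homotopy_subspace[OF gy] yD ct that by blast
    show "f (m, y) (s, simplicial_collapse i (simplical_face j t)) = f (m', sface S n j x) (s, t)"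
      if "n = Suc m' \<and> j \<le> n \<and> \<not> M n x j" "s \<in> {0..1}" "t \<in> standard_simplex m'" for m' j s t
    proof -
      have "m' = m" "j \<le> n" "\<not> M n x j" using that m by auto
      with degen_face_agree[OF m y, of j s t] that(2,3) show ?thesis by simp
    qed
    show "f (m, y) (s, simplicial_collapse i t) = f (Suc n, z) (s, simplical_face j t)"
      if "M (Suc n) z j \<and> x = sface S (Suc n) j z" for z j s t
      using matched_nondegen(2)[of m z j y i] that y m by blast
    show "f (m, y) (s, simplicial_collapse i t) = f (m', z) (s, simplicial_collapse j t)"
      if "n = Suc m' \<and> z \<in> ssimplices S m' \<and> j \<le> m' \<and> x = sdegen S m' j z" "s \<in> {0..1}" "t \<in> standard_simplex n" for m' z j s t
    proof -
      have "m' = m" "z \<in> ssimplices S m" "j \<le> m" "x = sdegen S m j z" using that m by auto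
      with degen_presentations_agree[OF m y, of z j s t] that(2,3) show ?thesis by simp
    qed
  qed (use pt in auto)
  then show ?thesis by blast
qed

text \<open>The homotopy is the restriction of the one already chosen on the partner
  \<open>y\<close>, where this face was left free.\<close>

lemma ex_cell_homotopy_matched_face:
  assumes y: "M (Suc n) y i" "x = sface S (Suc n) i y"
  shows "\<exists>r. cell_homotopy f n x r"
proof -
  have yD: "y \<in> D (Suc n)" "i \<le> Suc n" using matched[OF y(1)] by auto
  then have yS: "y \<in> ssimplices S (Suc n)" using D_sub by blast
  have yx: "((Suc n, y), (n, x)) \<in> R" using matched_above[OF y(1)] y(2) by simp
  then have gy: "good f (Suc n) y" using below yS by blast
  have ft: "simplical_face i t \<in> standard_simplex (Suc n)" if "t \<in> standard_simplex n" for t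
    using simplical_face_in_standard_simplex_Suc that yD by blast
  let ?r = "\<lambda>p. f (Suc n, y) (fst p, simplical_face i (snd p))"
  have "cell_homotopy f n x ?r"
    unfolding cell_homotopy_def fst_conv snd_conv
  proof (intro conjI allI impI ballI)
    have "continuous_map (prod_topology unit_interval (simplex_space n)) (prod_topology unit_interval (simplex_space (Suc n)))
        (\<lambda>p. (fst p, simplical_face i (snd p)))"
      using continuous_map_compose[OF continuous_map_snd continuous_map_simplical_face[OF yD(2)]]
      by (intro continuous_map_pairedI continuous_map_fst) (simp add: o_def)
    from continuous_map_compose[OF this cell_homotopy_continuous[OF gy]]
    show "continuous_map (prod_topology unit_interval (simplex_space n)) (geometric_realization S) ?r"
      by (simp add: o_def)
    show "f (Suc n, y) (0, simplical_face i t) = rpoint S n x t" if "t \<in> standard_simplex n" for t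
      using cell_homotopy_start[OF gy ft[OF that]] rpoint_face[OF yS yD(2) that] y(2) by simp
    show "f (Suc n, y) (s, simplical_face i t) = base" if "x = pt" for s t
      using matched_pt[OF y(1)] y(2) that by simp
    show "f (Suc n, y) (1, simplical_face i t) = base" if "t \<in> standard_simplex n" for t
      using cell_homotopy_end[OF gy yD(1) ft[OF that]] .
    show "f (Suc n, y) (s, simplical_face i t) \<in> subspace" if "t \<in> standard_simplex n" "s \<in> {0..1}" for s t
      using cell_homotopy_subspace[OF gy yD(1) that(2) ft[OF that(1)]] .
    show "f (Suc n, y) (s, simplical_face i (simplical_face j t)) = f (m, sface S n j x) (s, t)"
      if "n = Suc m \<and> j \<le> n \<and> \<not> M n x j" and st: "s \<in> {0..1}" "t \<in> standard_simplex m" for m j s t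
    proof -
      have m: "n = Suc m" and j: "j \<le> n" "\<not> M n x j" using that by auto
      have gx: "good f m (sface S n j x)"
        using below face_below[of x m j] face_in[of x m j] x j m by blast
      \<comment> \<open>Every face of \<open>x\<close> is also a face of some face \<open>k\<close>
        of \<open>y\<close> with \<open>k \<noteq> i\<close>. That face is not matched with
        \<open>y\<close>, so the constraint recorded at \<open>y\<close> applies to it.\<close>
      have face_step: ?thesis
        if k: "k \<le> Suc n" "k \<noteq> i" and l: "l \<le> n"
          and eq: "sface S n j x = sface S n l (sface S (Suc n) k y)"
          and ft: "simplical_face i (simplical_face j t) = simplical_face k (simplical_face l t)" for k l
      proof -
        have nM: "\<not> M (Suc n) y k" using matched_unique(1) y k by blast
        then have "((n, sface S (Suc n) k y), (n, x)) \<in> R"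
          using face_below[OF yS k(1)] yx trans by (meson transD)
        then have gk: "good f n (sface S (Suc n) k y)"
          using below face_in yS k by blast
        have lt: "simplical_face l t \<in> standard_simplex n"
          using simplical_face_in_standard_simplex_Suc st l m by blast
        have "f (Suc n, y) (s, simplical_face k (simplical_face l t)) = f (n, sface S (Suc n) k y) (s, simplical_face l t)"
          by (rule cell_homotopy_face[OF gy refl k(1) nM st(1) lt])
        also have "\<dots> = f (m, sface S n l (sface S (Suc n) k y)) (s, t)"
          using good_face[of f m "sface S (Suc n) k y" l s t] gk gx l st eq m by simp
        finally show ?thesis by (simp only: ft eq)
      qed
      show ?thesis
      proof (cases "j < i")
        case True
        then show ?thesis
          using y(2) yS yD j m by (intro face_step[of j "i - 1"])
            (simp_all add: face_face simplical_face_simplical_face)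
      next
        case False
        then show ?thesis
          using y(2) yS yD j m face_face[of y m i "Suc j"] simplical_face_simplical_face[of i "Suc j" t]
          by (intro face_step[of "Suc j" i]) simp_all
      qed
    qed
    show "f (Suc n, y) (s, simplical_face i t) = f (Suc n, z) (s, simplical_face j t)"
      if "M (Suc n) z j \<and> x = sface S (Suc n) j z" for z j s t
      using matched_unique(2)[OF y(1), of z j] matched_unique(1)[OF y(1)] that y(2) by metis
    show "f (Suc n, y) (s, simplical_face i t) = f (m, z) (s, simplicial_collapse j t)"
      if "n = Suc m \<and> z \<in> ssimplices S m \<and> j \<le> m \<and> x = sdegen S m j z" for m z j s t
      using matched_nondegen(2)[of m y i z j] that y by blast
  qed
  then show ?thesis by blast
qed

text \<open>Both walls restrict to the homotopy on their common codimension-two face, which precedes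
  \<open>x\<close> by \<open>good_below_face\<close> even when it is matched with one of the
  walls.\<close>

lemma walls_agree:
  assumes n: "n = Suc (Suc m)" and jk: "j < k" "k \<le> n" and M: "\<not> M n x j" "\<not> M n x k"
    and st: "s \<in> {0..1}" "t \<in> standard_simplex m"
  shows "f (n - 1, sface S n k x) (s, simplical_face j t) = f (n - 1, sface S n j x) (s, simplical_face (k - 1) t)"
proof -
  have fc: "((Suc m, sface S n l x), (n, x)) \<in> R" "sface S n l x \<in> ssimplices S (Suc m)"
    if "l \<le> n" "\<not> M n x l" for l
    using face_below[of x "Suc m" l] face_in[of x "Suc m" l] x n that by auto
  have fk: "good f (Suc m) (sface S n k x)" and fj: "good f (Suc m) (sface S n j x)"
    using fc below jk M by auto
  have "f (Suc m, sface S n k x) (s, simplical_face j t) = f (m, sface S (Suc m) j (sface S n k x)) (s, t)"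
    using fc[of k] jk M n by (intro good_face fk good_below_face st) auto
  also have "sface S (Suc m) j (sface S n k x) = sface S (Suc m) (k - 1) (sface S n j x)"
    using face_face[of x m j k] x n jk by simp
  also have "f (m, \<dots>) (s, t) = f (Suc m, sface S n j x) (s, simplical_face (k - 1) t)"
    using fc[of j] jk M n by (intro good_face[symmetric] fj good_below_face st) auto
  finally show ?thesis by (simp add: n)
qed

context
  assumes nondegen: "\<And>m y i. n = Suc m \<Longrightarrow> y \<in> ssimplices S m \<Longrightarrow> i \<le> m \<Longrightarrow> x \<noteq> sdegen S m i y"
    and not_matched_face: "\<And>y i. M (Suc n) y i \<Longrightarrow> x \<noteq> sface S (Suc n) i y"
    and not_pt: "x \<noteq> pt"
begin

lemma good_wall: "\<lbrakk>n = Suc m; j \<le> n; \<not> M n x j\<rbrakk> \<Longrightarrow> good f m (sface S n j x)"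
  using face_below[of x m j] face_in[of x m j] x by (intro below) auto

text \<open>Outside \<open>D\<close> no face is matched, so all walls are already settled, and
  nothing is demanded at time 1: homotopy extension applies.\<close>

lemma ex_cell_homotopy_outside:
  assumes "x \<notin> D n"
  shows "\<exists>r. cell_homotopy f n x r"
proof -
  let ?g = "\<lambda>j. f (n - 1, sface S n j x)"
  have nM: "\<not> M n x j" for j using assms matched by blast
  have g: "continuous_map (prod_topology unit_interval (simplex_space m)) (geometric_realization S) (?g j)"
    if "j \<le> n" "n = Suc m" for j m
    using cell_homotopy_continuous[OF good_wall[OF that(2,1) nM]] that by simp
  have gu: "rpoint S n x (simplical_face j t) = ?g j (0, t)"
    if "j \<le> n" "n = Suc m" "t \<in> standard_simplex m" for j m t
    using cell_homotopy_start[OF good_wall[OF that(2,1) nM]] rpoint_face[of x S m j t] x that by simp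
  have gg: "?g k (s, simplical_face j t) = ?g j (s, simplical_face (k - 1) t)"
    if "k \<le> n" "j < k" "n = Suc (Suc m)" "s \<in> {0..1}" "t \<in> standard_simplex m" for j k m s t
    using walls_agree[OF that(3,2,1) nM nM that(4,5)] .
  show ?thesis
  proof (rule simplex_homotopy_extension[of n "geometric_realization S" ?g "rpoint S n x",
        OF g continuous_map_rpoint[OF x] gg gu])
    fix G assume G: "continuous_map (prod_topology unit_interval (simplex_space n)) (geometric_realization S) G"
      "\<And>t. t \<in> standard_simplex n \<Longrightarrow> G (0, t) = rpoint S n x t"
      "\<And>j m s t. \<lbrakk>j \<le> n; n = Suc m; s \<in> {0..1}; t \<in> standard_simplex m\<rbrakk> \<Longrightarrow> G (s, simplical_face j t) = ?g j (s, t)"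
    have "cell_homotopy f n x G"
      unfolding cell_homotopy_def
    proof (intro conjI allI impI ballI)
      show "G (s, simplical_face j t) = f (m, sface S n j x) (s, t)"
        if "n = Suc m \<and> j \<le> n \<and> \<not> M n x j" "s \<in> {0..1}" "t \<in> standard_simplex m" for m j s t
        using G(3)[of j m s t] that by simp
    qed (use G(1,2) assms nondegen not_matched_face not_pt in blast)+
    then show ?thesis by blast
  qed
qed

text \<open>Contracting along the horn inside \<open>subspace\<close>, rather than inside the whole
  realization, is what makes the homotopy preserve \<open>D\<close>.\<close>

lemma ex_cell_homotopy_matched:
  assumes i: "M n x i"
  shows "\<exists>r. cell_homotopy f n x r"
proof -
  let ?g = "\<lambda>j. f (n - 1, sface S n j x)"
  let ?Y = "subtopology (geometric_realization S) subspace"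
  have xD: "x \<in> D n" and n: "1 \<le> n" "i \<le> n" using matched[OF i] by auto
  have nM: "\<not> M n x j" if "j \<noteq> i" for j using matched_unique(1)[OF i] that by blast
  have faceD: "sface S n j x \<in> D m" if "n = Suc m" "j \<le> n" for j m
    using D_face xD that by blast
  have g: "continuous_map (prod_topology unit_interval (simplex_space m)) ?Y (?g j)"
    if "j \<le> n" "j \<noteq> i" "n = Suc m" for j m
  proof -
    note gd = good_wall[OF that(3,1) nM[OF that(2)]]
    show ?thesis
      using cell_homotopy_continuous[OF gd] cell_homotopy_subspace[OF gd faceD[OF that(3,1)]] that
      by (auto simp: continuous_map_in_subtopology)
  qed
  have u: "continuous_map (simplex_space n) ?Y (rpoint S n x)"
    using continuous_map_rpoint[OF x] xD by (auto simp: continuous_map_in_subtopology subspace_def)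
  have gu: "rpoint S n x (simplical_face j t) = ?g j (0, t)"
    if "j \<le> n" "j \<noteq> i" "n = Suc m" "t \<in> standard_simplex m" for j m t
    using cell_homotopy_start[OF good_wall[OF that(3,1) nM[OF that(2)]]] rpoint_face[of x S m j t] x that by simp
  have gc: "?g j (1, t) = base"
    if "j \<le> n" "j \<noteq> i" "n = Suc m" "t \<in> standard_simplex m" for j m t
    using cell_homotopy_end[OF good_wall[OF that(3,1) nM[OF that(2)]] faceD[OF that(3,1)]] that by simp
  have gg: "?g k (s, simplical_face j t) = ?g j (s, simplical_face (k - 1) t)"
    if "k \<le> n" "j < k" "j \<noteq> i" "k \<noteq> i" "n = Suc (Suc m)" "s \<in> {0..1}" "t \<in> standard_simplex m" for j k m s t
    using walls_agree[OF that(5,2,1) nM[OF that(3)] nM[OF that(4)] that(6,7)] .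
  have base: "base \<in> topspace ?Y"
    using base_in_subspace subspace_subset by auto
  show ?thesis
  proof (rule simplex_horn_contraction[of n i ?Y ?g "rpoint S n x" base, OF n g u base gg gu gc])
    fix G assume G: "continuous_map (prod_topology unit_interval (simplex_space n)) ?Y G"
      "\<And>t. t \<in> standard_simplex n \<Longrightarrow> G (0, t) = rpoint S n x t"
      "\<And>t. t \<in> standard_simplex n \<Longrightarrow> G (1, t) = base"
      "\<And>j m s t. \<lbrakk>j \<le> n; j \<noteq> i; n = Suc m; s \<in> {0..1}; t \<in> standard_simplex m\<rbrakk>
        \<Longrightarrow> G (s, simplical_face j t) = ?g j (s, t)"
    have "cell_homotopy f n x G"
      unfolding cell_homotopy_def
    proof (intro conjI allI impI ballI)
      show "continuous_map (prod_topology unit_interval (simplex_space n)) (geometric_realization S) G"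
        using G(1) by (simp add: continuous_map_in_subtopology)
      show "G (s, t) \<in> subspace" if "s \<in> {0..1}" "t \<in> standard_simplex n" for s t
        using continuous_map_image_subset_topspace[OF G(1)] that by auto
      show "G (s, simplical_face j t) = f (m, sface S n j x) (s, t)"
        if "n = Suc m \<and> j \<le> n \<and> \<not> M n x j" "s \<in> {0..1}" "t \<in> standard_simplex m" for m j s t
      proof -
        have "j \<noteq> i" using that i by blast
        then show ?thesis using G(4)[of j m s t] that by simp
      qed
    qed (use G(2,3) nondegen not_matched_face not_pt in blast)+
    then show ?thesis by blast
  qed
qed

end

lemma ex_cell_homotopy: "\<exists>r. cell_homotopy f n x r"
proof -
  consider "x = pt"
    | m y i where "n = Suc m" "y \<in> ssimplices S m" "i \<le> m" "x = sdegen S m i y" "x \<noteq> pt"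
    | y i where "M (Suc n) y i" "x = sface S (Suc n) i y"
    | "x \<noteq> pt" "\<And>m y i. n = Suc m \<Longrightarrow> y \<in> ssimplices S m \<Longrightarrow> i \<le> m \<Longrightarrow> x \<noteq> sdegen S m i y"
      "\<And>y i. M (Suc n) y i \<Longrightarrow> x \<noteq> sface S (Suc n) i y"
    by blast
  then show ?thesis
  proof cases
    case 4
    show ?thesis
    proof (cases "x \<in> D n")
      case True
      with 4 matching obtain i where "M n x i" by metis
      with 4 show ?thesis by (intro ex_cell_homotopy_matched)
    next
      case False
      with 4 show ?thesis by (intro ex_cell_homotopy_outside)
    qed
  qed (use ex_cell_homotopy_pt ex_cell_homotopy_degen ex_cell_homotopy_matched_face in blast)+
qed

end

end

section \<open>The global homotopy and the collapse theorem\<close>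

context sset_collapse
begin

text \<open>Only values of \<open>f\<close> strictly below the cell enter, as choice along a
  well-founded relation requires.\<close>

lemma cell_homotopy_cong:
  assumes x: "x \<in> ssimplices S n" and eq: "\<And>z. (z, (n, x)) \<in> R \<Longrightarrow> f z = g z"
    and r: "cell_homotopy f n x r"
  shows "cell_homotopy g n x r"
  unfolding cell_homotopy_def
proof (intro conjI allI impI ballI)
  show "r (s, simplical_face i t) = g (m, sface S n i x) (s, t)"
    if "n = Suc m \<and> i \<le> n \<and> \<not> M n x i" "s \<in> {0..1}" "t \<in> standard_simplex m" for m i s t
  proof -
    have "f (m, sface S n i x) = g (m, sface S n i x)"
      using face_below[of x m i] x that by (intro eq) auto
    then show ?thesis using cell_homotopy_face[OF r, of m i s t] that by auto
  qed
  show "r (s, t) = g (Suc n, y) (s, simplical_face i t)"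
    if "M (Suc n) y i \<and> x = sface S (Suc n) i y" "s \<in> {0..1}" "t \<in> standard_simplex n" for y i s t
  proof -
    have "f (Suc n, y) = g (Suc n, y)"
      using matched_above[of n y i] that by (intro eq) auto
    then show ?thesis using cell_homotopy_matched[OF r, of y i s t] that by auto
  qed
  show "r (s, t) = g (m, y) (s, simplicial_collapse i t)"
    if "n = Suc m \<and> y \<in> ssimplices S m \<and> i \<le> m \<and> x = sdegen S m i y" "s \<in> {0..1}" "t \<in> standard_simplex n"
    for m y i s t
  proof -
    have "f (m, y) = g (m, y)"
      using degen_below[of y m i] that by (intro eq) auto
    then show ?thesis using cell_homotopy_degen[OF r, of m y i s t] that by auto
  qed
qed (use cell_homotopyD[OF r] in blast)+

lemma ex_cell_homotopies: "\<exists>f. \<forall>n x. x \<in> ssimplices S n \<longrightarrow> good f n x"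
proof -
  let ?P = "\<lambda>f (n, x) r. x \<in> ssimplices S n \<longrightarrow> cell_homotopy f n x r"
  have "\<exists>f. \<forall>z. ?P f z (f z)"
  proof (rule dependent_wf_choice[OF wf])
    show "?P f z r = ?P g z r" if eq: "\<And>z'. (z', z) \<in> R \<Longrightarrow> f z' = g z'" for f g z r
    proof -
      obtain n x where z: "z = (n, x)" by (cases z)
      have "cell_homotopy f n x r \<longleftrightarrow> cell_homotopy g n x r" if "x \<in> ssimplices S n"
        using cell_homotopy_cong[OF that, of f g r] cell_homotopy_cong[OF that, of g f r] eq z by metis
      then show ?thesis by (auto simp: z)
    qed
    show "\<exists>r. ?P f z r" if below: "\<And>y. (y, z) \<in> R \<Longrightarrow> ?P f y (f y)" for z f
    proof -
      obtain n x where z: "z = (n, x)" by (cases z)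
      have "good f m y" if "((m, y), (n, x)) \<in> R" "y \<in> ssimplices S m" for m y
        using below[of "(m, y)"] that z by simp
      then have "\<exists>r. cell_homotopy f n x r" if "x \<in> ssimplices S n"
        by (intro ex_cell_homotopy that)
      then show ?thesis by (auto simp: z)
    qed
  qed
  then show ?thesis by fast
qed

text \<open>\<open>q\<close> exhibits \<open>Q\<close> as the quotient by \<open>D\<close>, and
  \<open>lift\<close> is a degreewise section that need not be simplicial. The inverse
  \<open>G\<close> sends a cell of \<open>Q\<close> to the end of the homotopy on its lift: a face
  and the lift of its image differ only inside \<open>D\<close>, where the end is
  \<open>base\<close>. The global homotopy \<open>H\<close> and the homotopy \<open>K\<close> that
  it induces on \<open>Q\<close> compare the composites with the identities.\<close>

theorem homotopy_equivalent_collapse: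
  assumes q_in: "\<And>n x. x \<in> ssimplices S n \<Longrightarrow> q n x \<in> ssimplices Q n"
    and q_face: "\<And>n i x. \<lbrakk>x \<in> ssimplices S (Suc n); i \<le> Suc n\<rbrakk>
      \<Longrightarrow> q n (sface S (Suc n) i x) = sface Q (Suc n) i (q (Suc n) x)"
    and q_degen: "\<And>n i x. \<lbrakk>x \<in> ssimplices S n; i \<le> n\<rbrakk>
      \<Longrightarrow> q (Suc n) (sdegen S n i x) = sdegen Q n i (q n x)"
    and lift_in: "\<And>n y. y \<in> ssimplices Q n \<Longrightarrow> lift n y \<in> ssimplices S n"
    and q_lift: "\<And>n y. y \<in> ssimplices Q n \<Longrightarrow> q n (lift n y) = y"
    and lift_q: "\<And>n x. x \<in> ssimplices S n \<Longrightarrow> lift n (q n x) = (if x \<in> D n then pt else x)"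
  shows "geometric_realization S homotopy_equivalent_space geometric_realization Q"
proof -
  let ?S = "geometric_realization S" and ?Q = "geometric_realization Q"
  obtain f where good: "\<And>n x. x \<in> ssimplices S n \<Longrightarrow> good f n x"
    using ex_cell_homotopies by blast
  have ptS: "pt \<in> ssimplices S n" for n using pt_in D_sub by blast
  have f_face: "f (n, sface S (Suc n) i x) (s, t) = f (Suc n, x) (s, simplical_face i t)"
    if "x \<in> ssimplices S (Suc n)" "i \<le> Suc n" "s \<in> {0..1}" "t \<in> standard_simplex n" for n i x s t
    using good_face[OF good[OF that(1)] that(2) good[OF face_in[OF that(1,2)]] that(3,4)] by simp
  have f_degen: "f (Suc n, sdegen S n i x) (s, t) = f (n, x) (s, simplicial_collapse i t)"
    if "x \<in> ssimplices S n" "i \<le> n" "s \<in> {0..1}" "t \<in> standard_simplex (Suc n)" for n i x s t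
    using cell_homotopy_degen[OF good[OF degen_in[OF that(1,2)]] refl that(1,2) refl that(3,4)] .
  obtain H where H: "continuous_map (prod_topology unit_interval ?S) ?S H"
    "\<And>n x s t. \<lbrakk>x \<in> ssimplices S n; s \<in> {0..1}; t \<in> standard_simplex n\<rbrakk> \<Longrightarrow> H (s, rpoint S n x t) = f (n, x) (s, t)"
  proof (rule realization_lift_homotopy[of S ?S "\<lambda>n x. f (n, x)",
      OF cell_homotopy_continuous[OF good] f_face f_degen])
    fix H assume "continuous_map (prod_topology unit_interval ?S) ?S H"
      "\<And>n x s t. \<lbrakk>x \<in> ssimplices S n; s \<in> {0..1}; t \<in> standard_simplex n\<rbrakk> \<Longrightarrow> H (s, rpoint S n x t) = f (n, x) (s, t)"
    then show thesis by (rule that)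
  qed
  have q_rpoint_face: "rpoint Q n (q n (sface S (Suc n) i x)) t = rpoint Q (Suc n) (q (Suc n) x) (simplical_face i t)"
    if "x \<in> ssimplices S (Suc n)" "i \<le> Suc n" "t \<in> standard_simplex n" for n i x t
    using rpoint_face[of "q (Suc n) x" Q n i t] q_in q_face that by simp
  have q_rpoint_degen: "rpoint Q (Suc n) (q (Suc n) (sdegen S n i x)) t = rpoint Q n (q n x) (simplicial_collapse i t)"
    if "x \<in> ssimplices S n" "i \<le> n" "t \<in> standard_simplex (Suc n)" for n i x t
    using rpoint_degen[of "q n x" Q n i t] q_in q_degen that by simp
  obtain \<phi> where \<phi>: "continuous_map ?S ?Q \<phi>"
    "\<And>n x t. \<lbrakk>x \<in> ssimplices S n; t \<in> standard_simplex n\<rbrakk> \<Longrightarrow> \<phi> (rpoint S n x t) = rpoint Q n (q n x) t"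
  proof (rule realization_lift_map[of S ?Q "\<lambda>n x. rpoint Q n (q n x)",
      OF continuous_map_rpoint[OF q_in] q_rpoint_face q_rpoint_degen])
    fix \<phi> assume "continuous_map ?S ?Q \<phi>"
      "\<And>n x t. \<lbrakk>x \<in> ssimplices S n; t \<in> standard_simplex n\<rbrakk> \<Longrightarrow> \<phi> (rpoint S n x t) = rpoint Q n (q n x) t"
    then show thesis by (rule that)
  qed
  have \<phi>_subspace: "\<phi> p = \<phi> base" if p: "p \<in> subspace" for p
  proof -
    obtain n x t where p: "p = rpoint S n x t" "x \<in> D n" and t: "t \<in> standard_simplex n"
      using p unfolding subspace_def by blast
    have x: "x \<in> ssimplices S n" using p D_sub by blast
    have "q n x = q n pt"
      using q_lift[OF q_in[OF x]] lift_q[OF x] p by simp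
    then have "\<phi> p = \<phi> (rpoint S n pt t)"
      using \<phi>(2) p x t ptS by simp
    then show ?thesis using rpoint_pt[OF t] by simp
  qed
  have lift_end: "f (n, lift n (q n x)) (1, t) = f (n, x) (1, t)"
    if "x \<in> ssimplices S n" "t \<in> standard_simplex n" for n x t
    using cell_homotopy_end[OF good[OF that(1)]] cell_homotopy_pt[OF good[OF ptS] refl] lift_q that by auto
  \<comment> \<open>If \<open>x\<close> is in \<open>D\<close>, its track stays in
    \<open>subspace\<close> and the track of \<open>pt\<close> is constant at \<open>base\<close>;
    \<open>\<phi>\<close> identifies all these points.\<close>
  have lift_hom: "\<phi> (f (n, lift n (q n x)) (s, t)) = \<phi> (f (n, x) (s, t))"
    if "x \<in> ssimplices S n" "s \<in> {0..1}" "t \<in> standard_simplex n" for n x s t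
    using cell_homotopy_subspace[OF good[OF that(1)]] cell_homotopy_pt[OF good[OF ptS] refl] lift_q that \<phi>_subspace
    by auto
  have lift_face: "sface Q (Suc n) i y = q n (sface S (Suc n) i (lift (Suc n) y))"
    if "y \<in> ssimplices Q (Suc n)" "i \<le> Suc n" for n i y
    using q_face[OF lift_in] q_lift that by simp
  have lift_degen: "sdegen Q n i y = q (Suc n) (sdegen S n i (lift n y))"
    if "y \<in> ssimplices Q n" "i \<le> n" for n i y
    using q_degen[OF lift_in] q_lift that by simp
  let ?K = "\<lambda>n y p. \<phi> (f (n, lift n y) p)"
  obtain K where K: "continuous_map (prod_topology unit_interval ?Q) ?Q K"
    "\<And>n y s t. \<lbrakk>y \<in> ssimplices Q n; s \<in> {0..1}; t \<in> standard_simplex n\<rbrakk>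
      \<Longrightarrow> K (s, rpoint Q n y t) = ?K n y (s, t)"
  proof (rule realization_lift_homotopy[of Q ?Q ?K])
    fix K assume "continuous_map (prod_topology unit_interval ?Q) ?Q K"
      "\<And>n y s t. \<lbrakk>y \<in> ssimplices Q n; s \<in> {0..1}; t \<in> standard_simplex n\<rbrakk>
        \<Longrightarrow> K (s, rpoint Q n y t) = ?K n y (s, t)"
    then show thesis by (rule that)
  next
    show "continuous_map (prod_topology unit_interval (simplex_space n)) ?Q (?K n y)"
      if "y \<in> ssimplices Q n" for n y
      using continuous_map_compose[OF cell_homotopy_continuous[OF good[OF lift_in[OF that]]] \<phi>(1)]
      by (simp add: o_def)
    show "?K n (sface Q (Suc n) i y) (s, t) = ?K (Suc n) y (s, simplical_face i t)"
      if "y \<in> ssimplices Q (Suc n)" "i \<le> Suc n" "s \<in> {0..1}" "t \<in> standard_simplex n" for n i y s t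
      using lift_hom[OF face_in[OF lift_in] that(3,4)] f_face[OF lift_in] lift_face that by simp
    show "?K (Suc n) (sdegen Q n i y) (s, t) = ?K n y (s, simplicial_collapse i t)"
      if "y \<in> ssimplices Q n" "i \<le> n" "s \<in> {0..1}" "t \<in> standard_simplex (Suc n)" for n i y s t
      using lift_hom[OF degen_in[OF lift_in] that(3,4)] f_degen[OF lift_in] lift_degen that by simp
  qed
  let ?G = "\<lambda>n y t. f (n, lift n y) (1, t)"
  obtain G where G: "continuous_map ?Q ?S G"
    "\<And>n y t. \<lbrakk>y \<in> ssimplices Q n; t \<in> standard_simplex n\<rbrakk> \<Longrightarrow> G (rpoint Q n y t) = ?G n y t"
  proof (rule realization_lift_map[of Q ?S ?G])
    fix G assume "continuous_map ?Q ?S G"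
      "\<And>n y t. \<lbrakk>y \<in> ssimplices Q n; t \<in> standard_simplex n\<rbrakk> \<Longrightarrow> G (rpoint Q n y t) = ?G n y t"
    then show thesis by (rule that)
  next
    show "continuous_map (simplex_space n) ?S (?G n y)"
      if "y \<in> ssimplices Q n" for n y
      using continuous_map_o_Pair[OF cell_homotopy_continuous[OF good[OF lift_in[OF that]]], of 1]
      by (simp add: o_def)
    show "?G n (sface Q (Suc n) i y) t = ?G (Suc n) y (simplical_face i t)"
      if "y \<in> ssimplices Q (Suc n)" "i \<le> Suc n" "t \<in> standard_simplex n" for n i y t
      using lift_end[OF face_in[OF lift_in] that(3)] f_face[OF lift_in] lift_face that by simp
    show "?G (Suc n) (sdegen Q n i y) t = ?G n y (simplicial_collapse i t)"
      if "y \<in> ssimplices Q n" "i \<le> n" "t \<in> standard_simplex (Suc n)" for n i y t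
      using lift_end[OF degen_in[OF lift_in] that(3)] f_degen[OF lift_in] lift_degen that by simp
  qed
  have hS: "homotopic_with (\<lambda>x. True) ?S ?S id (G \<circ> \<phi>)"
  proof (subst homotopic_with, simp, intro exI conjI ballI)
    show "H (0, p) = id p" "H (1, p) = (G \<circ> \<phi>) p" if p: "p \<in> topspace ?S" for p
    proof -
      obtain n x t where p: "p = rpoint S n x t" "x \<in> ssimplices S n" "t \<in> standard_simplex n"
        using p unfolding topspace_geometric_realization by blast
      show "H (0, p) = id p"
        using H(2) cell_homotopy_start[OF good] p by simp
      show "H (1, p) = (G \<circ> \<phi>) p"
        using H(2) \<phi>(2) G(2) q_in lift_end p by simp
    qed
  qed (use H in auto)
  have hQ: "homotopic_with (\<lambda>x. True) ?Q ?Q id (\<phi> \<circ> G)"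
  proof (subst homotopic_with, simp, intro exI conjI ballI)
    show "K (0, p) = id p" "K (1, p) = (\<phi> \<circ> G) p" if p: "p \<in> topspace ?Q" for p
    proof -
      obtain n y t where p: "p = rpoint Q n y t" "y \<in> ssimplices Q n" "t \<in> standard_simplex n"
        using p unfolding topspace_geometric_realization by blast
      show "K (0, p) = id p"
        using K(2) cell_homotopy_start[OF good] \<phi>(2) lift_in q_lift p by simp
      show "K (1, p) = (\<phi> \<circ> G) p"
        using K(2) G(2) p by simp
    qed
  qed (use K in auto)
  show ?thesis
    unfolding homotopy_equivalent_space_def
    by (intro exI[of _ \<phi>] exI[of _ G] conjI \<phi>(1) G(1)
        homotopic_with_symD[OF hS] homotopic_with_symD[OF hQ])
qed

end

section \<open>Steps in a metric fibration\<close>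

lemma mdist_refl: "x \<in> mspace X \<Longrightarrow> mdist X x x = 0"
  by simp

lemma path_len_append: "path_len X (as @ x # r) = path_len X (as @ [x]) + path_len X (x # r)"
  by (induction as rule: induct_list012) auto

lemma delete_nth_append:
  "delete_nth (length as) (as @ x # bs) = as @ bs"
  "delete_nth (Suc (length as)) (as @ x # y # bs) = as @ x # bs"
  by (simp_all add: delete_nth_def)

lemma repeat_nth_append: "repeat_nth (length as) (as @ x # bs) = as @ x # x # bs"
  by (simp add: repeat_nth_def)

lemma not_distinct_adj_repeat_nth:
  assumes "i < length xs"
  shows "\<not> distinct_adj (repeat_nth i xs)"
proof -
  have "xs = take i xs @ xs ! i # drop (Suc i) xs"
    using assms by (simp add: id_take_nth_drop)
  moreover have "length (take i xs) = i" using assms by simp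
  ultimately have "repeat_nth i xs = take i xs @ xs ! i # xs ! i # drop (Suc i) xs"
    by (metis repeat_nth_append)
  then show ?thesis by (simp add: distinct_adj_append_iff)
qed

lemma delete_nth_cases:
  assumes "i < length xs" "2 \<le> length xs"
  obtains (first) x y bs where "xs = x # y # bs" "i = 0" "delete_nth i xs = y # bs"
  | (last) as x y where "xs = as @ [x, y]" "i = Suc (length as)" "delete_nth i xs = as @ [x]"
  | (mid) as x y z bs where "xs = as @ x # y # z # bs" "i = Suc (length as)" "delete_nth i xs = as @ x # z # bs"
proof (cases "i = 0")
  case True
  with assms(2) obtain x y bs where xs: "xs = x # y # bs"
    by (cases xs; cases "tl xs") auto
  with True show thesis by (intro first) (simp_all add: delete_nth_def)
next
  case False
  define as where "as = take (i - 1) xs"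
  have i: "i = Suc (length as)" using False assms by (simp add: as_def)
  have "xs = take (i - 1) xs @ xs ! (i - 1) # drop (Suc (i - 1)) xs"
    using False assms by (intro id_take_nth_drop) simp
  moreover have "drop i xs = xs ! i # drop (Suc i) xs"
    using assms by (simp add: Cons_nth_drop_Suc)
  ultimately obtain x y zs where xs: "xs = as @ x # y # zs"
    using False by (simp add: as_def)
  then have "delete_nth i xs = as @ x # zs"
    using i delete_nth_append(2)[of as x y zs] by simp
  with xs i show thesis by (cases zs) (auto intro: last mid)
qed

lemma path_len_delete_nth_eqE:
  assumes "i < length xs" "2 \<le> length xs" "set xs \<subseteq> mspace X"
    and eq: "path_len X (delete_nth i xs) = path_len X xs"
  obtains (first) y bs where "xs = y # y # bs" "i = 0" "delete_nth i xs = y # bs"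
  | (last) as y where "xs = as @ [y, y]" "i = Suc (length as)" "delete_nth i xs = as @ [y]"
  | (mid) as x y z bs where "xs = as @ x # y # z # bs" "i = Suc (length as)"
      "delete_nth i xs = as @ x # z # bs" "mdist X x z = mdist X x y + mdist X y z"
  using assms(1,2)
proof (cases rule: delete_nth_cases)
  case (first x y bs)
  moreover have "x = y" using first eq assms(3) by simp
  ultimately show thesis using that(1) by blast
next
  case (last as x y)
  moreover have "x = y" using last eq assms(3) path_len_append[of X as x "[y]"] by simp
  ultimately show thesis using that(2) by blast
next
  case (mid as x y z bs)
  moreover have "mdist X x z = mdist X x y + mdist X y z"
    using mid eq path_len_append[of X as x "y # z # bs"] path_len_append[of X as x "z # bs"] by simp
  ultimately show thesis using that(3) by blast
qed

section \<open>Transport, base moves and fiber moves\<close>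

locale fibration =
  fixes E :: "'e metric" and B :: "'b metric" and p :: "'e \<Rightarrow> 'b"
  assumes metric_fibration: "metric_fibration E B p"
begin

lemma proj_in [simp]: "x \<in> mspace E \<Longrightarrow> p x \<in> mspace B"
  using metric_fibration by (auto simp: metric_fibration_def Lipschitz_continuous_map_def)

lemma mspace_fiber_iff: "x \<in> mspace (fiber E p b) \<longleftrightarrow> x \<in> mspace E \<and> p x = b"
  by (auto simp: fiber_def)

definition transport :: "'e \<Rightarrow> 'b \<Rightarrow> 'e" where
  "transport x b = (THE x'. x' \<in> mspace (fiber E p b) \<and> mdist E x x' = mdist B (p x) b \<and>
     (\<forall>y \<in> mspace (fiber E p b). mdist E x y = mdist E x x' + mdist E x' y))"

lemma transport:
  assumes "x \<in> mspace E" "b \<in> mspace B"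
  shows transport_in: "transport x b \<in> mspace E"
    and proj_transport: "p (transport x b) = b"
    and mdist_transport: "mdist E x (transport x b) = mdist B (p x) b"
    and mdist_via_transport: "\<lbrakk>y \<in> mspace E; p y = b\<rbrakk> \<Longrightarrow> mdist E x y = mdist B (p x) b + mdist E (transport x b) y"
proof -
  have "\<exists>!x'. x' \<in> mspace (fiber E p b) \<and> mdist E x x' = mdist B (p x) b \<and>
     (\<forall>y \<in> mspace (fiber E p b). mdist E x y = mdist E x x' + mdist E x' y)"
    using metric_fibration assms by (auto simp: metric_fibration_def)
  from theI'[OF this] show "transport x b \<in> mspace E" "p (transport x b) = b"
    "mdist E x (transport x b) = mdist B (p x) b"
    "\<lbrakk>y \<in> mspace E; p y = b\<rbrakk> \<Longrightarrow> mdist E x y = mdist B (p x) b + mdist E (transport x b) y"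
    unfolding transport_def[symmetric] by (auto simp: mspace_fiber_iff)
qed

lemma mdist_proj_le: "\<lbrakk>x \<in> mspace E; y \<in> mspace E\<rbrakk> \<Longrightarrow> mdist B (p x) (p y) \<le> mdist E x y"
  using mdist_via_transport[of x "p y" y] mdist_nonneg[of E "transport x (p y)" y] by simp

text \<open>The excess of \<open>mdist E x y\<close> over the base distance is the distance from the
  transport to \<open>y\<close>; here it vanishes.\<close>

lemma transport_unique:
  assumes "x \<in> mspace E" "y \<in> mspace E" "mdist E x y = mdist B (p x) (p y)"
  shows "transport x (p y) = y"
  using mdist_via_transport[of x "p y" y] transport_in[of x "p y"] assms by simp

lemma transport_transport_back:
  assumes "x \<in> mspace E" "b \<in> mspace B"
  shows "transport (transport x b) (p x) = x"
proof (rule transport_unique)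
  show "mdist E (transport x b) x = mdist B (p (transport x b)) (p x)"
    using transport[OF assms] by (metis mdist_commute)
qed (use assms transport_in in auto)

text \<open>Computes the distance between \<open>x\<close> and \<open>transport y b\<close> from
  either end. Transporting \<open>transport y b\<close> back gives \<open>y\<close>, and the base
  distance cancels.\<close>

lemma mdist_transport_transport:
  assumes "x \<in> mspace E" "y \<in> mspace E" "p x = p y" "b \<in> mspace B"
  shows "mdist E (transport x b) (transport y b) = mdist E x y"
proof -
  note x = transport[OF assms(1,4)] and y = transport[OF assms(2,4)]
  have "mdist E x (transport y b) = mdist B (p x) b + mdist E (transport x b) (transport y b)"
    using x(4)[of "transport y b"] y assms by simp
  moreover have "mdist E (transport y b) x = mdist B b (p x) + mdist E y x"
    using mdist_via_transport[OF y(1), of "p x" x] y transport_transport_back[OF assms(2,4)] assms by simp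
  ultimately show ?thesis by (simp add: mdist_commute)
qed

definition moves_base :: "'e \<Rightarrow> 'e \<Rightarrow> bool" where
  "moves_base x y \<longleftrightarrow> p x \<noteq> p y"

text \<open>For points of \<open>E\<close> the two distances differ by the distance from
  \<open>transport x (p y)\<close> to \<open>y\<close>, so the negation describes the horizontal
  steps.\<close>

definition moves_fiber :: "'e \<Rightarrow> 'e \<Rightarrow> bool" where
  "moves_fiber x y \<longleftrightarrow> mdist E x y \<noteq> mdist B (p x) (p y)"

lemma no_move [simp]: "\<not> moves_base x x" "\<not> moves_fiber x x" if "x \<in> mspace E"
  using that by (simp_all add: moves_base_def moves_fiber_def mdist_refl)

lemma moves_if_neq: "\<lbrakk>x \<in> mspace E; y \<in> mspace E; x \<noteq> y\<rbrakk> \<Longrightarrow> moves_base x y \<or> moves_fiber x y"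
  by (auto simp: moves_base_def moves_fiber_def mdist_refl)

lemma transport_moves:
  assumes "x \<in> mspace E" "z \<in> mspace E"
  shows "\<not> moves_fiber x (transport x (p z))" "\<not> moves_base (transport x (p z)) z"
    "moves_fiber x z \<Longrightarrow> transport x (p z) \<noteq> z"
  using transport[of x "p z"] assms by (auto simp: moves_fiber_def moves_base_def)

context
  fixes x y z
  assumes xyz: "x \<in> mspace E" "y \<in> mspace E" "z \<in> mspace E"
begin

text \<open>This is what makes the entry inserted by the matching both unique and length
  preserving.\<close>

lemma base_then_fiber:
  assumes "\<not> moves_fiber x y" "\<not> moves_base y z"
  shows base_then_fiber_between: "mdist E x z = mdist E x y + mdist E y z"
    and base_then_fiber_transport: "y = transport x (p z)"
proof -
  show "y = transport x (p z)"
    using transport_unique[OF xyz(1,2)] assms by (simp add: moves_fiber_def moves_base_def)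
  then show "mdist E x z = mdist E x y + mdist E y z"
    using mdist_via_transport[of x "p z" z] xyz assms by (simp add: moves_fiber_def moves_base_def)
qed

context
  assumes between: "mdist E x z = mdist E x y + mdist E y z"
begin

text \<open>The excess over the base distance is superadditive along geodesics, by the triangle
  inequality in \<open>B\<close>.\<close>

lemma moves_fiber_between:
  assumes "moves_fiber x y \<or> moves_fiber y z"
  shows "moves_fiber x z"
  unfolding moves_fiber_def
proof
  assume "mdist E x z = mdist B (p x) (p z)"
  then have "mdist E x y + mdist E y z \<le> mdist B (p x) (p y) + mdist B (p y) (p z)"
    using between mdist_triangle[of "p x" B "p y" "p z"] xyz by simp
  then show False
    using assms mdist_proj_le[of x y] mdist_proj_le[of y z] xyz by (auto simp: moves_fiber_def)
qed

lemma base_between_if_horizontal: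
  assumes "\<not> moves_fiber x z"
  shows "mdist B (p x) (p z) = mdist B (p x) (p y) + mdist B (p y) (p z)"
proof -
  have "\<not> moves_fiber x y" "\<not> moves_fiber y z" using assms moves_fiber_between by blast+
  with assms between show ?thesis by (simp add: moves_fiber_def)
qed

text \<open>Leaving the fiber and coming back is never geodesic: with \<open>p x = p z\<close>, transporting \<open>y\<close> back to
  the fiber of \<open>x\<close> gives a path that is shorter by \<open>2 d(p x, p y)\<close>.\<close>

lemma moves_base_between: "moves_base x z \<longleftrightarrow> moves_base x y \<or> moves_base y z"
proof -
  have "p y = p x" if "p x = p z"
  proof -
    let ?y = "transport y (p x)"
    have y: "?y \<in> mspace E" using transport_in xyz by simp
    have "mdist E y x = mdist B (p y) (p x) + mdist E ?y x" "mdist E y z = mdist B (p y) (p x) + mdist E ?y z"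
      using mdist_via_transport[of y "p x"] xyz that by simp_all
    moreover have "mdist E x z \<le> mdist E x ?y + mdist E ?y z"
      by (intro mdist_triangle xyz y)
    ultimately have "mdist B (p y) (p x) \<le> 0"
      using between mdist_commute[of E x y] mdist_commute[of E x ?y] by linarith
    then show ?thesis
      using mdist_nonneg[of B "p y" "p x"] xyz mdist_zero[of "p y" B "p x"] by simp
  qed
  then show ?thesis by (auto simp: moves_base_def)
qed

text \<open>Two horizontal base moves may compose, through holonomy, to a step that also moves in
  the fiber. If one step stays over a point, this cannot happen, since such a step without a fiber
  move is constant.\<close>

lemma moves_fiber_between_iff:
  assumes "\<not> moves_base x y \<or> \<not> moves_base y z"
  shows "moves_fiber x z \<longleftrightarrow> moves_fiber x y \<or> moves_fiber y z"
proof -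
  have "x = y \<or> y = z" if "\<not> moves_fiber x y" "\<not> moves_fiber y z"
    using assms moves_if_neq xyz that by blast
  then show ?thesis using moves_fiber_between by auto
qed

end

end

section \<open>Counting moves along a tuple\<close>

fun base_steps :: "'e list \<Rightarrow> nat" where
  "base_steps (x # y # r) = of_bool (moves_base x y) + base_steps (y # r)"
| "base_steps _ = 0"

fun fiber_steps :: "'e list \<Rightarrow> nat" where
  "fiber_steps (x # y # r) = of_bool (moves_fiber x y) + fiber_steps (y # r)"
| "fiber_steps _ = 0"

text \<open>The base move of the step \<open>x, y\<close> itself is left out, since a step with both
  moves counts as base first. Hence factoring such a step through the transport changes no
  count.\<close>

fun inversions :: "'e list \<Rightarrow> nat" where
  "inversions (x # y # r) = of_bool (moves_fiber x y) * base_steps (y # r) + inversions (y # r)"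
| "inversions _ = 0"

text \<open>A step that moves both in the base and in the fiber counts as moving first in the base.\<close>

fun base_before_fiber :: "'e list \<Rightarrow> bool" where
  "base_before_fiber (x # y # r) \<longleftrightarrow>
     moves_base x y \<and> 0 < fiber_steps (x # y # r) \<or> base_before_fiber (y # r)"
| "base_before_fiber _ \<longleftrightarrow> False"

lemma base_steps_append: "base_steps (as @ x # r) = base_steps (as @ [x]) + base_steps (x # r)"
  by (induction as rule: induct_list012) auto

lemma fiber_steps_append: "fiber_steps (as @ x # r) = fiber_steps (as @ [x]) + fiber_steps (x # r)"
  by (induction as rule: induct_list012) auto

lemma inversions_append:
  "inversions (as @ x # r) = inversions (as @ [x]) + fiber_steps (as @ [x]) * base_steps (x # r) + inversions (x # r)"
proof (induction as rule: induct_list012)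
  case (3 a b as)
  then show ?case
    using base_steps_append[of "b # as" x r] by (simp add: algebra_simps)
qed auto

lemma base_before_fiber_append:
  "base_before_fiber (as @ x # r) \<longleftrightarrow> base_before_fiber (as @ [x]) \<or>
     0 < base_steps (as @ [x]) \<and> 0 < fiber_steps (x # r) \<or> base_before_fiber (x # r)"
proof (induction as rule: induct_list012)
  case (3 a b as)
  then show ?case
    using fiber_steps_append[of "b # as" x r] by auto
qed auto

lemma fiber_steps_prefix: "fiber_steps xs \<le> fiber_steps (xs @ ys)"
  by (induction xs rule: induct_list012) auto

lemma base_before_fiber_prefix: "base_before_fiber xs \<Longrightarrow> base_before_fiber (xs @ ys)"
proof (induction xs rule: induct_list012)
  case (3 x y xs)
  then show ?case
    using fiber_steps_prefix[of "x # y # xs" ys] by auto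
qed auto

definition steps_rank :: "'e list \<Rightarrow> nat \<times> nat \<times> nat" where
  "steps_rank xs = (base_steps xs, fiber_steps xs, inversions xs)"

abbreviation steps_less :: "((nat \<times> nat \<times> nat) \<times> (nat \<times> nat \<times> nat)) set" where
  "steps_less \<equiv> less_than <*lex*> less_than <*lex*> less_than"

lemma steps_rank_repeat:
  assumes "x \<in> mspace E"
  shows "steps_rank (as @ x # x # bs) = steps_rank (as @ x # bs)"
    "base_before_fiber (as @ x # x # bs) \<longleftrightarrow> base_before_fiber (as @ x # bs)"
  using assms
  by (simp_all add: steps_rank_def
      base_steps_append[of as x "x # bs"] base_steps_append[of as x bs]
      fiber_steps_append[of as x "x # bs"] fiber_steps_append[of as x bs]
      inversions_append[of as x "x # bs"] inversions_append[of as x bs]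
      base_before_fiber_append[of as x "x # bs"] base_before_fiber_append[of as x bs])

text \<open>Every move of the two steps survives in the merged step, where a base move counts as
  preceding a fiber move.\<close>

lemma base_before_fiber_delete:
  assumes "x \<in> mspace E" "y \<in> mspace E" "z \<in> mspace E" "mdist E x z = mdist E x y + mdist E y z"
    and "base_before_fiber (as @ x # y # z # bs)"
  shows "base_before_fiber (as @ x # z # bs)"
  using assms(5) moves_fiber_between[OF assms(1-4)] moves_base_between[OF assms(1-4)]
  by (auto simp: base_before_fiber_append[of as x "y # z # bs"] base_before_fiber_append[of as x "z # bs"])

text \<open>Two base moves merge into at most one, lowering the first count whatever holonomy does
  to the second. Otherwise two fiber moves merge and lower the second count, or a fiber move
  followed by a base move becomes a step counted as base first, which loses an inversion. Only base
  then fiber, or a repetition, leaves all counts alone.\<close>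

lemma steps_rank_delete:
  assumes xyz: "x \<in> mspace E" "y \<in> mspace E" "z \<in> mspace E" "mdist E x z = mdist E x y + mdist E y z"
  shows "(steps_rank (as @ x # z # bs), steps_rank (as @ x # y # z # bs)) \<in> steps_less \<or>
    steps_rank (as @ x # z # bs) = steps_rank (as @ x # y # z # bs) \<and>
    (x = y \<or> y = z \<or> moves_base x y \<and> \<not> moves_fiber x y \<and> \<not> moves_base y z \<and> moves_fiber y z)"
proof -
  note append = base_steps_append[of as x "y # z # bs"] base_steps_append[of as x "z # bs"]
    fiber_steps_append[of as x "y # z # bs"] fiber_steps_append[of as x "z # bs"]
    inversions_append[of as x "y # z # bs"] inversions_append[of as x "z # bs"]
  note b = moves_base_between[OF xyz] and f = moves_fiber_between_iff[OF xyz]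
  consider "x = y" | "y = z" | "x \<noteq> y" "y \<noteq> z" by blast
  then show ?thesis
  proof cases
    case 1
    then show ?thesis using steps_rank_repeat(1)[OF xyz(1)] by simp
  next
    case 2
    then show ?thesis using steps_rank_repeat(1)[OF xyz(2), of "as @ [x]"] by simp
  next
    case 3
    then have m: "moves_base x y \<or> moves_fiber x y" "moves_base y z \<or> moves_fiber y z"
      using moves_if_neq xyz by blast+
    show ?thesis
    proof (cases "moves_base x y \<and> moves_base y z")
      case True
      then show ?thesis using b by (simp add: steps_rank_def append)
    next
      case nb: False
      show ?thesis
      proof (cases "moves_fiber x y \<and> moves_fiber y z")
        case True
        then show ?thesis
          using nb b f by (auto simp: steps_rank_def append)
      next
        case False
        then show ?thesis
          using nb b f m
          by (auto simp: steps_rank_def append)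
      qed
    qed
  qed
qed

lemma first_base_before_fiber:
  assumes "base_before_fiber xs"
  obtains as x bs where "xs = as @ x # bs" "\<not> base_before_fiber as" "base_before_fiber (as @ [x])"
  using assms
proof (induction xs rule: rev_induct)
  case (snoc x xs)
  then show ?case
  proof (cases "base_before_fiber xs")
    case True
    show ?thesis
    proof (rule snoc.IH[OF _ True])
      fix as y bs
      assume "xs = as @ y # bs" "\<not> base_before_fiber as" "base_before_fiber (as @ [y])"
      then show thesis by (intro snoc.prems(1)[of as y "bs @ [x]"]) simp_all
    qed
  qed (use snoc.prems in auto)
qed simp

text \<open>The property passes from a prefix to every extension, so two minimal prefixes of one
  tuple have the same length.\<close>

lemma first_base_before_fiber_unique:
  assumes eq: "as @ x # bs = as' @ x' # bs'"
    and "\<not> base_before_fiber as" "base_before_fiber (as @ [x])"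
    and "\<not> base_before_fiber as'" "base_before_fiber (as' @ [x'])"
  shows "as = as' \<and> x = x' \<and> bs = bs'"
proof -
  have *: False
    if "as @ x # bs = as' @ x' # bs'" "length as < length as'" "base_before_fiber (as @ [x])" "\<not> base_before_fiber as'"
    for as bs as' bs' x x'
  proof -
    have "take (Suc (length as)) as' = as @ [x]"
      using arg_cong[OF that(1), of "take (Suc (length as))"] that(2) by simp
    then have "as' = (as @ [x]) @ drop (Suc (length as)) as'"
      by (metis append_take_drop_id)
    then show False using base_before_fiber_prefix that(3,4) by metis
  qed
  have "length as = length as'"
    using *[OF eq] *[OF eq[symmetric]] assms by (meson linorder_neqE_nat)
  then show ?thesis using eq by simp
qed

end

section \<open>The acyclic matching on mixed tuples\<close>

context fibration
begin

definition mixed :: "real \<Rightarrow> nat \<Rightarrow> 'e list option set" where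
  "mixed l n = insert None (Some ` {xs. Some xs \<in> ssimplices (HW_sset E l) n \<and> base_before_fiber xs})"

text \<open>The matching inserts the transport \<open>y\<close> of \<open>x\<close> into the first step \<open>x, z\<close> that completes a
  base move before a fiber move, if this step moves in both directions; here \<open>i\<close> is the position of \<open>y\<close>.\<close>

definition matched_at :: "real \<Rightarrow> nat \<Rightarrow> 'e list option \<Rightarrow> nat \<Rightarrow> bool" where
  "matched_at l n \<sigma> i \<longleftrightarrow> \<sigma> \<in> ssimplices (HW_sset E l) n \<and>
     (\<exists>as x y z bs. \<sigma> = Some (as @ x # y # z # bs) \<and> i = Suc (length as) \<and> distinct_adj (as @ x # y # z # bs) \<and>
        \<not> base_before_fiber (as @ [x]) \<and> \<not> moves_fiber x y \<and> \<not> moves_base y z)"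

definition simplex_rank :: "'e list option \<Rightarrow> nat \<times> nat \<times> nat" where
  "simplex_rank \<sigma> = (case \<sigma> of None \<Rightarrow> (0, 0, 0) | Some xs \<Rightarrow> steps_rank xs)"

text \<open>The offset 3 places the free face \<open>d\<^sub>i x\<close> of a matched \<open>(n + 1)\<close>-simplex \<open>x\<close> directly after
  \<open>x\<close>, and degenerate simplices after what they are degenerate on.\<close>

definition level :: "real \<Rightarrow> nat \<Rightarrow> 'e list option \<Rightarrow> nat" where
  "level l n \<sigma> = (if \<sigma> = None \<or> (\<exists>i. matched_at l n \<sigma> i) then 2 * n else 2 * n + 3)"

definition below :: "real \<Rightarrow> (nat \<times> 'e list option) rel" where
  "below l = inv_image (steps_less <*lex*> less_than) (\<lambda>(n, \<sigma>). (simplex_rank \<sigma>, level l n \<sigma>))"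

lemma below_iff:
  "((n, \<sigma>), (m, \<tau>)) \<in> below l \<longleftrightarrow>
     (simplex_rank \<sigma>, simplex_rank \<tau>) \<in> steps_less \<or> simplex_rank \<sigma> = simplex_rank \<tau> \<and> level l n \<sigma> < level l m \<tau>"
  by (simp add: below_def)

lemma level_bounds: "2 * n \<le> level l n \<sigma>" "level l n \<sigma> \<le> 2 * n + 3"
  by (auto simp: level_def)

lemma zero_le_steps: "((0, 0, 0), r) \<in> steps_less \<or> r = (0, 0, 0)"
  by (cases r) auto

text \<open>The entry \<open>z\<close> completes the shortest prefix with a base move before a fiber
  move, both with \<open>y\<close> and without it. This common marker drives the uniqueness and
  disjointness results.\<close>

lemma matched_atE:
  assumes "matched_at l n \<sigma> i"
  obtains as x y z bs where "\<sigma> = Some (as @ x # y # z # bs)" "i = Suc (length as)"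
    "\<sigma> \<in> ssimplices (HW_sset E l) n" "n = length as + length bs + 2"
    "x \<in> mspace E" "y \<in> mspace E" "z \<in> mspace E" "distinct_adj (as @ x # y # z # bs)"
    "moves_base x y" "\<not> moves_fiber x y" "\<not> moves_base y z" "moves_fiber y z"
    "mdist E x z = mdist E x y + mdist E y z" "y = transport x (p z)" "moves_base x z" "moves_fiber x z"
    "\<not> base_before_fiber (as @ [x])" "\<not> base_before_fiber (as @ [x, y])"
    "base_before_fiber (as @ [x, z])" "base_before_fiber (as @ [x, y, z])"
    "sface (HW_sset E l) n i \<sigma> = Some (as @ x # z # bs)"
proof -
  obtain as x y z bs where \<sigma>: "\<sigma> = Some (as @ x # y # z # bs)" "i = Suc (length as)"
    "\<sigma> \<in> ssimplices (HW_sset E l) n" "distinct_adj (as @ x # y # z # bs)"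
    "\<not> base_before_fiber (as @ [x])" "\<not> moves_fiber x y" "\<not> moves_base y z"
    using assms unfolding matched_at_def by blast
  have n: "n = length as + length bs + 2" and xyz: "x \<in> mspace E" "y \<in> mspace E" "z \<in> mspace E"
    and len: "path_len E (as @ x # y # z # bs) = l"
    using \<sigma>(1,3) by (auto simp: HW_sset_simps)
  have "x \<noteq> y" "y \<noteq> z" using \<sigma>(4) by (auto simp: distinct_adj_append_iff)
  then have m: "moves_base x y" "moves_fiber y z" using moves_if_neq xyz \<sigma> by blast+
  have bet: "mdist E x z = mdist E x y + mdist E y z"
    using base_then_fiber_between[OF xyz \<sigma>(6,7)] .
  have xz: "moves_base x z" "moves_fiber x z"
    using moves_base_between[OF xyz bet] moves_fiber_between[OF xyz bet] m by auto
  have "path_len E (as @ x # z # bs) = l"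
    using len path_len_append[of E as x "y # z # bs"] path_len_append[of E as x "z # bs"] bet by simp
  then have "sface (HW_sset E l) n i \<sigma> = Some (as @ x # z # bs)"
    using \<sigma>(1,2) delete_nth_append(2)[of as x y "z # bs"] by (simp add: HW_sset_simps)
  moreover have "\<not> base_before_fiber (as @ [x, y])" "base_before_fiber (as @ [x, z])" "base_before_fiber (as @ [x, y, z])"
    using base_before_fiber_append[of as x "[y]"] base_before_fiber_append[of as x "[z]"]
      base_before_fiber_append[of as x "[y, z]"] \<sigma>(5,6) m xz by simp_all
  ultimately show thesis
    using that[OF \<sigma>(1,2,3) n xyz \<sigma>(4) m(1) \<sigma>(6,7) m(2) bet base_then_fiber_transport[OF xyz \<sigma>(6,7)] xz \<sigma>(5)] by blast
qed

lemma matched_at_unique: "\<lbrakk>matched_at l n \<sigma> i; matched_at l m \<sigma> j\<rbrakk> \<Longrightarrow> i = j"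
proof (elim matched_atE)
  fix as x y z bs as' x' y' z' bs'
  assume "\<sigma> = Some (as @ x # y # z # bs)" "\<sigma> = Some (as' @ x' # y' # z' # bs')"
    and f: "\<not> base_before_fiber (as @ [x, y])" "base_before_fiber (as @ [x, y, z])"
      "\<not> base_before_fiber (as' @ [x', y'])" "base_before_fiber (as' @ [x', y', z'])"
    and i: "i = Suc (length as)" "j = Suc (length as')"
  then have "(as @ [x, y]) @ z # bs = (as' @ [x', y']) @ z' # bs'" by simp
  from first_base_before_fiber_unique[OF this] f have "as @ [x, y] = as' @ [x', y']" by simp
  with i show "i = j" by simp
qed

text \<open>The marker \<open>z\<close> fixes the place of insertion, and the inserted entry is the
  transport of \<open>x\<close> to \<open>p z\<close>.\<close>

lemma matched_at_face_unique:
  assumes "matched_at l n \<sigma> i" "matched_at l n \<tau> j"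
    "sface (HW_sset E l) n i \<sigma> = sface (HW_sset E l) n j \<tau>"
  shows "\<sigma> = \<tau>"
  using assms
proof (elim matched_atE)
  fix as x y z bs as' x' y' z' bs'
  assume s: "\<sigma> = Some (as @ x # y # z # bs)" "\<tau> = Some (as' @ x' # y' # z' # bs')"
    and f: "\<not> base_before_fiber (as @ [x])" "base_before_fiber (as @ [x, z])"
      "\<not> base_before_fiber (as' @ [x'])" "base_before_fiber (as' @ [x', z'])"
    and y: "y = transport x (p z)" "y' = transport x' (p z')"
    and "sface (HW_sset E l) n i \<sigma> = Some (as @ x # z # bs)" "sface (HW_sset E l) n j \<tau> = Some (as' @ x' # z' # bs')"
  then have "(as @ [x]) @ z # bs = (as' @ [x']) @ z' # bs'" using assms(3) by simp
  from first_base_before_fiber_unique[OF this] f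
  have "as @ [x] = as' @ [x']" "z = z'" "bs = bs'" by simp_all
  with s y show "\<sigma> = \<tau>" by simp
qed

text \<open>The step into the marker is vertical in a matched simplex but moves in the base in its
  matched face.\<close>

lemma not_matched_at_face:
  assumes "matched_at l n \<sigma> i"
  shows "\<not> matched_at l m (sface (HW_sset E l) n i \<sigma>) j"
proof
  assume "matched_at l m (sface (HW_sset E l) n i \<sigma>) j"
  with assms show False
  proof (elim matched_atE)
    fix as x y z bs as' x' y' z' bs'
    assume f: "\<not> base_before_fiber (as @ [x])" "base_before_fiber (as @ [x, z])"
        "\<not> base_before_fiber (as' @ [x', y'])" "base_before_fiber (as' @ [x', y', z'])"
      and m: "moves_base x z" "\<not> moves_base y' z'"
      and "sface (HW_sset E l) n i \<sigma> = Some (as @ x # z # bs)"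
        "sface (HW_sset E l) n i \<sigma> = Some (as' @ x' # y' # z' # bs')"
    then have "(as @ [x]) @ z # bs = (as' @ [x', y']) @ z' # bs'" by simp
    from first_base_before_fiber_unique[OF this] f
    have "as @ [x] = as' @ [x', y']" "z = z'" by simp_all
    then have "x = y'" "z = z'" by auto
    with m show False by simp
  qed
qed

lemma matched_at_nondegenerate:
  assumes "matched_at l n \<sigma> i" "\<tau> \<in> ssimplices (HW_sset E l) m" "j \<le> m"
  shows "\<sigma> \<noteq> sdegen (HW_sset E l) m j \<tau>" "sface (HW_sset E l) n i \<sigma> \<noteq> sdegen (HW_sset E l) m j \<tau>"
proof -
  have *: "sdegen (HW_sset E l) m j \<tau> \<noteq> Some xs" if "distinct_adj xs" for xs
    using assms(2)
  proof (cases rule: ssimplices_HW_cases)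
    case (2 ys)
    then have "\<not> distinct_adj (repeat_nth j ys)"
      using assms(3) by (intro not_distinct_adj_repeat_nth) simp
    with 2 that show ?thesis by (auto simp: HW_sset_simps)
  qed (simp add: HW_sset_simps)
  from assms(1) show "\<sigma> \<noteq> sdegen (HW_sset E l) m j \<tau>" "sface (HW_sset E l) n i \<sigma> \<noteq> sdegen (HW_sset E l) m j \<tau>"
  proof (atomize (full), elim matched_atE)
    fix as x y z bs
    assume s: "\<sigma> = Some (as @ x # y # z # bs)" "sface (HW_sset E l) n i \<sigma> = Some (as @ x # z # bs)"
      and d: "distinct_adj (as @ x # y # z # bs)" and "moves_base x z"
    then have "x \<noteq> z" by (auto simp: moves_base_def)
    then have "distinct_adj (as @ x # z # bs)" using d by (auto simp: distinct_adj_append_iff)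
    then show "\<sigma> \<noteq> sdegen (HW_sset E l) m j \<tau> \<and> sface (HW_sset E l) n i \<sigma> \<noteq> sdegen (HW_sset E l) m j \<tau>"
      using *[OF d] * s by metis
  qed
qed

lemma matched_at_rank: "matched_at l n \<sigma> i \<Longrightarrow> simplex_rank (sface (HW_sset E l) n i \<sigma>) = simplex_rank \<sigma>"
proof (elim matched_atE)
  fix as x y z bs
  assume "\<sigma> = Some (as @ x # y # z # bs)" "sface (HW_sset E l) n i \<sigma> = Some (as @ x # z # bs)"
    and "moves_base x y" "\<not> moves_fiber x y" "\<not> moves_base y z" "moves_fiber y z" "moves_base x z" "moves_fiber x z"
  then show ?thesis
    by (simp add: simplex_rank_def steps_rank_def
        base_steps_append[of as x "y # z # bs"] base_steps_append[of as x "z # bs"]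
        fiber_steps_append[of as x "y # z # bs"] fiber_steps_append[of as x "z # bs"]
        inversions_append[of as x "y # z # bs"] inversions_append[of as x "z # bs"])
qed

text \<open>Handles the other corners where deletion keeps the rank. The prefix up to
  \<open>z\<close> already has a base move before a fiber move, so the matched place lies further
  left and survives the deletion.\<close>

lemma matched_at_other_face:
  assumes m: "matched_at l n (Some (as @ x # y # z # bs)) k" and k: "k \<noteq> Suc (length as)"
    and xyz: "moves_base x y" "\<not> moves_base y z" "moves_fiber y z" "x \<noteq> z"
    and face: "Some (as @ x # z # bs) \<in> ssimplices (HW_sset E l) n'"
  shows "matched_at l n' (Some (as @ x # z # bs)) k"
  using m
proof (rule matched_atE)
  fix as' x' y' z' bs'
  assume s: "Some (as @ x # y # z # bs) = Some (as' @ x' # y' # z' # bs')" and k': "k = Suc (length as')"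
    and f: "\<not> base_before_fiber (as' @ [x'])" "\<not> base_before_fiber (as' @ [x', y'])"
    and m': "\<not> moves_fiber x' y'" "\<not> moves_base y' z'" and d: "distinct_adj (as' @ x' # y' # z' # bs')"
  have eq: "as @ x # y # z # bs = as' @ x' # y' # z' # bs'" using s by simp
  have "base_before_fiber (as @ [x, y, z])"
    using base_before_fiber_append[of as x "[y, z]"] xyz by simp
  moreover have "as' @ [x', y'] = (as @ [x, y, z]) @ drop (length as + 3) (as' @ [x', y'])" if "length as < length as'"
  proof -
    have "take (length as + 3) (as' @ [x', y']) = take (length as + 3) ((as' @ [x', y']) @ z' # bs')"
      unfolding take_append[of _ "as' @ [x', y']"] using that by simp
    also have "(as' @ [x', y']) @ z' # bs' = as @ x # y # z # bs" using eq by simp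
    also have "take (length as + 3) \<dots> = as @ [x, y, z]" by simp
    finally show ?thesis by (metis append_take_drop_id)
  qed
  ultimately have "\<not> length as < length as'"
    using f(2) base_before_fiber_prefix by metis
  moreover have "length as \<noteq> length as'" using k k' by simp
  \<comment> \<open>If the corners overlapped this way, the base move \<open>x, y\<close> would be
    the vertical step \<open>y', z'\<close>.\<close>
  moreover have "length as \<noteq> Suc (length as')"
  proof
    assume "length as = Suc (length as')"
    then have "x = y'" "y = z'"
      using arg_cong[OF eq, of "\<lambda>xs. xs ! length as"] arg_cong[OF eq, of "\<lambda>xs. xs ! Suc (length as)"]
      by (simp_all add: nth_append)
    then show False using xyz m' by simp
  qed
  ultimately have len: "length (as' @ [x', y']) \<le> length as" by simp
  have "(as' @ [x', y']) @ z' # bs' = as @ x # y # z # bs" using eq by simp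
  then obtain us where "as' @ [x', y'] = as @ us \<and> us @ z' # bs' = x # y # z # bs \<or>
      (as' @ [x', y']) @ us = as \<and> z' # bs' = us @ x # y # z # bs"
    using append_eq_append_conv2[of "as' @ [x', y']"] by blast
  moreover have "us = []" if "as' @ [x', y'] = as @ us"
    using arg_cong[OF that, of length] len by simp
  ultimately obtain cs where cs: "as = (as' @ [x', y']) @ cs" "z' # bs' = cs @ x # y # z # bs"
    by (metis append_Nil append_Nil2)
  then obtain ds where ds: "cs @ x # z # bs = z' # ds" by (cases cs) auto
  have "distinct_adj (as @ x # z # bs)"
    using d xyz(4) unfolding eq[symmetric] by (auto simp: distinct_adj_append_iff)
  moreover have "as @ x # z # bs = as' @ x' # y' # z' # ds" using cs(1) ds by simp
  ultimately show ?thesis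
    unfolding matched_at_def using face f(1) m' k'
    by (intro conjI exI[of _ as'] exI[of _ x'] exI[of _ y'] exI[of _ z'] exI[of _ ds]) simp_all
qed

text \<open>The base point has the least rank. Any other face keeps the rank only by removing a
  repetition or at a base-then-fiber corner, and then the level decides.\<close>

lemma below_face:
  assumes \<sigma>: "\<sigma> \<in> ssimplices (HW_sset E l) (Suc n)" and i: "i \<le> Suc n" "\<not> matched_at l (Suc n) \<sigma> i"
  shows "((n, sface (HW_sset E l) (Suc n) i \<sigma>), (Suc n, \<sigma>)) \<in> below l"
proof (cases "sface (HW_sset E l) (Suc n) i \<sigma>")
  case None
  then show ?thesis
    using zero_le_steps[of "simplex_rank \<sigma>"] level_bounds(1)[of "Suc n" l \<sigma>]
    by (auto simp: below_iff level_def[of l n] simplex_rank_def[of None])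
next
  case (Some ys)
  with \<sigma> obtain xs where xs: "\<sigma> = Some xs" "length xs = Suc (Suc n)" "set xs \<subseteq> mspace E" "path_len E xs = l"
    by (cases rule: ssimplices_HW_cases) (auto simp: HW_sset_simps)
  have ys: "ys = delete_nth i xs" "path_len E (delete_nth i xs) = l"
    using Some xs by (auto simp: HW_sset_simps split: if_splits)
  have ys_in: "Some ys \<in> ssimplices (HW_sset E l) n"
    using ys xs i set_delete_nth[of i xs] by (auto simp: HW_sset_simps length_delete_nth)
  \<comment> \<open>A tuple with a repetition is unmatched, so its level
    \<open>2 * Suc n + 3\<close> exceeds every level in degree \<open>n\<close>.\<close>
  have degenerate: ?thesis if "\<not> distinct_adj xs" "steps_rank ys = steps_rank xs"
  proof -
    have "\<not> matched_at l (Suc n) \<sigma> k" for k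
      using that(1) xs(1) unfolding matched_at_def by auto
    then have "level l (Suc n) \<sigma> = 2 * Suc n + 3" using xs(1) by (simp add: level_def)
    then show ?thesis
      using Some that(2) xs(1) level_bounds(2)[of l n "Some ys"] by (simp add: below_iff simplex_rank_def)
  qed
  have "i < length xs" "2 \<le> length xs" "set xs \<subseteq> mspace E" "path_len E (delete_nth i xs) = path_len E xs"
    using xs ys i by simp_all
  then show ?thesis
  proof (cases rule: path_len_delete_nth_eqE)
    case (first y bs)
    then show ?thesis
      using ys xs steps_rank_repeat(1)[of y "[]" bs] by (intro degenerate) auto
  next
    case (last as y)
    then show ?thesis
      using ys xs steps_rank_repeat(1)[of y as "[]"] by (intro degenerate) (auto simp: distinct_adj_append_iff)
  next
    case (mid as x y z bs)
    have xyz: "x \<in> mspace E" "y \<in> mspace E" "z \<in> mspace E" using mid xs by auto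
    consider "(steps_rank ys, steps_rank xs) \<in> steps_less"
      | "steps_rank ys = steps_rank xs" "x = y \<or> y = z"
      | "steps_rank ys = steps_rank xs" "moves_base x y" "\<not> moves_fiber x y" "\<not> moves_base y z" "moves_fiber y z"
      using steps_rank_delete[OF xyz mid(4), of as bs] mid ys by auto
    then show ?thesis
    proof cases
      case 1
      then show ?thesis using Some xs(1) by (simp add: below_iff simplex_rank_def)
    next
      case 2
      then show ?thesis using mid(1) by (intro degenerate) (auto simp: distinct_adj_append_iff)
    next
      case 3
      have "x \<noteq> z"
        using 3 by (auto simp: moves_base_def)
      \<comment> \<open>A simplex matched elsewhere passes its matching on to the face, and the
        levels are \<open>2 * n\<close> and \<open>2 * Suc n\<close>; an unmatched simplex has the
        offset 3 on its side.\<close>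
      have "level l n (Some ys) < level l (Suc n) \<sigma>"
      proof (cases "\<exists>k. matched_at l (Suc n) \<sigma> k")
        case True
        then obtain k where k: "matched_at l (Suc n) \<sigma> k" ..
        then have "k \<noteq> i" using i by blast
        have "matched_at l n (Some ys) k"
          using matched_at_other_face[of l "Suc n" as x y z bs k n] k \<open>k \<noteq> i\<close> 3 \<open>x \<noteq> z\<close> mid ys ys_in xs(1) by simp
        then have "level l n (Some ys) = 2 * n" by (auto simp: level_def)
        then show ?thesis using level_bounds(1)[of "Suc n" l \<sigma>] by simp
      next
        case False
        then have "level l (Suc n) \<sigma> = 2 * Suc n + 3" using xs(1) by (simp add: level_def)
        then show ?thesis using level_bounds(2)[of l n "Some ys"] by simp
      qed
      then show ?thesis using 3(1) Some xs(1) by (simp add: below_iff simplex_rank_def)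
    qed
  qed
qed

lemma base_before_fiber_face:
  assumes "i < length xs" "2 \<le> length xs" "set xs \<subseteq> mspace E" "path_len E (delete_nth i xs) = path_len E xs"
    and bbf: "base_before_fiber xs"
  shows "base_before_fiber (delete_nth i xs)"
  using assms(1-4)
proof (cases rule: path_len_delete_nth_eqE)
  case (first y bs)
  then show ?thesis using steps_rank_repeat(2)[of y "[]" bs] bbf assms(3) by simp
next
  case (last as y)
  then show ?thesis using steps_rank_repeat(2)[of y as "[]"] bbf assms(3) by simp
next
  case (mid as x y z bs)
  then show ?thesis using base_before_fiber_delete[of x y z as bs] bbf assms(3) by simp
qed

text \<open>Consider the step \<open>x, z\<close> that completes the first base move before a fiber
  move. If it moves in the base, inserting the transport exhibits the tuple as a matched face; if it
  is vertical, the preceding step is purely horizontal and the tuple is matched at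
  \<open>x\<close>.\<close>

lemma mixed_matching:
  assumes \<sigma>: "\<sigma> \<in> mixed l n" "\<sigma> \<noteq> None"
    and nondegen: "\<And>m \<tau> i. \<lbrakk>n = Suc m; \<tau> \<in> ssimplices (HW_sset E l) m; i \<le> m\<rbrakk> \<Longrightarrow> \<sigma> \<noteq> sdegen (HW_sset E l) m i \<tau>"
  shows "(\<exists>i. matched_at l n \<sigma> i) \<or> (\<exists>\<tau> i. matched_at l (Suc n) \<tau> i \<and> \<sigma> = sface (HW_sset E l) (Suc n) i \<tau>)"
proof -
  obtain xs where xs: "\<sigma> = Some xs" "Some xs \<in> ssimplices (HW_sset E l) n" "base_before_fiber xs"
    using \<sigma> by (auto simp: mixed_def)
  then have in_E: "set xs \<subseteq> mspace E" "length xs = Suc n" "path_len E xs = l"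
    by (simp_all add: HW_sset_simps)
  have dist: "distinct_adj xs"
  proof (rule ccontr)
    assume "\<not> distinct_adj xs"
    then obtain i where i: "Suc i < length xs" "xs ! i = xs ! Suc i"
      by (auto simp: distinct_adj_conv_nth)
    define as bs where "as = take i xs" and "bs = drop (Suc (Suc i)) xs"
    have "xs = as @ xs ! i # xs ! i # bs"
      using i id_take_nth_drop[of i xs] Cons_nth_drop_Suc[of "Suc i" xs] by (simp add: as_def bs_def)
    moreover have "length as = i" using i by (simp add: as_def)
    ultimately obtain x where x: "xs = as @ x # x # bs" "i = length as" by blast
    obtain m where m: "n = Suc m" using i in_E by (cases n) auto
    have "path_len E (as @ x # bs) = l"
      using in_E x path_len_append[of E as x "x # bs"] path_len_append[of E as x bs] by (simp add: mdist_refl)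
    then have "Some (as @ x # bs) \<in> ssimplices (HW_sset E l) m"
      using in_E x m by (simp add: HW_sset_simps)
    from nondegen[OF m this, of i] show False
      using x xs i in_E m repeat_nth_append[of as x bs] by (simp add: HW_sset_simps)
  qed
  obtain us z bs where us: "xs = us @ z # bs" "\<not> base_before_fiber us" "base_before_fiber (us @ [z])"
    using first_base_before_fiber xs(3) by blast
  obtain as x where as: "us = as @ [x]"
    using us(3) by (cases us rule: rev_cases) auto
  have xz: "x \<in> mspace E" "z \<in> mspace E" using in_E us as by auto
  \<comment> \<open>However \<open>z\<close> completes the prefix, the fiber move lies in its last
    step.\<close>
  have fz: "moves_fiber x z"
    using base_before_fiber_append[of as x "[z]"] us as by (auto split: if_splits)
  show ?thesis
  proof (cases "moves_base x z")
    case True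
    define y where "y = transport x (p z)"
    have y: "y \<in> mspace E" "\<not> moves_fiber x y" "\<not> moves_base y z" "y \<noteq> z"
      using transport_in[of x "p z"] transport_moves[OF xz] fz xz by (auto simp: y_def)
    have "x \<noteq> y" using y True by auto
    have "path_len E (as @ x # y # z # bs) = l"
      using in_E(3) us as base_then_fiber_between[OF xz(1) y(1) xz(2) y(2,3)]
        path_len_append[of E as x "y # z # bs"] path_len_append[of E as x "z # bs"] by simp
    then have "Some (as @ x # y # z # bs) \<in> ssimplices (HW_sset E l) (Suc n)"
      using in_E us as y by (auto simp: HW_sset_simps)
    moreover have "distinct_adj (as @ x # y # z # bs)"
      using dist us as \<open>x \<noteq> y\<close> y(4) by (auto simp: distinct_adj_append_iff)
    ultimately have m: "matched_at l (Suc n) (Some (as @ x # y # z # bs)) (Suc (length as))"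
      using y us(2) as unfolding matched_at_def by blast
    have "\<sigma> = sface (HW_sset E l) (Suc n) (Suc (length as)) (Some (as @ x # y # z # bs))"
      using xs(1) us as in_E(3) delete_nth_append(2)[of as x y "z # bs"] by (simp add: HW_sset_simps)
    with m show ?thesis by blast
  next
    case False
    \<comment> \<open>A vertical completing step needs an earlier base move, so \<open>x\<close> has
      a predecessor.\<close>
    have "as \<noteq> []" using us as False by auto
    then obtain cs w where cs: "as = cs @ [w]" by (cases as rule: rev_cases) auto
    have w: "w \<in> mspace E" "w \<noteq> x" using in_E us as cs dist by (auto simp: distinct_adj_append_iff)
    have "0 < base_steps (cs @ [w, x])"
      using base_before_fiber_append[of as x "[z]"] us as cs False by simp
    \<comment> \<open>A fiber move in \<open>w, x\<close> would follow or accompany the base move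
      just found, and \<open>us\<close> would not be minimal.\<close>
    then have "\<not> moves_fiber w x"
      using base_before_fiber_append[of cs w "[x]"] base_steps_append[of cs w "[x]"] us as cs
      by (auto split: if_splits)
    moreover have "\<not> base_before_fiber (cs @ [w])"
      using us as cs base_before_fiber_prefix[of "cs @ [w]" "[x]"] by auto
    ultimately have "matched_at l n \<sigma> (Suc (length cs))"
      unfolding matched_at_def using xs us as cs False dist
      by (intro conjI exI[of _ cs] exI[of _ w] exI[of _ x] exI[of _ z] exI[of _ bs]) simp_all
    then show ?thesis by blast
  qed
qed

theorem sset_collapse_HW: "sset_collapse (HW_sset E l) None (mixed l) (matched_at l) (below l)"
proof
  show "simplicial_set (HW_sset E l)" by (rule simplicial_set_HW_sset)
  show "None \<in> mixed l n" "mixed l n \<subseteq> ssimplices (HW_sset E l) n" for n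
    by (auto simp: mixed_def HW_sset_simps)
  show "sface (HW_sset E l) (Suc n) i None = None" "sdegen (HW_sset E l) n i None = None" for n i
    by (simp_all add: HW_sset_simps)
  show "sface (HW_sset E l) (Suc n) i \<sigma> \<in> mixed l n"
    if "\<sigma> \<in> mixed l (Suc n)" "i \<le> Suc n" for n i \<sigma>
  proof (cases "sface (HW_sset E l) (Suc n) i \<sigma>")
    case (Some ys)
    with that obtain xs where xs: "\<sigma> = Some xs" "set xs \<subseteq> mspace E" "length xs = Suc (Suc n)"
      "path_len E xs = l" "base_before_fiber xs"
      by (auto simp: mixed_def HW_sset_simps)
    with Some have ys: "ys = delete_nth i xs" "path_len E ys = l"
      by (auto simp: HW_sset_simps split: if_splits)
    then have "base_before_fiber ys"
      using base_before_fiber_face[of i xs] xs that by simp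
    then show ?thesis
      using ys xs Some that set_delete_nth[of i xs] by (auto simp: mixed_def HW_sset_simps length_delete_nth)
  qed (simp add: mixed_def)
  show "wf (below l)" unfolding below_def by (intro wf_inv_image wf_lex_prod wf_less_than)
  show "trans (below l)" unfolding below_def by (intro trans_inv_image trans_lex_prod trans_less_than)
  show "((n, \<sigma>), (Suc n, sdegen (HW_sset E l) n i \<sigma>)) \<in> below l"
    if \<sigma>: "\<sigma> \<in> ssimplices (HW_sset E l) n" "i \<le> n" for n i \<sigma>
    using \<sigma>(1)
  proof (cases rule: ssimplices_HW_cases)
    case 1
    then show ?thesis by (simp add: below_iff HW_sset_simps level_def)
  next
    case (2 xs)
    have xs: "xs = take i xs @ xs ! i # drop (Suc i) xs" and i: "length (take i xs) = i" "xs ! i \<in> mspace E"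
      using 2 \<sigma>(2) by (auto simp: id_take_nth_drop)
    then have "repeat_nth i xs = take i xs @ xs ! i # xs ! i # drop (Suc i) xs"
      by (metis repeat_nth_append)
    then have "steps_rank (repeat_nth i xs) = steps_rank xs"
      using steps_rank_repeat(1)[OF i(2), of "take i xs" "drop (Suc i) xs"] xs by simp
    moreover have "\<not> matched_at l (Suc n) (Some (repeat_nth i xs)) k" for k
      using not_distinct_adj_repeat_nth[of i xs] 2 \<sigma>(2) unfolding matched_at_def by auto
    ultimately show ?thesis
      using 2 level_bounds(2)[of l n \<sigma>] by (simp add: below_iff HW_sset_simps level_def[of l "Suc n"] simplex_rank_def)
  qed
  show "((n, sface (HW_sset E l) (Suc n) i \<sigma>), (Suc n, \<sigma>)) \<in> below l"
    if "\<sigma> \<in> ssimplices (HW_sset E l) (Suc n)" "i \<le> Suc n" "\<not> matched_at l (Suc n) \<sigma> i" for n i \<sigma>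
    using that by (rule below_face)
  show "\<sigma> \<in> mixed l n \<and> 1 \<le> n \<and> i \<le> n" if "matched_at l n \<sigma> i" for n \<sigma> i
    using that
  proof (rule matched_atE)
    fix as x y z bs
    assume "\<sigma> = Some (as @ x # y # z # bs)" "i = Suc (length as)" "\<sigma> \<in> ssimplices (HW_sset E l) n"
      "n = length as + length bs + 2" "base_before_fiber (as @ [x, y, z])"
    then show ?thesis
      using base_before_fiber_prefix[of "as @ [x, y, z]" bs] by (simp add: mixed_def)
  qed
  show "\<sigma> \<noteq> sdegen (HW_sset E l) n j \<tau>"
    if "matched_at l (Suc n) \<sigma> i" "\<tau> \<in> ssimplices (HW_sset E l) n" "j \<le> n" for n \<sigma> \<tau> i j
    using matched_at_nondegenerate(1)[OF that] .
  show "sface (HW_sset E l) (Suc (Suc n)) i \<sigma> \<noteq> sdegen (HW_sset E l) n j \<tau>"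
    if "matched_at l (Suc (Suc n)) \<sigma> i" "\<tau> \<in> ssimplices (HW_sset E l) n" "j \<le> n" for n \<sigma> \<tau> i j
    using matched_at_nondegenerate(2)[OF that] .
  show "\<sigma> \<noteq> None \<and> sface (HW_sset E l) (Suc n) i \<sigma> \<noteq> None" if "matched_at l (Suc n) \<sigma> i" for n \<sigma> i
    using that by (rule matched_atE) simp
  have face_level: "level l n (sface (HW_sset E l) (Suc n) i \<sigma>) = 2 * n + 3" and level: "level l (Suc n) \<sigma> = 2 * Suc n"
    if "matched_at l (Suc n) \<sigma> i" for n \<sigma> i
    using that not_matched_at_face[OF that] by (auto simp: level_def elim: matched_atE)
  show "((Suc n, \<sigma>), (n, sface (HW_sset E l) (Suc n) i \<sigma>)) \<in> below l"
    if "matched_at l (Suc n) \<sigma> i" for n \<sigma> i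
    using face_level[OF that] level[OF that] matched_at_rank[OF that] by (simp add: below_iff)
  \<comment> \<open>The matched face has level \<open>2 * n + 3\<close>, still below the least
    possible level \<open>2 * n + 4\<close> in degree \<open>n + 2\<close>.\<close>
  show "((n, sface (HW_sset E l) (Suc n) i \<sigma>), (Suc (Suc n), \<tau>)) \<in> below l"
    if "matched_at l (Suc n) \<sigma> i" "((Suc n, \<sigma>), (Suc (Suc n), \<tau>)) \<in> below l" for n i \<sigma> \<tau>
    using face_level[OF that(1)] matched_at_rank[OF that(1)] that(2) level_bounds(1)[of "Suc (Suc n)" l \<tau>]
    by (auto simp: below_iff)
  show "i = j" if "matched_at l n \<sigma> i" "matched_at l n \<sigma> j" for n \<sigma> i j
    using matched_at_unique[OF that] .
  show "\<sigma> = \<tau>" if "matched_at l (Suc n) \<sigma> i" "matched_at l (Suc n) \<tau> j"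
    "sface (HW_sset E l) (Suc n) i \<sigma> = sface (HW_sset E l) (Suc n) j \<tau>" for n \<sigma> \<tau> i j
    using matched_at_face_unique[OF that] .
  show "(\<exists>i. matched_at l n \<sigma> i) \<or> (\<exists>\<tau> i. matched_at l (Suc n) \<tau> i \<and> \<sigma> = sface (HW_sset E l) (Suc n) i \<tau>)"
    if "\<sigma> \<in> mixed l n" "\<sigma> \<noteq> None"
      "\<And>m \<tau> i. n = Suc m \<Longrightarrow> \<tau> \<in> ssimplices (HW_sset E l) m \<Longrightarrow> i \<le> m \<Longrightarrow> \<sigma> \<noteq> sdegen (HW_sset E l) m i \<tau>"
    for n \<sigma>
    using mixed_matching[OF that] .
qed

end

section \<open>Comparison with the product\<close>

text \<open>The quotient by \<open>D\<close>, modelled on representatives so that simplices keep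
  their type.\<close>

definition collapse_sset :: "'s sset \<Rightarrow> (nat \<Rightarrow> 's set) \<Rightarrow> 's \<Rightarrow> 's sset" where
  "collapse_sset S D pt = \<lparr>
     ssimplices = (\<lambda>n. insert pt (ssimplices S n - D n)),
     sface = (\<lambda>n i x. if sface S n i x \<in> D (n - 1) then pt else sface S n i x),
     sdegen = (\<lambda>n i x. if sdegen S n i x \<in> D (Suc n) then pt else sdegen S n i x) \<rparr>"

lemma collapse_sset_simps [simp]:
  "ssimplices (collapse_sset S D pt) n = insert pt (ssimplices S n - D n)"
  "sface (collapse_sset S D pt) n i x = (if sface S n i x \<in> D (n - 1) then pt else sface S n i x)"
  "sdegen (collapse_sset S D pt) n i x = (if sdegen S n i x \<in> D (Suc n) then pt else sdegen S n i x)"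
  by (simp_all add: collapse_sset_def)

context fibration
begin

lemma mixed_iff: "Some xs \<in> mixed l n \<longleftrightarrow> Some xs \<in> ssimplices (HW_sset E l) n \<and> base_before_fiber xs"
  "None \<in> mixed l n"
  by (auto simp: mixed_def)

lemma base_before_fiber_repeat_nth:
  assumes "i < length xs" "set xs \<subseteq> mspace E"
  shows "base_before_fiber (repeat_nth i xs) \<longleftrightarrow> base_before_fiber xs"
proof -
  have xs: "xs = take i xs @ xs ! i # drop (Suc i) xs" and i: "length (take i xs) = i" "xs ! i \<in> mspace E"
    using assms by (auto simp: id_take_nth_drop)
  then have "repeat_nth i xs = take i xs @ xs ! i # xs ! i # drop (Suc i) xs"
    by (metis repeat_nth_append)
  then show ?thesis
    using steps_rank_repeat(2)[OF i(2), of "take i xs" "drop (Suc i) xs"] xs by simp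
qed

lemma mixed_degen_iff:
  assumes "\<sigma> \<in> ssimplices (HW_sset E l) n" "i \<le> n"
  shows "sdegen (HW_sset E l) n i \<sigma> \<in> mixed l (Suc n) \<longleftrightarrow> \<sigma> \<in> mixed l n"
  using assms(1)
proof (cases rule: ssimplices_HW_cases)
  case (2 xs)
  then have "set (repeat_nth i xs) \<subseteq> mspace E" using set_repeat_nth[of i xs] by auto
  then show ?thesis
    using 2 assms(2) base_before_fiber_repeat_nth[of i xs]
    by (simp add: HW_sset_simps mixed_iff length_repeat_nth path_len_repeat_nth)
qed (simp add: HW_sset_simps mixed_iff)

lemma mixed_face:
  assumes "\<sigma> \<in> mixed l (Suc n)" "i \<le> Suc n"
  shows "sface (HW_sset E l) (Suc n) i \<sigma> \<in> mixed l n"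
  using sset_collapse.D_face[OF sset_collapse_HW assms] .

lemma realization_collapse_mixed:
  "geometric_realization (HW_sset E l) homotopy_equivalent_space
     geometric_realization (collapse_sset (HW_sset E l) (mixed l) None)"
proof (rule sset_collapse.homotopy_equivalent_collapse[OF sset_collapse_HW,
      where q = "\<lambda>n \<sigma>. if \<sigma> \<in> mixed l n then None else \<sigma>" and lift = "\<lambda>n \<sigma>. \<sigma>"])
qed (auto simp: mixed_face mixed_degen_iff mixed_iff HW_sset_simps)

end

section \<open>The product as a metric fibration\<close>

lemma mdist_l1_prod_metric_prod:
  "mdist (l1_prod_metric X Y) u v = mdist X (fst u) (fst v) + mdist Y (snd u) (snd v)"
  by (cases u; cases v) simp

text \<open>Transport in the product keeps the first coordinate; the distance condition alone forces
  this, which gives uniqueness.\<close>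

lemma metric_fibration_l1_prod: "metric_fibration (l1_prod_metric F B) B snd"
  unfolding metric_fibration_def
proof (intro conjI ballI)
  show "Lipschitz_continuous_map (l1_prod_metric F B) B snd"
    unfolding Lipschitz_continuous_map_def
    by (intro conjI exI[of _ 1]) (auto simp: mdist_l1_prod_metric_prod)
next
  fix u c assume u: "u \<in> mspace (l1_prod_metric F B)" and c: "c \<in> mspace B"
  have fib: "v \<in> mspace (fiber (l1_prod_metric F B) snd c) \<longleftrightarrow> fst v \<in> mspace F \<and> snd v = c" for v
    using c by (auto simp: fiber_def mem_Times_iff)
  show "\<exists>!v. v \<in> mspace (fiber (l1_prod_metric F B) snd c) \<and>
      mdist (l1_prod_metric F B) u v = mdist B (snd u) c \<and>
      (\<forall>w \<in> mspace (fiber (l1_prod_metric F B) snd c).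
        mdist (l1_prod_metric F B) u w = mdist (l1_prod_metric F B) u v + mdist (l1_prod_metric F B) v w)"
  proof (rule ex1I[of _ "(fst u, c)"])
    show "(fst u, c) \<in> mspace (fiber (l1_prod_metric F B) snd c) \<and>
      mdist (l1_prod_metric F B) u (fst u, c) = mdist B (snd u) c \<and>
      (\<forall>w \<in> mspace (fiber (l1_prod_metric F B) snd c).
        mdist (l1_prod_metric F B) u w = mdist (l1_prod_metric F B) u (fst u, c) + mdist (l1_prod_metric F B) (fst u, c) w)"
      using u c by (auto simp: fib mdist_l1_prod_metric_prod mdist_refl)
  next
    fix v assume "v \<in> mspace (fiber (l1_prod_metric F B) snd c) \<and>
      mdist (l1_prod_metric F B) u v = mdist B (snd u) c \<and>
      (\<forall>w \<in> mspace (fiber (l1_prod_metric F B) snd c).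
        mdist (l1_prod_metric F B) u w = mdist (l1_prod_metric F B) u v + mdist (l1_prod_metric F B) v w)"
    then show "v = (fst u, c)"
      using u by (auto simp: fib mdist_l1_prod_metric_prod prod_eq_iff)
  qed
qed

section \<open>Developing tuples of the product into \<open>E\<close>\<close>

locale based_fibration = fibration E B p for E :: "'e metric" and B :: "'b metric" and p :: "'e \<Rightarrow> 'b" +
  fixes b :: 'b
  assumes b_in: "b \<in> mspace B"
begin

abbreviation F :: "'e metric" where
  "F \<equiv> fiber E p b"

abbreviation FB :: "('e \<times> 'b) metric" where
  "FB \<equiv> l1_prod_metric F B"

sublocale product: fibration FB B snd
  by unfold_locales (rule metric_fibration_l1_prod)

lemma mdist_F [simp]: "mdist F = mdist E"
  by (simp add: fiber_def)

lemma product_moves: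
  "product.moves_base u v \<longleftrightarrow> snd u \<noteq> snd v" "product.moves_fiber u v \<longleftrightarrow> mdist E (fst u) (fst v) \<noteq> 0"
  by (simp_all add: product.moves_base_def product.moves_fiber_def mdist_l1_prod_metric_prod)

text \<open>An isometry \<open>g\<close> from the reference fiber \<open>F\<close> onto the fiber
  over \<open>c\<close>, with inverse \<open>h\<close>. Framings arise by transport along a base
  path and so record the accumulated holonomy.\<close>

definition framing :: "('e \<Rightarrow> 'e) \<Rightarrow> ('e \<Rightarrow> 'e) \<Rightarrow> 'b \<Rightarrow> bool" where
  "framing g h c \<longleftrightarrow> c \<in> mspace B \<and>
     (\<forall>z \<in> mspace F. g z \<in> mspace E \<and> p (g z) = c \<and> h (g z) = z) \<and>
     (\<forall>x \<in> mspace E. p x = c \<longrightarrow> h x \<in> mspace F \<and> g (h x) = x) \<and>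
     (\<forall>z \<in> mspace F. \<forall>z' \<in> mspace F. mdist E (g z) (g z') = mdist E z z')"

lemma framing_id: "framing (\<lambda>z. z) (\<lambda>x. x) b"
  by (auto simp: framing_def b_in mspace_fiber_iff)

lemma framingD:
  assumes "framing g h c"
  shows "c \<in> mspace B" "z \<in> mspace F \<Longrightarrow> g z \<in> mspace E" "z \<in> mspace F \<Longrightarrow> p (g z) = c"
    "z \<in> mspace F \<Longrightarrow> h (g z) = z" "\<lbrakk>x \<in> mspace E; p x = c\<rbrakk> \<Longrightarrow> h x \<in> mspace F"
    "\<lbrakk>x \<in> mspace E; p x = c\<rbrakk> \<Longrightarrow> g (h x) = x"
    "\<lbrakk>z \<in> mspace F; z' \<in> mspace F\<rbrakk> \<Longrightarrow> mdist E (g z) (g z') = mdist E z z'"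
  using assms by (auto simp: framing_def)

lemma framing_transport:
  assumes fr: "framing g h c" and c': "c' \<in> mspace B"
  shows "framing (\<lambda>z. transport (g z) c') (\<lambda>x. h (transport x c)) c'"
  unfolding framing_def
proof (intro conjI ballI impI)
  note fr = framingD[OF fr]
  show "c' \<in> mspace B" by fact
  show "transport (g z) c' \<in> mspace E" "p (transport (g z) c') = c'" if "z \<in> mspace F" for z
    using transport_in proj_transport fr that c' by auto
  show "h (transport (transport (g z) c') c) = z" if "z \<in> mspace F" for z
    using transport_transport_back[of "g z" c'] fr that c' by auto
  show "h (transport x c) \<in> mspace F" if "x \<in> mspace E" "p x = c'" for x
    using transport_in proj_transport fr that by auto
  show "transport (g (h (transport x c))) c' = x" if "x \<in> mspace E" "p x = c'" for x
    using transport_transport_back[of x c] transport_in[of x c] proj_transport[of x c] fr that by auto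
  show "mdist E (transport (g z) c') (transport (g z') c') = mdist E z z'"
    if "z \<in> mspace F" "z' \<in> mspace F" for z z'
    using mdist_transport_transport[of "g z" "g z'" c'] fr that c' by simp
qed

text \<open>The fiber coordinate of each entry is carried from \<open>F\<close> along the whole base
  path up to that entry, not directly to its base point.\<close>

fun develop :: "('e \<Rightarrow> 'e) \<Rightarrow> ('e \<times> 'b) list \<Rightarrow> 'e list" where
  "develop g [] = []"
| "develop g (u # us) = transport (g (fst u)) (snd u) # develop (\<lambda>z. transport (g z) (snd u)) us"

text \<open>Here \<open>h\<close> and \<open>c\<close> record how to return to \<open>F\<close>
  backwards along the base path traversed so far.\<close>

fun undevelop :: "('e \<Rightarrow> 'e) \<Rightarrow> 'b \<Rightarrow> 'e list \<Rightarrow> ('e \<times> 'b) list" where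
  "undevelop h c [] = []"
| "undevelop h c (x # xs) = (h (transport x c), p x) # undevelop (\<lambda>y. h (transport y c)) (p x) xs"

lemma length_develop [simp]: "length (develop g us) = length us"
  by (induction us arbitrary: g) auto

lemma length_undevelop [simp]: "length (undevelop h c xs) = length xs"
  by (induction xs arbitrary: h c) auto

lemma develop_in:
  "\<lbrakk>framing g h c; set us \<subseteq> mspace FB\<rbrakk> \<Longrightarrow> set (develop g us) \<subseteq> mspace E"
proof (induction us arbitrary: g h c)
  case (Cons u us)
  then show ?case
    using Cons.IH[OF framing_transport[OF Cons.prems(1)], of "snd u"] framingD(2)[OF framing_transport[OF Cons.prems(1)]]
    by auto
qed simp

lemma undevelop_in:
  "\<lbrakk>framing g h c; set xs \<subseteq> mspace E\<rbrakk> \<Longrightarrow> set (undevelop h c xs) \<subseteq> mspace FB"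
proof (induction xs arbitrary: g h c)
  case (Cons x xs)
  then have x: "x \<in> mspace E" by auto
  note fr = framing_transport[OF Cons.prems(1) proj_in[OF x]]
  show ?case
    using framingD(5)[OF fr x refl] Cons.IH[OF fr] Cons.prems(2) x by simp
qed simp

lemma undevelop_develop:
  "\<lbrakk>framing g h c; set us \<subseteq> mspace FB\<rbrakk> \<Longrightarrow> undevelop h c (develop g us) = us"
proof (induction us arbitrary: g h c)
  case (Cons u us)
  then have u: "fst u \<in> mspace F" "snd u \<in> mspace B" by auto
  note fr = framing_transport[OF Cons.prems(1) u(2)]
  show ?case
    using framingD(3,4)[OF fr u(1)] Cons.IH[OF fr] Cons.prems(2) by simp
qed simp

lemma develop_undevelop:
  "\<lbrakk>framing g h c; set xs \<subseteq> mspace E\<rbrakk> \<Longrightarrow> develop g (undevelop h c xs) = xs"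
proof (induction xs arbitrary: g h c)
  case (Cons x xs)
  then have x: "x \<in> mspace E" by auto
  note fr = framing_transport[OF Cons.prems(1) proj_in[OF x]]
  show ?case
    using framingD(6)[OF fr x refl] Cons.IH[OF fr] Cons.prems(2) by simp
qed simp

text \<open>Framings obtained along different base paths are compared on \<open>F\<close> only, not
  as total functions.\<close>

lemma develop_cong:
  "\<lbrakk>\<And>z. z \<in> mspace F \<Longrightarrow> g z = g' z; set us \<subseteq> mspace FB\<rbrakk> \<Longrightarrow> develop g us = develop g' us"
proof (induction us arbitrary: g g')
  case (Cons u us)
  then have "develop (\<lambda>z. transport (g z) (snd u)) us = develop (\<lambda>z. transport (g' z) (snd u)) us"
    by (intro Cons.IH) auto
  with Cons.prems show ?case by auto
qed simp

text \<open>Isolates the framing accumulated along a prefix, so that an inner deletion can be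
  studied at its own place.\<close>

lemma develop_append:
  "\<lbrakk>framing g h c; set us \<subseteq> mspace FB\<rbrakk> \<Longrightarrow>
     \<exists>g' h' c'. framing g' h' c' \<and> (\<forall>vs. develop g (us @ vs) = develop g us @ develop g' vs)"
proof (induction us arbitrary: g h c)
  case (Cons u us)
  then have "snd u \<in> mspace B" "set us \<subseteq> mspace FB" by auto
  from Cons.IH[OF framing_transport[OF Cons.prems(1) this(1)] this(2)] show ?case by simp
qed auto

text \<open>The distance splits at the transport of \<open>g (fst u)\<close> to \<open>c'\<close>;
  the fiber part is unchanged because framings are isometries.\<close>

lemma develop_step:
  assumes "framing g h c" "u \<in> mspace FB" "c' \<in> mspace B" "f' \<in> mspace F"
  shows "mdist E (g (fst u)) (transport (g f') c') = mdist E (fst u) f' + mdist B c c'"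
proof -
  have u: "fst u \<in> mspace F" using assms by auto
  note fr = framingD[OF assms(1)] and fr' = framingD[OF framing_transport[OF assms(1,3)]]
  have "mdist E (g (fst u)) (transport (g f') c') = mdist B c c' + mdist E (transport (g (fst u)) c') (transport (g f') c')"
    using mdist_via_transport[of "g (fst u)" c' "transport (g f') c'"] fr(2,3)[OF u] fr'(2,3)[OF assms(4)] assms(3) by simp
  then show ?thesis using fr'(7)[OF u assms(4)] by simp
qed

lemma develop_Cons_Cons:
  assumes fr: "framing g h c" and uv: "u \<in> mspace FB" "v \<in> mspace FB"
  defines "x \<equiv> transport (g (fst u)) (snd u)"
    and "y \<equiv> transport (transport (g (fst v)) (snd u)) (snd v)"
  shows "mdist E x y = mdist FB u v"
    "moves_base x y \<longleftrightarrow> product.moves_base u v" "moves_fiber x y \<longleftrightarrow> product.moves_fiber u v"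
proof -
  have uv': "snd u \<in> mspace B" "fst u \<in> mspace F" "snd v \<in> mspace B" "fst v \<in> mspace F" using uv by auto
  note fr1 = framing_transport[OF fr uv'(1)] and fr2 = framing_transport[OF framing_transport[OF fr uv'(1)] uv'(3)]
  show d: "mdist E x y = mdist FB u v"
    using develop_step[OF fr1 uv(1) uv'(3,4)] by (simp add: x_def y_def mdist_l1_prod_metric_prod)
  have p: "p x = snd u" "p y = snd v"
    using framingD(3)[OF fr1 uv'(2)] framingD(3)[OF fr2 uv'(4)] by (simp_all add: x_def y_def)
  show "moves_base x y \<longleftrightarrow> product.moves_base u v"
    by (simp add: moves_base_def product_moves p)
  show "moves_fiber x y \<longleftrightarrow> product.moves_fiber u v"
    using d by (simp add: moves_fiber_def product.moves_fiber_def p)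
qed

text \<open>Lengths and moves involve neighbouring entries only, which differ by a single transport;
  holonomy shows up only between entries further apart.\<close>

lemma develop_steps:
  "\<lbrakk>framing g h c; set us \<subseteq> mspace FB\<rbrakk> \<Longrightarrow>
     path_len E (develop g us) = path_len FB us \<and> fiber_steps (develop g us) = product.fiber_steps us \<and>
     (base_before_fiber (develop g us) \<longleftrightarrow> product.base_before_fiber us)"
proof (induction us arbitrary: g h c rule: induct_list012)
  case (3 u v us)
  then have "snd u \<in> mspace B" by auto
  from framing_transport[OF "3.prems"(1) this] "3.IH"(2) "3.prems"(2)
  have "path_len E (develop (\<lambda>z. transport (g z) (snd u)) (v # us)) = path_len FB (v # us) \<and>
      fiber_steps (develop (\<lambda>z. transport (g z) (snd u)) (v # us)) = product.fiber_steps (v # us) \<and>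
      (base_before_fiber (develop (\<lambda>z. transport (g z) (snd u)) (v # us)) \<longleftrightarrow> product.base_before_fiber (v # us))"
    by fastforce
  then show ?case
    using develop_Cons_Cons[OF "3.prems"(1), of u v] "3.prems"(2) by simp
qed auto

text \<open>An inner face that survives in the product skips a base point on a geodesic, and
  transport along base geodesics composes. Hence the later entries are developed alike with or
  without it.\<close>

lemma develop_delete_nth:
  assumes fr: "framing g h c" and us: "set us \<subseteq> mspace FB" "i < length us" "2 \<le> length us"
    and eq: "path_len FB (delete_nth i us) = path_len FB us"
  shows "develop g (delete_nth i us) = delete_nth i (develop g us)"
  using us(2,3,1) eq
proof (cases rule: path_len_delete_nth_eqE)
  case (first v ws)
  then have v: "fst v \<in> mspace F" "snd v \<in> mspace B" and ws: "set ws \<subseteq> mspace FB" using us by auto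
  note fr1 = framingD[OF framing_transport[OF fr v(2)]]
  have stay: "transport (transport (g z) (snd v)) (snd v) = transport (g z) (snd v)" if "z \<in> mspace F" for z
    using transport_unique[of "transport (g z) (snd v)" "transport (g z) (snd v)"] fr1(2,3)[OF that] v
    by (simp add: mdist_refl)
  have "develop (\<lambda>z. transport (transport (g z) (snd v)) (snd v)) ws = develop (\<lambda>z. transport (g z) (snd v)) ws"
    by (rule develop_cong[OF stay ws])
  then show ?thesis using first stay[OF v(1)] by (simp add: delete_nth_def)
next
  case (last vs v)
  then have "set vs \<subseteq> mspace FB" using us by auto
  then obtain g' where g': "\<And>ws. develop g (vs @ ws) = develop g vs @ develop g' ws"
    using develop_append[OF fr] by blast
  then show ?thesis
    using last delete_nth_append(2)[of "develop g vs" _ _ "[]"] by simp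
next
  case (mid vs u v w ws)
  then have "set vs \<subseteq> mspace FB" using us by auto
  then obtain g' h' c' where fr': "framing g' h' c'" and g': "\<And>ws. develop g (vs @ ws) = develop g vs @ develop g' ws"
    using develop_append[OF fr] by blast
  have uvw: "fst u \<in> mspace F" "snd u \<in> mspace B" "fst v \<in> mspace F" "snd v \<in> mspace B"
    "fst w \<in> mspace F" "snd w \<in> mspace B" and ws: "set ws \<subseteq> mspace FB"
    using mid us by auto
  \<comment> \<open>Equality in a sum of two triangle inequalities forces equality in each.\<close>
  have "mdist B (snd u) (snd w) = mdist B (snd u) (snd v) + mdist B (snd v) (snd w)"
    using mid(4) mdist_triangle[of "snd u" B "snd v" "snd w"] mdist_triangle[of "fst u" F "fst v" "fst w"] uvw
    by (simp add: mdist_l1_prod_metric_prod)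
  then have compose: "transport (transport x (snd v)) (snd w) = transport x (snd w)"
    if x: "x \<in> mspace E" "p x = snd u" for x
  proof -
    let ?y = "transport x (snd v)"
    let ?z = "transport ?y (snd w)"
    note y = transport[OF x(1) uvw(4)] and z = transport[OF transport_in[OF x(1) uvw(4)] uvw(6)]
    \<comment> \<open>Being no further from \<open>x\<close> than the base distance,
      \<open>?z\<close> is its transport.\<close>
    have "mdist E x ?z \<le> mdist B (snd u) (snd w)"
      using mdist_triangle[OF x(1) y(1) z(1)] y(2,3) z(3) x(2)
        \<open>mdist B (snd u) (snd w) = mdist B (snd u) (snd v) + mdist B (snd v) (snd w)\<close> by simp
    moreover have "mdist B (snd u) (snd w) \<le> mdist E x ?z"
      using mdist_proj_le[OF x(1) z(1)] z(2) x(2) by simp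
    ultimately show ?thesis
      using transport_unique[OF x(1) z(1)] z(2) x(2) by simp
  qed
  note fr1 = framingD[OF framing_transport[OF fr' uvw(2)]]
  let ?g = "\<lambda>z. transport (g' z) (snd u)"
  have "transport (transport (?g z) (snd v)) (snd w) = transport (?g z) (snd w)" if "z \<in> mspace F" for z
    using compose fr1(2,3)[OF that] by blast
  moreover from this have "develop (\<lambda>z. transport (transport (?g z) (snd v)) (snd w)) ws = develop (\<lambda>z. transport (?g z) (snd w)) ws"
    using ws by (intro develop_cong)
  ultimately show ?thesis
    using mid(1-3) g' uvw delete_nth_append(2)[of "develop g vs"] by simp
qed

text \<open>A face of a development may survive although the corresponding face in the product is the base
  point, but only because of holonomy, and then it is mixed.\<close>

lemma path_len_delete_nth_develop:
  assumes fr: "framing g h c" and us: "set us \<subseteq> mspace FB" "i < length us" "2 \<le> length us"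
    and eq: "path_len E (delete_nth i (develop g us)) = path_len E (develop g us)"
    and unmixed: "\<not> base_before_fiber (delete_nth i (develop g us))"
  shows "path_len FB (delete_nth i us) = path_len FB us"
  using us(2,3)
proof (cases rule: delete_nth_cases)
  case (first u v ws)
  then show ?thesis
    using eq develop_Cons_Cons(1)[OF fr, of u v] us(1) by (simp add: delete_nth_def)
next
  case (last vs u v)
  then have "set vs \<subseteq> mspace FB" using us by auto
  then obtain g' h' c' where fr': "framing g' h' c'" and g': "\<And>ws. develop g (vs @ ws) = develop g vs @ develop g' ws"
    using develop_append[OF fr] by blast
  have "mdist E (transport (g' (fst u)) (snd u)) (transport (transport (g' (fst v)) (snd u)) (snd v)) = 0"
    using eq last g' delete_nth_append(2)[of "develop g vs" _ _ "[]"]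
      path_len_append[of E "develop g vs" _ "[transport (transport (g' (fst v)) (snd u)) (snd v)]"] by simp
  then have "mdist FB u v = 0"
    using develop_Cons_Cons(1)[OF fr', of u v] last us(1) by simp
  then show ?thesis using last path_len_append[of FB vs u "[v]"] by simp
next
  case (mid vs u v w ws)
  then have "set vs \<subseteq> mspace FB" using us by auto
  then obtain g' h' c' where fr': "framing g' h' c'" and g': "\<And>ws. develop g (vs @ ws) = develop g vs @ develop g' ws"
    using develop_append[OF fr] by blast
  have FB: "u \<in> mspace FB" "v \<in> mspace FB" "w \<in> mspace FB" using mid us by auto
  then have uvw: "fst u \<in> mspace F" "snd u \<in> mspace B" "fst v \<in> mspace F" "snd v \<in> mspace B"
    "fst w \<in> mspace F" "snd w \<in> mspace B" by auto
  define g1 where "g1 z = transport (g' z) (snd u)" for z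
  define g2 where "g2 z = transport (g1 z) (snd v)" for z
  define g3 where "g3 z = transport (g2 z) (snd w)" for z
  obtain h1 h2 h3 where fr1: "framing g1 h1 (snd u)" and fr2: "framing g2 h2 (snd v)" and fr3: "framing g3 h3 (snd w)"
    using framing_transport[OF fr' uvw(2)] framing_transport[OF framing_transport[OF fr' uvw(2)] uvw(4)]
      framing_transport[OF framing_transport[OF framing_transport[OF fr' uvw(2)] uvw(4)] uvw(6)]
    unfolding g1_def[symmetric] g2_def[symmetric] g3_def[symmetric] by blast
  let ?x = "g1 (fst u)" and ?y = "g2 (fst v)" and ?z = "g3 (fst w)"
  have dev: "develop g us = develop g vs @ ?x # ?y # ?z # develop g3 ws"
  proof -
    have "g3 = (\<lambda>z. transport (transport (transport (g' z) (snd u)) (snd v)) (snd w))"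
      by (simp add: fun_eq_iff g1_def g2_def g3_def)
    then show ?thesis using mid(1) g' by (simp add: g1_def g2_def)
  qed
  have del: "delete_nth i (develop g us) = develop g vs @ ?x # ?z # develop g3 ws"
    using dev mid(2) delete_nth_append(2)[of "develop g vs" ?x ?y] by simp
  have xyz: "?x \<in> mspace E" "?y \<in> mspace E" "?z \<in> mspace E"
    "p ?x = snd u" "p ?y = snd v" "p ?z = snd w"
    using framingD(2,3)[OF fr1 uvw(1)] framingD(2,3)[OF fr2 uvw(3)] framingD(2,3)[OF fr3 uvw(5)] by simp_all
  have bet: "mdist E ?x ?z = mdist E ?x ?y + mdist E ?y ?z"
    using eq unfolding del unfolding dev
    by (simp add: path_len_append[of E _ ?x "?y # ?z # develop g3 ws"] path_len_append[of E _ ?x "?z # develop g3 ws"])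
  have xy: "mdist E ?x ?y = mdist FB u v"
    using develop_step[OF fr1 FB(1) uvw(4,3)] by (simp add: g2_def mdist_l1_prod_metric_prod)
  have yz: "mdist E ?y ?z = mdist FB v w"
    using develop_step[OF fr2 FB(2) uvw(6,5)] by (simp add: g3_def mdist_l1_prod_metric_prod)
  \<comment> \<open>A merged step with both moves would make the face mixed.\<close>
  have "\<not> (moves_base ?x ?z \<and> moves_fiber ?x ?z)"
    using unmixed base_before_fiber_append[of "develop g vs" ?x "?z # develop g3 ws"] unfolding del by auto
  then consider (vertical) "\<not> moves_base ?x ?z" | (horizontal) "\<not> moves_fiber ?x ?z" by blast
  then have "mdist FB u w = mdist FB u v + mdist FB v w"
  proof cases
    case vertical
    \<comment> \<open>Without a base move the transports in between are trivial on the fibers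
      concerned, so both ends are seen in the same framing.\<close>
    then have s: "snd u = snd v" "snd v = snd w"
      using moves_base_between[OF xyz(1-3) bet] xyz by (auto simp: moves_base_def)
    have stay: "transport x (p x) = x" if "x \<in> mspace E" for x
      using transport_unique[OF that that] that by (simp add: mdist_refl)
    have "g3 z = g1 z" if "z \<in> mspace F" for z
      using framingD(2,3)[OF fr1 that] stay[of "g1 z"] s by (simp add: g2_def g3_def)
    then have "mdist E ?x ?z = mdist FB u w"
      using framingD(7)[OF fr1 uvw(1,5)] uvw s by (simp add: mdist_l1_prod_metric_prod mdist_refl)
    then show ?thesis using bet xy yz by simp
  next
    case horizontal
    \<comment> \<open>Both partial steps are horizontal as well, so the first coordinates agree, and
      the base path is geodesic.\<close>
    then have "\<not> moves_fiber ?x ?y" "\<not> moves_fiber ?y ?z"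
      using moves_fiber_between[OF xyz(1-3) bet] by blast+
    then have "mdist E (fst u) (fst v) = 0" "mdist E (fst v) (fst w) = 0"
      using xy yz xyz by (auto simp: moves_fiber_def mdist_l1_prod_metric_prod)
    then have "fst u = fst v" "fst v = fst w"
      using uvw by (auto simp: mspace_fiber_iff)
    then show ?thesis
      using base_between_if_horizontal[OF xyz(1-3) bet horizontal] xyz uvw
      by (simp add: mdist_l1_prod_metric_prod mspace_fiber_iff mdist_refl)
  qed
  then show ?thesis
    using mid path_len_append[of FB vs u "v # w # ws"] path_len_append[of FB vs u "w # ws"] by simp
qed

lemma develop_repeat_nth:
  assumes fr: "framing g h c" and us: "set us \<subseteq> mspace FB" "i < length us"
  shows "develop g (repeat_nth i us) = repeat_nth i (develop g us)"
proof -
  define vs ws where "vs = take i us" and "ws = drop (Suc i) us"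
  obtain u where u: "us = vs @ u # ws" and len: "length vs = i"
    using us id_take_nth_drop[of i us] by (auto simp: vs_def ws_def)
  have "set vs \<subseteq> mspace FB" using us u by auto
  then obtain g' h' c' where fr': "framing g' h' c'" and g': "\<And>ws. develop g (vs @ ws) = develop g vs @ develop g' ws"
    using develop_append[OF fr] by blast
  have fu: "fst u \<in> mspace F" "snd u \<in> mspace B" and ws: "set ws \<subseteq> mspace FB" using us u by auto
  note fr1 = framingD[OF framing_transport[OF fr' fu(2)]]
  have stay: "transport (transport (g' z) (snd u)) (snd u) = transport (g' z) (snd u)" if "z \<in> mspace F" for z
    using transport_unique[of "transport (g' z) (snd u)" "transport (g' z) (snd u)"] fr1(2,3)[OF that] fu
    by (simp add: mdist_refl)
  have "develop (\<lambda>z. transport (transport (g' z) (snd u)) (snd u)) ws = develop (\<lambda>z. transport (g' z) (snd u)) ws"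
    by (rule develop_cong[OF stay ws])
  then show ?thesis
    using repeat_nth_append[of vs u ws] repeat_nth_append[of "develop g vs" _ "develop (\<lambda>z. transport (g' z) (snd u)) ws"]
      u len g' stay[OF fu(1)] by simp
qed

abbreviation dev :: "('e \<times> 'b) list \<Rightarrow> 'e list" where
  "dev \<equiv> develop (\<lambda>z. z)"

definition develop_simplex :: "real \<Rightarrow> nat \<Rightarrow> ('e \<times> 'b) list option \<Rightarrow> 'e list option" where
  "develop_simplex l n \<tau> = (if \<tau> \<in> product.mixed l n then None else map_option dev \<tau>)"

lemma develop_simplex_simps [simp]:
  "develop_simplex l n None = None"
  "Some us \<in> ssimplices (HW_sset FB l) n \<Longrightarrow>
     develop_simplex l n (Some us) = (if product.base_before_fiber us then None else Some (dev us))"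
  by (simp_all add: develop_simplex_def product.mixed_iff)

lemma dev_in_HW:
  assumes "Some us \<in> ssimplices (HW_sset FB l) n"
  shows "Some (dev us) \<in> ssimplices (HW_sset E l) n"
    "base_before_fiber (dev us) \<longleftrightarrow> product.base_before_fiber us"
  using assms develop_in[OF framing_id, of us] develop_steps[OF framing_id, of us] by (auto simp: HW_sset_simps)

text \<open>Development commutes with faces only modulo mixed tuples, so its target is the collapse
  of \<open>HW_sset E l\<close>. On unmixed simplices it is bijective, with \<open>undevelop\<close>
  as inverse.\<close>

lemma realization_product_collapse:
  "geometric_realization (HW_sset FB l) homotopy_equivalent_space
     geometric_realization (collapse_sset (HW_sset E l) (mixed l) None)"
  (is "_ homotopy_equivalent_space geometric_realization ?Q")
proof (rule sset_collapse.homotopy_equivalent_collapse[OF product.sset_collapse_HW,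
      where q = "develop_simplex l" and lift = "\<lambda>n. map_option (undevelop (\<lambda>x. x) b)"])
  fix n and \<tau> :: "('e \<times> 'b) list option"
  assume \<tau>: "\<tau> \<in> ssimplices (HW_sset FB l) n"
  show "develop_simplex l n \<tau> \<in> ssimplices ?Q n"
    using \<tau> dev_in_HW by (cases \<tau>) (auto simp: mixed_iff)
  show "map_option (undevelop (\<lambda>x. x) b) (develop_simplex l n \<tau>) = (if \<tau> \<in> product.mixed l n then None else \<tau>)"
    using \<tau> undevelop_develop[OF framing_id] by (cases \<tau>) (auto simp: product.mixed_iff HW_sset_simps)
  show "develop_simplex l (Suc n) (sdegen (HW_sset FB l) n i \<tau>) = sdegen ?Q n i (develop_simplex l n \<tau>)"
    if i: "i \<le> n" for i
    using \<tau>
  proof (cases rule: ssimplices_HW_cases)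
    case (2 us)
    have "sdegen (HW_sset FB l) n i \<tau> \<in> product.mixed l (Suc n) \<longleftrightarrow> \<tau> \<in> product.mixed l n"
      by (rule product.mixed_degen_iff[OF \<tau> i])
    moreover have "sdegen (HW_sset E l) n i (Some (dev us)) \<in> mixed l (Suc n) \<longleftrightarrow> Some (dev us) \<in> mixed l n"
      using mixed_degen_iff[OF dev_in_HW(1) i] \<tau> 2 by simp
    moreover have "dev (repeat_nth i us) = repeat_nth i (dev us)"
      using 2 i by (intro develop_repeat_nth[OF framing_id]) auto
    ultimately show ?thesis
      using 2 \<tau> dev_in_HW[of us l n] by (auto simp: develop_simplex_def HW_sset_simps mixed_iff product.mixed_iff)
  qed (simp add: HW_sset_simps develop_simplex_def mixed_iff product.mixed_iff)
next
  fix n i and \<tau> :: "('e \<times> 'b) list option"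
  assume \<tau>: "\<tau> \<in> ssimplices (HW_sset FB l) (Suc n)" and i: "i \<le> Suc n"
  show "develop_simplex l n (sface (HW_sset FB l) (Suc n) i \<tau>) = sface ?Q (Suc n) i (develop_simplex l (Suc n) \<tau>)"
  proof (cases "\<tau> \<in> product.mixed l (Suc n)")
    case True
    then show ?thesis
      using product.mixed_face[OF True i] by (simp add: develop_simplex_def HW_sset_simps)
  next
    case False
    obtain us where us: "\<tau> = Some us" "length us = Suc (Suc n)" "set us \<subseteq> mspace FB" "path_len FB us = l"
      "\<not> product.base_before_fiber us"
      using \<tau> False by (cases rule: ssimplices_HW_cases) (auto simp: product.mixed_iff HW_sset_simps)
    have q: "develop_simplex l (Suc n) \<tau> = Some (dev us)"
      using us False by (simp add: develop_simplex_def)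
    have len: "path_len E (dev us) = l"
      using develop_steps[OF framing_id us(3)] us(4) by simp
    show ?thesis
    proof (cases "path_len FB (delete_nth i us) = l")
      case True
      then have "Some (delete_nth i us) \<in> ssimplices (HW_sset FB l) n"
        using us i set_delete_nth[of i us] by (auto simp: HW_sset_simps length_delete_nth)
      note this dev_in_HW[OF this]
      moreover have "dev (delete_nth i us) = delete_nth i (dev us)"
        using us i True by (intro develop_delete_nth[OF framing_id]) auto
      ultimately show ?thesis
        using us q True by (simp add: HW_sset_simps mixed_iff)
    next
      case face: False
      \<comment> \<open>The face in the product is the base point. In \<open>E\<close> it either is
        the base point too or survives through holonomy, and then it is mixed and collapsed.\<close>
      have "sface (HW_sset E l) (Suc n) i (Some (dev us)) \<in> mixed l n"
      proof (cases "path_len E (delete_nth i (dev us)) = l")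
        case True
        then have "base_before_fiber (delete_nth i (dev us))"
          using path_len_delete_nth_develop[OF framing_id us(3), of i] us i len face by auto
        then show ?thesis
          using True us i develop_in[OF framing_id us(3)] set_delete_nth[of i "dev us"]
          by (auto simp: HW_sset_simps mixed_iff length_delete_nth)
      qed (simp add: HW_sset_simps mixed_iff)
      then show ?thesis
        using us q face by (simp add: HW_sset_simps)
    qed
  qed
next
  fix n \<sigma> assume \<sigma>: "\<sigma> \<in> ssimplices ?Q n"
  have "map_option (undevelop (\<lambda>x. x) b) \<sigma> \<in> ssimplices (HW_sset FB l) n \<and>
    develop_simplex l n (map_option (undevelop (\<lambda>x. x) b) \<sigma>) = \<sigma>"
  proof (cases \<sigma>)
    case (Some xs)
    then have xs: "Some xs \<in> ssimplices (HW_sset E l) n" "\<not> base_before_fiber xs"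
      using \<sigma> by (auto simp: mixed_iff)
    then have in_E: "set xs \<subseteq> mspace E" by (simp add: HW_sset_simps)
    let ?us = "undevelop (\<lambda>x. x) b xs"
    have "set ?us \<subseteq> mspace FB" and "dev ?us = xs"
      using undevelop_in[OF framing_id in_E] develop_undevelop[OF framing_id in_E] by simp_all
    moreover from this have "path_len FB ?us = path_len E xs" "\<not> product.base_before_fiber ?us"
      using develop_steps[OF framing_id, of ?us] xs by simp_all
    ultimately show ?thesis
      using Some xs by (simp add: HW_sset_simps)
  qed (simp add: HW_sset_simps)
  then show "map_option (undevelop (\<lambda>x. x) b) \<sigma> \<in> ssimplices (HW_sset FB l) n"
    "develop_simplex l n (map_option (undevelop (\<lambda>x. x) b) \<sigma>) = \<sigma>"
    by blast+
qed

end

theorem corollary3p9: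
  fixes E :: "'e metric" and B :: "'b metric" and \<pi> :: "'e \<Rightarrow> 'b" and b :: 'b and l :: real
  assumes "metric_fibration E B \<pi>"
    and "b \<in> mspace B"
    and "0 \<le> l"
  shows "geometric_realization (HW_sset E l) homotopy_equivalent_space
         geometric_realization (HW_sset (l1_prod_metric (fiber E \<pi> b) B) l)"
proof -
  interpret based_fibration E B \<pi> b
    using assms by unfold_locales
  show ?thesis
    using homotopy_eqv_trans[OF realization_collapse_mixed
        homotopy_equivalent_space_sym[THEN iffD1, OF realization_product_collapse]] .
qed

end
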